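(* Let $R$ be a discrete valuation ring with fraction field $F$ of characteristic zero, finite residue field, and uniformizer $\pi$. Let $G$ be a finite group, $H$ a subgroup, and $M$ an $R[H]$-lattice such that $FM$ is free of rank $1$ over $F[H]$. Suppose there exist integers $0=n_0<n_1<\cdots<n_r$ and subgroups $\{e\}=P_0\subsetneq P_1\subsetneq\cdots\subsetneq P_r\subseteq H$ such that $\mathfrak{A}(F[H],M)=\sum_{i=0}^r\pi^{-n_i}R[H]\mathrm{Tr}_{P_i}$. Then: (i) $\mathrm{Ind}_H^G\mathfrak{A}(F[H],M)=\sum_{i=0}^r\pi^{-n_i}R[G]\mathrm{Tr}_{P_i}$; (ii) $\mathfrak{A}(F[G],\mathrm{Ind}_H^GM)=\sum_{i=0}^r\pi^{-n_i}R[G]\mathrm{Tr}_{\mathrm{ncl}_G(P_i)}$; (iii) $\mathrm{Ind}_H^G\mathfrak{A}(F[H],M)$ is a ring if and only if $P_i$ is normal in $G$ for every $i$; (iv) if every $P_i$ is normal in $G$ and $M$ is free over $\mathfrak{A}(F[H],M)$, then $\mathrm{Ind}_H^G\mathfrak{A}(F[H],M)$ is free over $\mathfrak{A}(F[G],\mathrm{Ind}_H^GM)$; (v) if $H$ is abelian and normal in $G$ and $\mathrm{Ind}_H^GM$ is projective over $\mathfrak{A}(F[G],\mathrm{Ind}_H^GM)$, then every $P_i$ is normal in $G$.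
   Context: An $R[H]$-lattice is an $R[H]$-module finitely generated and torsion-free over $R$. For an $F$-algebra $A$ and lattice $L$ in an $A$-module, $\mathfrak{A}(A,L)=\{\lambda\in A:\lambda L\subseteq L\}$. $\mathrm{Ind}_H^GX=R[G]\otimes_{R[H]}X$; $\mathrm{Ind}_H^GM$ is a lattice in the free rank-one $F[G]$-module $F[G]\otimes_{F[H]}FM$, and $\mathrm{Ind}_H^G\mathfrak{A}(F[H],M)$ is regarded as a subset of $F[G]$. $\mathrm{Tr}_P=\sum_{k\in P}k$, and $\mathrm{ncl}_G(P)$ is the normal closure of $P$ in $G$. *)

theory Defs
  imports "HOL-Algebra.Algebra"
begin

definition discrete_valuation_ring :: "('a, 'b) ring_scheme \<Rightarrow> bool" where
  "discrete_valuation_ring R \<longleftrightarrow>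
     principal_domain R \<and> (\<exists>!I. maximalideal I R) \<and> \<not> field R"

definition fraction_field_of :: "('a, 'b) ring_scheme \<Rightarrow> 'a set \<Rightarrow> bool" where
  "fraction_field_of F R \<longleftrightarrow>
     field F \<and> subring R F \<and>
     (\<forall>x \<in> carrier F. \<exists>a \<in> R. \<exists>b \<in> R - {\<zero>\<^bsub>F\<^esub>}. x = a \<otimes>\<^bsub>F\<^esub> inv\<^bsub>F\<^esub> b)"

definition char_zero :: "('a, 'b) ring_scheme \<Rightarrow> bool" where
  "char_zero F \<longleftrightarrow> (\<forall>k::nat. k > 0 \<longrightarrow> [k] \<cdot>\<^bsub>F\<^esub> \<one>\<^bsub>F\<^esub> \<noteq> \<zero>\<^bsub>F\<^esub>)"

definition uniformizer :: "('a, 'b) ring_scheme \<Rightarrow> 'a \<Rightarrow> bool" where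
  "uniformizer R p \<longleftrightarrow> p \<in> carrier R \<and> maximalideal (PIdl\<^bsub>R\<^esub> p) R"

text \<open>The library locale \<^locale>\<open>module\<close> requires a commutative ring. The fields \<^const>\<open>monoid.mult\<close> and
  \<^const>\<open>one\<close> of a module record play no role below.\<close>

locale left_module = A: ring A + V: abelian_group V
  for A :: "('a, 'c) ring_scheme" and V :: "('a, 'v) module" +
  assumes smult_closed:
      "\<lbrakk>a \<in> carrier A; x \<in> carrier V\<rbrakk> \<Longrightarrow> a \<odot>\<^bsub>V\<^esub> x \<in> carrier V"
    and smult_l_distr:
      "\<lbrakk>a \<in> carrier A; b \<in> carrier A; x \<in> carrier V\<rbrakk> \<Longrightarrow>
       (a \<oplus>\<^bsub>A\<^esub> b) \<odot>\<^bsub>V\<^esub> x = a \<odot>\<^bsub>V\<^esub> x \<oplus>\<^bsub>V\<^esub> b \<odot>\<^bsub>V\<^esub> x"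
    and smult_r_distr:
      "\<lbrakk>a \<in> carrier A; x \<in> carrier V; y \<in> carrier V\<rbrakk> \<Longrightarrow>
       a \<odot>\<^bsub>V\<^esub> (x \<oplus>\<^bsub>V\<^esub> y) = a \<odot>\<^bsub>V\<^esub> x \<oplus>\<^bsub>V\<^esub> a \<odot>\<^bsub>V\<^esub> y"
    and smult_assoc:
      "\<lbrakk>a \<in> carrier A; b \<in> carrier A; x \<in> carrier V\<rbrakk> \<Longrightarrow>
       (a \<otimes>\<^bsub>A\<^esub> b) \<odot>\<^bsub>V\<^esub> x = a \<odot>\<^bsub>V\<^esub> (b \<odot>\<^bsub>V\<^esub> x)"
    and smult_one: "x \<in> carrier V \<Longrightarrow> \<one>\<^bsub>A\<^esub> \<odot>\<^bsub>V\<^esub> x = x"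

definition regular_module :: "('a, 'c) ring_scheme \<Rightarrow> 'a set \<Rightarrow> ('a, 'a) module" where
  "regular_module A S =
     \<lparr>carrier = S, monoid.mult = monoid.mult A, one = one A, ring.zero = ring.zero A, add = add A, smult = monoid.mult A\<rparr>"

definition left_module_hom ::
  "('a, 'c) ring_scheme \<Rightarrow> ('a, 'v) module \<Rightarrow> ('a, 'w) module \<Rightarrow> ('v \<Rightarrow> 'w) set" where
  "left_module_hom A V W =
     {h \<in> hom (add_monoid V) (add_monoid W).
        \<forall>a \<in> carrier A. \<forall>x \<in> carrier V. h (a \<odot>\<^bsub>V\<^esub> x) = a \<odot>\<^bsub>W\<^esub> h x}"

definition free_module :: "('a, 'c) ring_scheme \<Rightarrow> 'i set \<Rightarrow> ('a, 'i \<Rightarrow> 'a) module" where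
  "free_module A I =
     \<lparr>carrier = {c. (\<forall>i. c i \<in> carrier A) \<and> (\<forall>i. i \<notin> I \<longrightarrow> c i = \<zero>\<^bsub>A\<^esub>) \<and>
                   finite {i. c i \<noteq> \<zero>\<^bsub>A\<^esub>}},
      monoid.mult = undefined, one = undefined,
      ring.zero = (\<lambda>i. \<zero>\<^bsub>A\<^esub>), add = (\<lambda>c d i. c i \<oplus>\<^bsub>A\<^esub> d i), smult = (\<lambda>a c i. a \<otimes>\<^bsub>A\<^esub> c i)\<rparr>"

definition lin_comb :: "('a, 'c) ring_scheme \<Rightarrow> ('a, 'v) module \<Rightarrow> ('v \<Rightarrow> 'a) \<Rightarrow> 'v" where
  "lin_comb A V c = (\<Oplus>\<^bsub>V\<^esub>b \<in> {b. c b \<noteq> \<zero>\<^bsub>A\<^esub>}. c b \<odot>\<^bsub>V\<^esub> b)"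

definition finitely_generated :: "('a, 'c) ring_scheme \<Rightarrow> ('a, 'v) module \<Rightarrow> bool" where
  "finitely_generated A V \<longleftrightarrow>
     (\<exists>B. finite B \<and> B \<subseteq> carrier V \<and> lin_comb A V ` carrier (free_module A B) = carrier V)"

definition torsion_free :: "('a, 'c) ring_scheme \<Rightarrow> ('a, 'v) module \<Rightarrow> bool" where
  "torsion_free A V \<longleftrightarrow>
     (\<forall>a \<in> carrier A. \<forall>x \<in> carrier V. a \<odot>\<^bsub>V\<^esub> x = \<zero>\<^bsub>V\<^esub> \<longrightarrow> a = \<zero>\<^bsub>A\<^esub> \<or> x = \<zero>\<^bsub>V\<^esub>)"

definition module_basis :: "('a, 'c) ring_scheme \<Rightarrow> ('a, 'v) module \<Rightarrow> 'v set \<Rightarrow> bool" where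
  "module_basis A V B \<longleftrightarrow>
     B \<subseteq> carrier V \<and> bij_betw (lin_comb A V) (carrier (free_module A B)) (carrier V)"

definition is_free :: "('a, 'c) ring_scheme \<Rightarrow> ('a, 'v) module \<Rightarrow> bool" where
  "is_free A V \<longleftrightarrow> left_module A V \<and> (\<exists>B. module_basis A V B)"

definition is_free_of_rank :: "('a, 'c) ring_scheme \<Rightarrow> ('a, 'v) module \<Rightarrow> nat \<Rightarrow> bool" where
  "is_free_of_rank A V k \<longleftrightarrow>
     left_module A V \<and> (\<exists>B. finite B \<and> card B = k \<and> module_basis A V B)"

text \<open>Projective means being a direct summand (a retract) of a free module. Taking the index set of
  the free module inside the type of \<^term>\<open>V\<close> is no restriction: a direct summand of any free
  module is also one of the free module on its own carrier.\<close>

definition is_projective :: "('a, 'c) ring_scheme \<Rightarrow> ('a, 'v) module \<Rightarrow> bool" where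
  "is_projective A V \<longleftrightarrow>
     left_module A V \<and>
     (\<exists>I :: 'v set. \<exists>s \<in> left_module_hom A V (free_module A I).
        \<exists>p \<in> left_module_hom A (free_module A I) V. \<forall>x \<in> carrier V. p (s x) = x)"

text \<open>For a subring \<^term>\<open>B\<close> of \<^term>\<open>A\<close> and a left \<^term>\<open>B\<close>-module \<^term>\<open>V\<close>, the tensor product
  of \<^term>\<open>A\<close> and \<^term>\<open>V\<close> over \<^term>\<open>B\<close> is the free abelian group on pairs modulo the usual
  relations; its elements are cosets.\<close>

definition tensor_relations ::
  "('a, 'c) ring_scheme \<Rightarrow> 'a set \<Rightarrow> ('a, 'v) module \<Rightarrow> (('a \<times> 'v) \<Rightarrow>\<^sub>0 int) set" where
  "tensor_relations A B V =
     generate (free_Abelian_group (carrier A \<times> carrier V))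
      ({frag_of (a \<oplus>\<^bsub>A\<^esub> a', x) - frag_of (a, x) - frag_of (a', x) | a a' x.
          a \<in> carrier A \<and> a' \<in> carrier A \<and> x \<in> carrier V} \<union>
       {frag_of (a, x \<oplus>\<^bsub>V\<^esub> x') - frag_of (a, x) - frag_of (a, x') | a x x'.
          a \<in> carrier A \<and> x \<in> carrier V \<and> x' \<in> carrier V} \<union>
       {frag_of (a \<otimes>\<^bsub>A\<^esub> b, x) - frag_of (a, b \<odot>\<^bsub>V\<^esub> x) | a b x.
          a \<in> carrier A \<and> b \<in> B \<and> x \<in> carrier V})"

definition tensor_class ::
  "('a, 'c) ring_scheme \<Rightarrow> 'a set \<Rightarrow> ('a, 'v) module \<Rightarrow>
   (('a \<times> 'v) \<Rightarrow>\<^sub>0 int) \<Rightarrow> (('a \<times> 'v) \<Rightarrow>\<^sub>0 int) set" where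
  "tensor_class A B V c =
     tensor_relations A B V #>\<^bsub>free_Abelian_group (carrier A \<times> carrier V)\<^esub> c"

text \<open>The map out of a tensor product induced by sending each generator \<^term>\<open>u\<close> to the class of
  \<^term>\<open>\<phi> u\<close> in the tensor product of \<^term>\<open>A\<close> and \<^term>\<open>V\<close> over \<^term>\<open>B\<close>. If the assignment
  respects the relations, all members of the union are the same coset.\<close>

definition tensor_lift ::
  "('a, 'c) ring_scheme \<Rightarrow> 'a set \<Rightarrow> ('a, 'v) module \<Rightarrow>
   ('u \<Rightarrow> (('a \<times> 'v) \<Rightarrow>\<^sub>0 int)) \<Rightarrow> ('u \<Rightarrow>\<^sub>0 int) set \<Rightarrow> (('a \<times> 'v) \<Rightarrow>\<^sub>0 int) set" where
  "tensor_lift A B V \<phi> C = (\<Union>c \<in> C. tensor_class A B V (frag_extend \<phi> c))"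

definition tensor ::
  "('a, 'c) ring_scheme \<Rightarrow> 'a set \<Rightarrow> ('a, 'v) module \<Rightarrow>
   ('a, (('a \<times> 'v) \<Rightarrow>\<^sub>0 int) set) module" where
  "tensor A B V =
     (let T = free_Abelian_group (carrier A \<times> carrier V) Mod tensor_relations A B V in
      \<lparr>carrier = carrier T, monoid.mult = undefined, one = undefined, ring.zero = one T, add = monoid.mult T,
       smult = (\<lambda>a. tensor_lift A B V (\<lambda>(a', x). frag_of (a \<otimes>\<^bsub>A\<^esub> a', x)))\<rparr>)"

text \<open>Intended for finite groups, so no finite-support condition is imposed. Elements are
  coefficient functions vanishing outside the carrier of the group. Hence the group
  ring of a subgroup over a subring is literally a subset of the group ring of the group.\<close>

definition group_elem :: "('k, 'c) ring_scheme \<Rightarrow> 'g \<Rightarrow> ('g \<Rightarrow> 'k)" where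
  "group_elem K g = (\<lambda>x. if x = g then \<one>\<^bsub>K\<^esub> else \<zero>\<^bsub>K\<^esub>)"

definition group_ring ::
  "('k, 'c) ring_scheme \<Rightarrow> ('g, 'd) monoid_scheme \<Rightarrow> ('k, 'g \<Rightarrow> 'k) module" where
  "group_ring K G =
     \<lparr>carrier = {f. (\<forall>x \<in> carrier G. f x \<in> carrier K) \<and> (\<forall>x. x \<notin> carrier G \<longrightarrow> f x = \<zero>\<^bsub>K\<^esub>)},
      monoid.mult = (\<lambda>f g x. if x \<in> carrier G
                      then \<Oplus>\<^bsub>K\<^esub>y \<in> carrier G. f y \<otimes>\<^bsub>K\<^esub> g (inv\<^bsub>G\<^esub> y \<otimes>\<^bsub>G\<^esub> x)
                      else \<zero>\<^bsub>K\<^esub>),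
      one = group_elem K \<one>\<^bsub>G\<^esub>,
      ring.zero = (\<lambda>x. \<zero>\<^bsub>K\<^esub>),
      add = (\<lambda>f g x. f x \<oplus>\<^bsub>K\<^esub> g x),
      smult = (\<lambda>k f x. k \<otimes>\<^bsub>K\<^esub> f x)\<rparr>"

definition Tr :: "('k, 'c) ring_scheme \<Rightarrow> ('g, 'd) monoid_scheme \<Rightarrow> 'g set \<Rightarrow> ('g \<Rightarrow> 'k)" where
  "Tr K G P = (\<Oplus>\<^bsub>group_ring K G\<^esub>k \<in> P. group_elem K k)"

definition ncl :: "('g, 'd) monoid_scheme \<Rightarrow> 'g set \<Rightarrow> 'g set" where
  "ncl G P = \<Inter>{N. N \<lhd> G \<and> P \<subseteq> N}"

definition trace_sum ::
  "('k, 'c) ring_scheme \<Rightarrow> 'k set \<Rightarrow> ('g, 'd) monoid_scheme \<Rightarrow> 'k \<Rightarrow> nat \<Rightarrow> (nat \<Rightarrow> int) \<Rightarrow>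
   (nat \<Rightarrow> 'g set) \<Rightarrow> ('g \<Rightarrow> 'k) set" where
  "trace_sum F R G \<pi> r n P =
     {\<Oplus>\<^bsub>group_ring F G\<^esub>i \<in> {..r}.
        (\<pi> [^]\<^bsub>F\<^esub> (- n i)) \<odot>\<^bsub>group_ring F G\<^esub> (x i \<otimes>\<^bsub>group_ring F G\<^esub> Tr F G (P i)) | x.
        \<forall>i \<le> r. x i \<in> carrier (group_ring (F\<lparr>carrier := R\<rparr>) G)}"

definition coeff_module ::
  "('k, 'c) ring_scheme \<Rightarrow> ('g, 'd) monoid_scheme \<Rightarrow> ('g \<Rightarrow> 'k, 'm) module \<Rightarrow> ('k, 'm) module" where
  "coeff_module K G M =
     \<lparr>carrier = carrier M, monoid.mult = monoid.mult M, one = one M, ring.zero = ring.zero M, add = add M,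
      smult = (\<lambda>k x. (k \<odot>\<^bsub>group_ring K G\<^esub> \<one>\<^bsub>group_ring K G\<^esub>) \<odot>\<^bsub>M\<^esub> x)\<rparr>"

definition group_ring_lattice ::
  "('k, 'c) ring_scheme \<Rightarrow> ('g, 'd) monoid_scheme \<Rightarrow> ('g \<Rightarrow> 'k, 'm) module \<Rightarrow> bool" where
  "group_ring_lattice R H M \<longleftrightarrow>
     left_module (group_ring R H) M \<and>
     finitely_generated R (coeff_module R H M) \<and> torsion_free R (coeff_module R H M)"

text \<open>\<open>FM\<close> is the tensor product of \<open>F\<close> and \<open>M\<close> over \<open>R\<close>, with \<open>F[H]\<close> acting by
  \<open>(\<Sum>\<^sub>h \<lambda>\<^sub>h h) (f \<otimes> m) = \<Sum>\<^sub>h \<lambda>\<^sub>h f \<otimes> h m\<close>.\<close>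

definition generic_fibre ::
  "('k, 'c) ring_scheme \<Rightarrow> 'k set \<Rightarrow> ('g, 'd) monoid_scheme \<Rightarrow> ('g \<Rightarrow> 'k, 'm) module \<Rightarrow>
   ('g \<Rightarrow> 'k, (('k \<times> 'm) \<Rightarrow>\<^sub>0 int) set) module" where
  "generic_fibre F R H M =
     (let M\<^sub>R = coeff_module (F\<lparr>carrier := R\<rparr>) H M; T = tensor F R M\<^sub>R in
      \<lparr>carrier = carrier T, monoid.mult = monoid.mult T, one = one T, ring.zero = ring.zero T, add = add T,
       smult = (\<lambda>l. tensor_lift F R M\<^sub>R
         (\<lambda>(f, m). \<Sum>h \<in> carrier H. frag_of (l h \<otimes>\<^bsub>F\<^esub> f, group_elem F h \<odot>\<^bsub>M\<^esub> m)))\<rparr>)"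

text \<open>The canonical map \<open>m \<mapsto> 1 \<otimes> m\<close> from \<open>M\<close> to \<open>FM\<close>.\<close>

definition to_generic_fibre ::
  "('k, 'c) ring_scheme \<Rightarrow> 'k set \<Rightarrow> ('g, 'd) monoid_scheme \<Rightarrow> ('g \<Rightarrow> 'k, 'm) module \<Rightarrow>
   'm \<Rightarrow> (('k \<times> 'm) \<Rightarrow>\<^sub>0 int) set" where
  "to_generic_fibre F R H M m =
     tensor_class F R (coeff_module (F\<lparr>carrier := R\<rparr>) H M) (frag_of (\<one>\<^bsub>F\<^esub>, m))"

definition lattice_in ::
  "('k, 'c) ring_scheme \<Rightarrow> 'k set \<Rightarrow> ('g, 'd) monoid_scheme \<Rightarrow> ('g \<Rightarrow> 'k, 'm) module \<Rightarrow>
   (('k \<times> 'm) \<Rightarrow>\<^sub>0 int) set set" where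
  "lattice_in F R H M = to_generic_fibre F R H M ` carrier M"

definition assoc_order ::
  "('a, 'c) ring_scheme \<Rightarrow> ('a, 'v) module \<Rightarrow> 'v set \<Rightarrow> 'a set" where
  "assoc_order A V L = {l \<in> carrier A. \<forall>x \<in> L. l \<odot>\<^bsub>V\<^esub> x \<in> L}"

definition Ind ::
  "('k, 'c) ring_scheme \<Rightarrow> ('g, 'd) monoid_scheme \<Rightarrow> 'g set \<Rightarrow> ('g \<Rightarrow> 'k, 'v) module \<Rightarrow>
   ('g \<Rightarrow> 'k, ((('g \<Rightarrow> 'k) \<times> 'v) \<Rightarrow>\<^sub>0 int) set) module" where
  "Ind K G H V = tensor (group_ring K G) (carrier (group_ring K (G\<lparr>carrier := H\<rparr>))) V"

text \<open>\<open>Ind M\<close> as a lattice in \<open>Ind FM\<close>: the image of the canonical map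
  \<open>x \<otimes> m \<mapsto> x \<otimes> (1 \<otimes> m)\<close>.\<close>

definition Ind_lattice ::
  "('k, 'c) ring_scheme \<Rightarrow> 'k set \<Rightarrow> ('g, 'd) monoid_scheme \<Rightarrow> 'g set \<Rightarrow>
   ('g \<Rightarrow> 'k, 'm) module \<Rightarrow>
   ((('g \<Rightarrow> 'k) \<times> (('k \<times> 'm) \<Rightarrow>\<^sub>0 int) set) \<Rightarrow>\<^sub>0 int) set set" where
  "Ind_lattice F R G H M =
     tensor_lift (group_ring F G) (carrier (group_ring F (G\<lparr>carrier := H\<rparr>)))
       (generic_fibre F R (G\<lparr>carrier := H\<rparr>) M)
       (\<lambda>(x, m). frag_of (x, to_generic_fibre F R (G\<lparr>carrier := H\<rparr>) M m))
     ` carrier (Ind (F\<lparr>carrier := R\<rparr>) G H M)"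

text \<open>For an \<open>R[H]\<close>-submodule \<open>S\<close> of \<open>F[H]\<close>, \<open>Ind S\<close> as a subset of \<open>F[G]\<close>: the image of the
  canonical map \<open>x \<otimes> s \<mapsto> x s\<close>, computed on any representative of a coset.\<close>

definition Ind_subset ::
  "('k, 'c) ring_scheme \<Rightarrow> 'k set \<Rightarrow> ('g, 'd) monoid_scheme \<Rightarrow> 'g set \<Rightarrow>
   ('g \<Rightarrow> 'k) set \<Rightarrow> ('g \<Rightarrow> 'k) set" where
  "Ind_subset F R G H S =
     (\<lambda>C. the_elem ((\<lambda>c. \<Oplus>\<^bsub>group_ring F G\<^esub>u \<in> Poly_Mapping.keys c.
            [Poly_Mapping.lookup c u] \<cdot>\<^bsub>group_ring F G\<^esub>
              (fst u \<otimes>\<^bsub>group_ring F G\<^esub> snd u)) ` C))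
     ` carrier (Ind (F\<lparr>carrier := R\<rparr>) G H (regular_module (group_ring F (G\<lparr>carrier := H\<rparr>)) S))"

abbreviation order_of_lattice ::
  "('k, 'c) ring_scheme \<Rightarrow> 'k set \<Rightarrow> ('g, 'd) monoid_scheme \<Rightarrow> 'g set \<Rightarrow>
   ('g \<Rightarrow> 'k, 'm) module \<Rightarrow> ('g \<Rightarrow> 'k) set" where
  "order_of_lattice F R G H M \<equiv>
     assoc_order (group_ring F (G\<lparr>carrier := H\<rparr>)) (generic_fibre F R (G\<lparr>carrier := H\<rparr>) M)
       (lattice_in F R (G\<lparr>carrier := H\<rparr>) M)"

abbreviation order_of_Ind ::
  "('k, 'c) ring_scheme \<Rightarrow> 'k set \<Rightarrow> ('g, 'd) monoid_scheme \<Rightarrow> 'g set \<Rightarrow>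
   ('g \<Rightarrow> 'k, 'm) module \<Rightarrow> ('g \<Rightarrow> 'k) set" where
  "order_of_Ind F R G H M \<equiv>
     assoc_order (group_ring F G) (Ind F G H (generic_fibre F R (G\<lparr>carrier := H\<rparr>) M))
       (Ind_lattice F R G H M)"

end

theory Submission
  imports Defs
begin

text \<open>
  A function on \<open>G\<close> lies in \<open>\<Sum>\<^sub>i \<pi>\<^sup>-\<^sup>n\<^sup>i R[G] Tr\<^bsub>P i\<^esub>\<close> iff its values lie in \<open>\<pi>\<^sup>-\<^sup>n\<^sup>r R\<close> and, modulo \<open>\<pi>\<^sup>-\<^sup>n\<^sup>i R\<close>, it is
  invariant under right translation by \<open>P (i+1)\<close>. Identify \<open>FM\<close> with \<open>F[H]\<close>, so that \<open>Ind M\<close> consists of the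
  \<open>y \<in> F[G]\<close> all of whose left translates restrict on \<open>H\<close> to elements of \<open>M\<close>. The order of \<open>Ind M\<close> is then the
  set of \<open>a\<close> with \<open>a g \<in> Ind \<AA>(F[H], M)\<close> for all \<open>g\<close>, and the congruences for all translates \<open>a g\<close> amount to
  invariance under the conjugates of \<open>P (i+1)\<close>, hence under the normal closure. The element
  \<open>\<pi>\<^sup>-\<^sup>n\<^sup>i Tr\<^bsub>P i\<^esub>\<close> detects normality of \<open>P i\<close>: it satisfies the congruences for all its right translates only
  if \<open>P i\<close> is normal. For (v), a dual basis of the projective module \<open>Ind M\<close> together with commutativity
  of \<open>F[H]\<close> shows that \<open>\<AA>(F[H], M)\<close> is contained in the order of \<open>Ind M\<close>.
\<close>

text \<open>The coefficients \<open>x i\<close> of a trace sum are not unique and multiplying by a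
  trace is a convolution, so trace sums are hard to compare directly. Congruences are pointwise:
  restriction to \<open>H\<close> and translation are read off at single points. A generator
  \<open>v\<close> of \<open>FM\<close> removes the tensor products in the same spirit, since every
  class in \<open>Ind FM\<close> is \<open>a \<otimes> v\<close> for exactly one \<open>a\<close> in
  \<open>F[G]\<close>. A ring containing \<open>R[G]\<close> is closed under right translation, so
  the test element that detects normality also decides when the induced order is a ring; under
  normality the induced order and the order of the induced lattice are one set, free over itself. In
  the projective case the dual maps take values in an order that need not be commutative. Because
  \<open>v\<close> has a denominator, some nonzero scalar \<open>d\<close> lies in the lattice, and
  evaluation at \<open>d\<close> turns a dual map into right multiplication. What must then commute
  with a lattice element is a restriction to \<open>H\<close>, so commutativity of
  \<open>F[H]\<close> suffices; normality of \<open>H\<close> keeps such restrictions inside the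
  order.\<close>

lemma (in abelian_monoid) finsum_swap:
  assumes "finite A" "finite B" "\<And>x y. x \<in> A \<Longrightarrow> y \<in> B \<Longrightarrow> f x y \<in> carrier G"
  shows "(\<Oplus>x\<in>A. \<Oplus>y\<in>B. f x y) = (\<Oplus>y\<in>B. \<Oplus>x\<in>A. f x y)"
  using assms
proof (induction A rule: finite_induct)
  case (insert a A)
  have "(\<Oplus>x\<in>insert a A. \<Oplus>y\<in>B. f x y) = (\<Oplus>y\<in>B. f a y) \<oplus> (\<Oplus>y\<in>B. \<Oplus>x\<in>A. f x y)"
    using insert by (simp add: Pi_def)
  also have "\<dots> = (\<Oplus>y\<in>B. f a y \<oplus> (\<Oplus>x\<in>A. f x y))"
    using insert by (subst finsum_addf) (auto simp: Pi_def)
  also have "\<dots> = (\<Oplus>y\<in>B. \<Oplus>x\<in>insert a A. f x y)"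
    using insert by (intro finsum_cong') (auto simp: Pi_def)
  finally show ?case .
qed (simp add: finsum_zero)

lemma (in abelian_monoid) finsum_single:
  assumes "finite A" "a \<in> A" "f a \<in> carrier G" "\<And>x. x \<in> A \<Longrightarrow> x \<noteq> a \<Longrightarrow> f x = \<zero>"
  shows "(\<Oplus>x\<in>A. f x) = f a"
proof -
  have "(\<Oplus>x\<in>A. f x) = (\<Oplus>x\<in>{a}. f x)"
    using assms by (intro add.finprod_mono_neutral_cong_right) (auto, metis zero_closed)
  then show ?thesis using assms by simp
qed

text \<open>A group ring over \<open>K\<lparr>carrier := R\<rparr>\<close> forms its convolutions
  with the summation of the subring record; this identifies those sums with the ones in the
  field.\<close>

lemma (in ring) finsum_subring_eq:
  assumes "subring S R" "finite I" "\<And>i. i \<in> I \<Longrightarrow> f i \<in> S"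
  shows "finsum (R\<lparr>carrier := S\<rparr>) f I = finsum R f I" "finsum R f I \<in> S"
proof -
  interpret S: ring "R\<lparr>carrier := S\<rparr>" by (rule subring_is_ring[OF assms(1)])
  note sub = subringE[OF assms(1)]
  have "finsum (R\<lparr>carrier := S\<rparr>) f I = finsum R f I \<and> finsum R f I \<in> S"
    using assms(2,3)
  proof (induction I rule: finite_induct)
    case (insert a I)
    have "finsum (R\<lparr>carrier := S\<rparr>) f (insert a I) = f a \<oplus> finsum (R\<lparr>carrier := S\<rparr>) f I"
      using insert by (subst S.finsum_insert) (auto simp: Pi_def)
    moreover have "finsum R f (insert a I) = f a \<oplus> finsum R f I"
      using insert sub(1) by (subst finsum_insert) (auto simp: Pi_def)
    ultimately show ?case using insert sub by auto
  qed (use sub in simp)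
  then show "finsum (R\<lparr>carrier := S\<rparr>) f I = finsum R f I" "finsum R f I \<in> S" by auto
qed

lemma (in abelian_group) finsum_in_subgroup:
  assumes "subgroup S (add_monoid G)" "\<And>i. i \<in> I \<Longrightarrow> f i \<in> S"
  shows "finsum G f I \<in> S"
proof (cases "finite I")
  case True
  then show ?thesis using assms(2)
  proof (induction I rule: finite_induct)
    case empty
    then show ?case using subgroup.one_closed[OF assms(1)] by simp
  next
    case (insert a I)
    then have "finsum G f (insert a I) = f a \<oplus> finsum G f I"
      using subgroup.subset[OF assms(1)] by (subst finsum_insert) (auto simp: Pi_def)
    then show ?case using insert subgroup.m_closed[OF assms(1)] by simp
  qed
next
  case False
  then show ?thesis using subgroup.one_closed[OF assms(1)] by (simp add: finsum_infinite)
qed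

section \<open>Group rings of finite groups\<close>

lemma group_ring_simps [simp]:
  "\<zero>\<^bsub>group_ring K G\<^esub> = (\<lambda>x. \<zero>\<^bsub>K\<^esub>)"
  "\<one>\<^bsub>group_ring K G\<^esub> = group_elem K \<one>\<^bsub>G\<^esub>"
  "f \<oplus>\<^bsub>group_ring K G\<^esub> g = (\<lambda>x. f x \<oplus>\<^bsub>K\<^esub> g x)"
  "k \<odot>\<^bsub>group_ring K G\<^esub> f = (\<lambda>x. k \<otimes>\<^bsub>K\<^esub> f x)"
  by (simp_all add: group_ring_def)

lemma group_ring_carrier:
  "f \<in> carrier (group_ring K G) \<longleftrightarrow>
     (\<forall>x \<in> carrier G. f x \<in> carrier K) \<and> (\<forall>x. x \<notin> carrier G \<longrightarrow> f x = \<zero>\<^bsub>K\<^esub>)"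
  by (simp add: group_ring_def)

lemma group_ring_mult:
  "(f \<otimes>\<^bsub>group_ring K G\<^esub> g) x =
     (if x \<in> carrier G then \<Oplus>\<^bsub>K\<^esub>y \<in> carrier G. f y \<otimes>\<^bsub>K\<^esub> g (inv\<^bsub>G\<^esub> y \<otimes>\<^bsub>G\<^esub> x) else \<zero>\<^bsub>K\<^esub>)"
  by (simp add: group_ring_def)

locale finite_group_ring = K: ring K + G: group G
  for K :: "('k, 'c) ring_scheme" and G :: "('g, 'd) monoid_scheme" +
  assumes finite_G: "finite (carrier G)"
begin

abbreviation "KG \<equiv> group_ring K G"

abbreviation "ge \<equiv> group_elem K"

lemma coeff_closed: "f \<in> carrier KG \<Longrightarrow> f x \<in> carrier K"
  by (cases "x \<in> carrier G") (auto simp: group_ring_carrier)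

lemma group_elem_closed: "g \<in> carrier G \<Longrightarrow> ge g \<in> carrier KG"
  by (auto simp: group_ring_carrier group_elem_def)

lemma mult_closed:
  assumes "f \<in> carrier KG" "g \<in> carrier KG"
  shows "f \<otimes>\<^bsub>KG\<^esub> g \<in> carrier KG"
  using assms by (auto simp: group_ring_carrier group_ring_mult intro!: K.finsum_closed)

lemma reindex_left:
  assumes "z \<in> carrier G" "\<And>y. y \<in> carrier G \<Longrightarrow> f y \<in> carrier K"
  shows "(\<Oplus>\<^bsub>K\<^esub>y\<in>carrier G. f y) = (\<Oplus>\<^bsub>K\<^esub>y\<in>carrier G. f (z \<otimes>\<^bsub>G\<^esub> y))"
proof -
  have "(\<lambda>y. z \<otimes>\<^bsub>G\<^esub> y) ` carrier G = carrier G"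
    using assms(1) by (rule G.surj_const_mult)
  moreover have "inj_on (\<lambda>y. z \<otimes>\<^bsub>G\<^esub> y) (carrier G)"
    using assms(1) by (rule G.inj_on_cmult)
  ultimately show ?thesis
    using K.finsum_reindex[of f "\<lambda>y. z \<otimes>\<^bsub>G\<^esub> y" "carrier G"] assms(2) by (auto simp: Pi_def)
qed

lemma mult_assoc:
  assumes f: "f \<in> carrier KG" and g: "g \<in> carrier KG" and h: "h \<in> carrier KG"
  shows "(f \<otimes>\<^bsub>KG\<^esub> g) \<otimes>\<^bsub>KG\<^esub> h = f \<otimes>\<^bsub>KG\<^esub> (g \<otimes>\<^bsub>KG\<^esub> h)"
proof
  fix x
  note [simp] = coeff_closed[OF f] coeff_closed[OF g] coeff_closed[OF h] finite_G
  show "((f \<otimes>\<^bsub>KG\<^esub> g) \<otimes>\<^bsub>KG\<^esub> h) x = (f \<otimes>\<^bsub>KG\<^esub> (g \<otimes>\<^bsub>KG\<^esub> h)) x"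
  proof (cases "x \<in> carrier G")
    case x: True
    have "((f \<otimes>\<^bsub>KG\<^esub> g) \<otimes>\<^bsub>KG\<^esub> h) x =
        (\<Oplus>\<^bsub>K\<^esub>y\<in>carrier G. \<Oplus>\<^bsub>K\<^esub>z\<in>carrier G.
           f z \<otimes>\<^bsub>K\<^esub> g (inv\<^bsub>G\<^esub> z \<otimes>\<^bsub>G\<^esub> y) \<otimes>\<^bsub>K\<^esub> h (inv\<^bsub>G\<^esub> y \<otimes>\<^bsub>G\<^esub> x))"
      unfolding group_ring_mult using x
      by (auto intro!: K.finsum_cong' simp: K.finsum_ldistr Pi_def)
    also have "\<dots> = (\<Oplus>\<^bsub>K\<^esub>z\<in>carrier G. \<Oplus>\<^bsub>K\<^esub>y\<in>carrier G.
           f z \<otimes>\<^bsub>K\<^esub> (g (inv\<^bsub>G\<^esub> z \<otimes>\<^bsub>G\<^esub> y) \<otimes>\<^bsub>K\<^esub> h (inv\<^bsub>G\<^esub> y \<otimes>\<^bsub>G\<^esub> x)))"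
      by (subst K.finsum_swap) (auto simp: K.m_assoc)
    also have "\<dots> = (\<Oplus>\<^bsub>K\<^esub>z\<in>carrier G. f z \<otimes>\<^bsub>K\<^esub> (g \<otimes>\<^bsub>KG\<^esub> h) (inv\<^bsub>G\<^esub> z \<otimes>\<^bsub>G\<^esub> x))"
    proof (rule K.finsum_cong')
      fix z assume z: "z \<in> carrier G"
      \<comment> \<open>Replacing \<open>y\<close> by \<open>z y\<close> removes \<open>z\<close>
        from the argument of \<open>g\<close>, so the inner sum becomes a value of the product of
        \<open>g\<close> and \<open>h\<close>.\<close>
      have "(\<Oplus>\<^bsub>K\<^esub>y\<in>carrier G. g (inv\<^bsub>G\<^esub> z \<otimes>\<^bsub>G\<^esub> y) \<otimes>\<^bsub>K\<^esub> h (inv\<^bsub>G\<^esub> y \<otimes>\<^bsub>G\<^esub> x))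
         = (\<Oplus>\<^bsub>K\<^esub>y\<in>carrier G. g y \<otimes>\<^bsub>K\<^esub> h (inv\<^bsub>G\<^esub> y \<otimes>\<^bsub>G\<^esub> (inv\<^bsub>G\<^esub> z \<otimes>\<^bsub>G\<^esub> x)))"
        using z x by (subst reindex_left[of z])
          (auto intro!: K.finsum_cong' simp: G.inv_mult_group G.m_assoc G.inv_solve_left' simp flip: G.m_assoc)
      then show "(\<Oplus>\<^bsub>K\<^esub>y\<in>carrier G. f z \<otimes>\<^bsub>K\<^esub> (g (inv\<^bsub>G\<^esub> z \<otimes>\<^bsub>G\<^esub> y) \<otimes>\<^bsub>K\<^esub> h (inv\<^bsub>G\<^esub> y \<otimes>\<^bsub>G\<^esub> x)))
         = f z \<otimes>\<^bsub>K\<^esub> (g \<otimes>\<^bsub>KG\<^esub> h) (inv\<^bsub>G\<^esub> z \<otimes>\<^bsub>G\<^esub> x)"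
        using z x by (simp add: group_ring_mult Pi_def flip: K.finsum_rdistr)
    qed (use coeff_closed[OF mult_closed[OF g h]] in auto)
    also have "\<dots> = (f \<otimes>\<^bsub>KG\<^esub> (g \<otimes>\<^bsub>KG\<^esub> h)) x"
      using x by (simp add: group_ring_mult[of _ _ f])
    finally show ?thesis .
  qed (simp add: group_ring_mult)
qed

text \<open>Group elements act by translating the argument, from the left here and from the right in
  \<open>mult_group_elem_apply\<close>. All later manipulations with translates and conjugates rest
  on these two formulas.\<close>

lemma group_elem_mult_apply:
  assumes "g \<in> carrier G" "f \<in> carrier KG" "x \<in> carrier G"
  shows "(ge g \<otimes>\<^bsub>KG\<^esub> f) x = f (inv\<^bsub>G\<^esub> g \<otimes>\<^bsub>G\<^esub> x)"
proof -
  have "(\<Oplus>\<^bsub>K\<^esub>y\<in>carrier G. ge g y \<otimes>\<^bsub>K\<^esub> f (inv\<^bsub>G\<^esub> y \<otimes>\<^bsub>G\<^esub> x)) = ge g g \<otimes>\<^bsub>K\<^esub> f (inv\<^bsub>G\<^esub> g \<otimes>\<^bsub>G\<^esub> x)"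
    using assms coeff_closed[OF assms(2)] finite_G
    by (intro K.finsum_single) (auto simp: group_elem_def)
  then show ?thesis using assms coeff_closed[OF assms(2)] by (simp add: group_ring_mult group_elem_def)
qed

lemma mult_group_elem_apply:
  assumes "g \<in> carrier G" "f \<in> carrier KG" "x \<in> carrier G"
  shows "(f \<otimes>\<^bsub>KG\<^esub> ge g) x = f (x \<otimes>\<^bsub>G\<^esub> inv\<^bsub>G\<^esub> g)"
proof -
  have eq: "inv\<^bsub>G\<^esub> y \<otimes>\<^bsub>G\<^esub> x = g \<longleftrightarrow> y = x \<otimes>\<^bsub>G\<^esub> inv\<^bsub>G\<^esub> g" if "y \<in> carrier G" for y
    using assms that by (metis G.inv_closed G.inv_solve_left' G.inv_solve_right')
  let ?t = "x \<otimes>\<^bsub>G\<^esub> inv\<^bsub>G\<^esub> g"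
  have t: "?t \<in> carrier G" using assms by simp
  have "(\<Oplus>\<^bsub>K\<^esub>y\<in>carrier G. f y \<otimes>\<^bsub>K\<^esub> ge g (inv\<^bsub>G\<^esub> y \<otimes>\<^bsub>G\<^esub> x)) = f ?t \<otimes>\<^bsub>K\<^esub> ge g (inv\<^bsub>G\<^esub> ?t \<otimes>\<^bsub>G\<^esub> x)"
    by (intro K.finsum_single) (use assms coeff_closed[OF assms(2)] finite_G eq t in \<open>auto simp: group_elem_def\<close>)
  then show ?thesis using assms coeff_closed[OF assms(2)] eq[OF t] t
    by (simp add: group_ring_mult group_elem_def)
qed

lemma mult_outside: "x \<notin> carrier G \<Longrightarrow> (f \<otimes>\<^bsub>KG\<^esub> g) x = \<zero>\<^bsub>K\<^esub>"
  by (simp add: group_ring_mult)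

lemma outside: "f \<in> carrier KG \<Longrightarrow> x \<notin> carrier G \<Longrightarrow> f x = \<zero>\<^bsub>K\<^esub>"
  by (simp add: group_ring_carrier)

lemma ring_group_ring: "ring KG"
proof (rule ringI)
  show "abelian_group KG"
  proof (rule abelian_groupI)
    fix f assume f: "f \<in> carrier KG"
    then show "\<exists>g\<in>carrier KG. g \<oplus>\<^bsub>KG\<^esub> f = \<zero>\<^bsub>KG\<^esub>"
      by (intro bexI[of _ "\<lambda>x. \<ominus>\<^bsub>K\<^esub> f x"]) (auto simp: group_ring_carrier K.l_neg fun_eq_iff coeff_closed)
  qed (simp_all add: group_ring_carrier K.a_ac fun_eq_iff coeff_closed)
  show "monoid KG"
  proof (rule monoidI)
    fix f assume f: "f \<in> carrier KG"
    show "\<one>\<^bsub>KG\<^esub> \<otimes>\<^bsub>KG\<^esub> f = f"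
    proof
      fix x show "(\<one>\<^bsub>KG\<^esub> \<otimes>\<^bsub>KG\<^esub> f) x = f x"
        using f by (cases "x \<in> carrier G") (auto simp: group_elem_mult_apply mult_outside outside)
    qed
    show "f \<otimes>\<^bsub>KG\<^esub> \<one>\<^bsub>KG\<^esub> = f"
    proof
      fix x show "(f \<otimes>\<^bsub>KG\<^esub> \<one>\<^bsub>KG\<^esub>) x = f x"
        using f by (cases "x \<in> carrier G") (auto simp: mult_group_elem_apply mult_outside outside)
    qed
  qed (use mult_closed mult_assoc group_elem_closed in auto)
  fix f g h assume fgh: "f \<in> carrier KG" "g \<in> carrier KG" "h \<in> carrier KG"
  note [simp] = fgh[THEN coeff_closed] finite_G
  show "(f \<oplus>\<^bsub>KG\<^esub> g) \<otimes>\<^bsub>KG\<^esub> h = f \<otimes>\<^bsub>KG\<^esub> h \<oplus>\<^bsub>KG\<^esub> g \<otimes>\<^bsub>KG\<^esub> h"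
    by (rule ext) (auto simp: group_ring_mult K.l_distr Pi_def simp flip: K.finsum_addf)
  show "h \<otimes>\<^bsub>KG\<^esub> (f \<oplus>\<^bsub>KG\<^esub> g) = h \<otimes>\<^bsub>KG\<^esub> f \<oplus>\<^bsub>KG\<^esub> h \<otimes>\<^bsub>KG\<^esub> g"
    by (rule ext) (auto simp: group_ring_mult K.r_distr Pi_def simp flip: K.finsum_addf)
qed

sublocale KG: ring KG
  by (rule ring_group_ring)

lemma uminus_apply: "f \<in> carrier KG \<Longrightarrow> (\<ominus>\<^bsub>KG\<^esub> f) x = \<ominus>\<^bsub>K\<^esub> f x"
proof -
  assume f: "f \<in> carrier KG"
  have "(\<ominus>\<^bsub>KG\<^esub> f) x \<oplus>\<^bsub>K\<^esub> f x = \<zero>\<^bsub>K\<^esub>"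
    using fun_cong[OF KG.l_neg[OF f], of x] by simp
  then show ?thesis
    using f by (intro K.minus_equality[symmetric]) (auto intro: coeff_closed)
qed

lemma finsum_apply:
  assumes "\<And>i. i \<in> I \<Longrightarrow> f i \<in> carrier KG"
  shows "(\<Oplus>\<^bsub>KG\<^esub>i\<in>I. f i) x = (\<Oplus>\<^bsub>K\<^esub>i\<in>I. f i x)"
  using assms
proof (induction I rule: infinite_finite_induct)
  case (insert a I)
  then show ?case by (simp add: Pi_def coeff_closed)
qed (simp_all add: KG.finsum_infinite K.finsum_infinite)

text \<open>A trace becomes an indicator function, so right multiplication by the trace of a
  subgroup sums a function over left cosets.\<close>

lemma Tr_eq:
  assumes "P \<subseteq> carrier G"
  shows "Tr K G P = (\<lambda>x. if x \<in> P then \<one>\<^bsub>K\<^esub> else \<zero>\<^bsub>K\<^esub>)"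
proof
  fix x
  have fin: "finite P" using assms finite_G by (rule finite_subset)
  have "Tr K G P x = (\<Oplus>\<^bsub>K\<^esub>k\<in>P. ge k x)"
    unfolding Tr_def using assms by (intro finsum_apply group_elem_closed) auto
  also have "\<dots> = (if x \<in> P then \<one>\<^bsub>K\<^esub> else \<zero>\<^bsub>K\<^esub>)"
  proof (cases "x \<in> P")
    case True
    then have "(\<Oplus>\<^bsub>K\<^esub>k\<in>P. ge k x) = ge x x"
      by (intro K.finsum_single) (auto simp: fin group_elem_def)
    then show ?thesis using True by (simp add: group_elem_def)
  next
    case False
    then have "(\<Oplus>\<^bsub>K\<^esub>k\<in>P. ge k x) = (\<Oplus>\<^bsub>K\<^esub>k\<in>P. \<zero>\<^bsub>K\<^esub>)"
      by (intro K.finsum_cong') (auto simp: group_elem_def)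
    then show ?thesis using False by simp
  qed
  finally show "Tr K G P x = (if x \<in> P then \<one>\<^bsub>K\<^esub> else \<zero>\<^bsub>K\<^esub>)" .
qed

lemma Tr_closed: "P \<subseteq> carrier G \<Longrightarrow> Tr K G P \<in> carrier KG"
  by (auto simp: Tr_eq group_ring_carrier)

end

section \<open>Sums of ideals generated by traces\<close>

text \<open>The exponents of a trace sum are integers, while the divisibility arguments run over
  natural powers of the uniformizer.\<close>

lemma int_pow_uminus_int:
  assumes "field F" "a \<in> carrier F"
  shows "a [^]\<^bsub>F\<^esub> (- int k) = inv\<^bsub>F\<^esub> (a [^]\<^bsub>F\<^esub> k)"
proof -
  interpret field F by fact
  show ?thesis by (cases "k = 0") (auto simp: int_pow_def2)
qed

lemma (in abelian_group) diff_cancel: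
  assumes "a \<in> carrier G" "b \<in> carrier G" "c \<in> carrier G"
  shows add_diff_cancel_left: "(c \<oplus> a) \<ominus> (c \<oplus> b) = a \<ominus> b"
    and diff_diff_cancel_right: "(a \<ominus> c) \<ominus> (b \<ominus> c) = a \<ominus> b"
proof -
  have "(c \<oplus> a) \<ominus> (c \<oplus> b) = (c \<oplus> \<ominus> c) \<oplus> (a \<oplus> \<ominus> b)"
    unfolding a_minus_def using assms by (simp only: minus_add a_ac a_closed a_inv_closed)
  then show "(c \<oplus> a) \<ominus> (c \<oplus> b) = a \<ominus> b"
    using assms by (simp add: r_neg a_minus_def)
  have "(a \<ominus> c) \<ominus> (b \<ominus> c) = (a \<oplus> \<ominus> b) \<oplus> (\<ominus> c \<oplus> c)"
    unfolding a_minus_def using assms by (simp only: minus_add a_ac a_closed a_inv_closed minus_minus)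
  then show "(a \<ominus> c) \<ominus> (b \<ominus> c) = a \<ominus> b"
    using assms by (simp add: l_neg a_minus_def)
qed

lemma (in abelian_group) minus_diff:
  assumes "a \<in> carrier G" "b \<in> carrier G"
  shows "\<ominus> (a \<ominus> b) = b \<ominus> a"
  using assms by (simp add: a_minus_def minus_add a_comm)

lemma (in abelian_group) add_diff_cancel:
  assumes "a \<in> carrier G" "c \<in> carrier G"
  shows "c \<oplus> (a \<ominus> c) = a"
proof -
  have "c \<oplus> (a \<ominus> c) = a \<oplus> (c \<oplus> \<ominus> c)"
    unfolding a_minus_def using assms by (simp only: a_ac a_closed a_inv_closed)
  then show ?thesis using assms by (simp add: r_neg)
qed

lemma (in group) cancel_inv:
  assumes "a \<in> carrier G" "b \<in> carrier G"
  shows "a \<otimes> (inv a \<otimes> b) = b" "inv a \<otimes> (a \<otimes> b) = b"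
  using assms by (simp_all flip: m_assoc)

lemma (in field) pow_neq_zero:
  "a \<in> carrier R \<Longrightarrow> a \<noteq> \<zero> \<Longrightarrow> a [^] (k::nat) \<noteq> \<zero>"
  by (induction k) (auto simp: integral_iff)

text \<open>The valuation is represented by a nonzero \<open>\<pi>\<close> in \<open>R\<close> whose
  inverse leaves \<open>R\<close>; that last property keeps the fractional ideals \<open>Q k\<close>
  below apart.\<close>

locale valued_group_ring = finite_group_ring K G + K: field K
  for K :: "('k, 'c) ring_scheme" and G :: "('g, 'd) monoid_scheme" +
  fixes R :: "'k set" and \<pi> :: 'k
  assumes subring_R: "subring R K" and pi_in_R: "\<pi> \<in> R" and pi_nonzero: "\<pi> \<noteq> \<zero>\<^bsub>K\<^esub>"
    and pi_not_unit: "inv\<^bsub>K\<^esub> \<pi> \<notin> R"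
begin

lemmas R_facts = subringE[OF subring_R]

lemma R_in_K: "x \<in> R \<Longrightarrow> x \<in> carrier K"
  using R_facts(1) by auto

text \<open>The fractional ideal generated by the inverse of \<open>\<pi>\<close> to the power
  \<open>k\<close>, tested by multiplying back into \<open>R\<close> so that the closure properties
  need no inverses.\<close>

definition Q :: "nat \<Rightarrow> 'k set" where
  "Q k = {x \<in> carrier K. \<pi> [^]\<^bsub>K\<^esub> k \<otimes>\<^bsub>K\<^esub> x \<in> R}"

lemma pi_pow_in_R: "\<pi> [^]\<^bsub>K\<^esub> (k::nat) \<in> R"
  by (induction k) (use R_facts pi_in_R in auto)

lemma pi_pow_closed: "\<pi> [^]\<^bsub>K\<^esub> (k::nat) \<in> carrier K"
  using pi_pow_in_R R_in_K by blast

lemma pi_pow_nonzero: "\<pi> [^]\<^bsub>K\<^esub> (k::nat) \<noteq> \<zero>\<^bsub>K\<^esub>"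
  using pi_in_R R_in_K pi_nonzero K.pow_neq_zero by blast

lemma pi_pow_Units: "\<pi> [^]\<^bsub>K\<^esub> (k::nat) \<in> Units K"
  using pi_pow_nonzero pi_pow_closed K.field_Units by auto

lemma Q_closed: "x \<in> Q k \<Longrightarrow> x \<in> carrier K"
  by (simp add: Q_def)

lemma Q_zero: "\<zero>\<^bsub>K\<^esub> \<in> Q k"
  using R_facts pi_pow_closed by (simp add: Q_def)

lemma Q_add: "x \<in> Q k \<Longrightarrow> y \<in> Q k \<Longrightarrow> x \<oplus>\<^bsub>K\<^esub> y \<in> Q k"
  using R_facts pi_pow_closed by (simp add: Q_def K.r_distr)

lemma Q_uminus: "x \<in> Q k \<Longrightarrow> \<ominus>\<^bsub>K\<^esub> x \<in> Q k"
  using R_facts pi_pow_closed by (simp add: Q_def K.r_minus)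

lemma Q_minus: "x \<in> Q k \<Longrightarrow> y \<in> Q k \<Longrightarrow> x \<ominus>\<^bsub>K\<^esub> y \<in> Q k"
  by (simp add: a_minus_def Q_add Q_uminus)

lemma Q_mono:
  assumes "k \<le> l" "x \<in> Q k"
  shows "x \<in> Q l"
proof -
  have "\<pi> [^]\<^bsub>K\<^esub> l \<otimes>\<^bsub>K\<^esub> x = \<pi> [^]\<^bsub>K\<^esub> (l - k) \<otimes>\<^bsub>K\<^esub> (\<pi> [^]\<^bsub>K\<^esub> k \<otimes>\<^bsub>K\<^esub> x)"
    using assms pi_pow_closed R_in_K[OF pi_in_R]
    by (simp add: Q_def K.nat_pow_mult flip: K.m_assoc)
  then show ?thesis
    using assms R_facts pi_pow_in_R by (simp add: Q_def)
qed

lemma R_subset_Q: "x \<in> R \<Longrightarrow> x \<in> Q k"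
  using R_facts pi_pow_in_R by (auto simp: Q_def)

lemma inv_pi_pow_mult_in_Q:
  assumes "x \<in> R"
  shows "inv\<^bsub>K\<^esub> (\<pi> [^]\<^bsub>K\<^esub> k) \<otimes>\<^bsub>K\<^esub> x \<in> Q k"
  using assms pi_pow_Units[of k] R_in_K[OF assms] pi_pow_closed
  by (simp add: Q_def flip: K.m_assoc)

text \<open>Membership would allow powers of \<open>\<pi>\<close> to be multiplied in until a single
  inverse of \<open>\<pi>\<close> is left in \<open>R\<close>. So the ideals \<open>Q k\<close>
  increase strictly, which later turns strict growth of the exponents into normality of the
  subgroups.\<close>

lemma inv_pi_pow_not_in_Q:
  assumes "k < l"
  shows "inv\<^bsub>K\<^esub> (\<pi> [^]\<^bsub>K\<^esub> l) \<notin> Q k"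
proof
  let ?p = "\<lambda>j::nat. \<pi> [^]\<^bsub>K\<^esub> j"
  assume "inv\<^bsub>K\<^esub> (?p l) \<in> Q k"
  \<comment> \<open>The extra power \<open>l - Suc k\<close> is the one that leaves exponent minus
    one.\<close>
  then have "?p (l - Suc k) \<otimes>\<^bsub>K\<^esub> (?p k \<otimes>\<^bsub>K\<^esub> inv\<^bsub>K\<^esub> (?p l)) \<in> R"
    using R_facts pi_pow_in_R by (simp add: Q_def)
  also have "?p (l - Suc k) \<otimes>\<^bsub>K\<^esub> (?p k \<otimes>\<^bsub>K\<^esub> inv\<^bsub>K\<^esub> (?p l)) = ?p (l - 1) \<otimes>\<^bsub>K\<^esub> inv\<^bsub>K\<^esub> (?p l)"
    using pi_pow_closed pi_pow_Units[of l] R_in_K[OF pi_in_R] assms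
    by (simp add: K.nat_pow_mult flip: K.m_assoc)
  also have "?p l = ?p (l - 1) \<otimes>\<^bsub>K\<^esub> \<pi>"
    using assms by (cases l) auto
  also have "?p (l - 1) \<otimes>\<^bsub>K\<^esub> inv\<^bsub>K\<^esub> (?p (l - 1) \<otimes>\<^bsub>K\<^esub> \<pi>) = inv\<^bsub>K\<^esub> \<pi>"
  proof -
    have u: "\<pi> \<in> Units K" "?p (l - 1) \<in> Units K"
      using pi_pow_Units pi_in_R pi_nonzero K.field_Units R_in_K by auto
    note c = u[THEN K.Units_closed] u[THEN K.Units_inv_closed]
    have "(?p (l - 1) \<otimes>\<^bsub>K\<^esub> \<pi>) \<otimes>\<^bsub>K\<^esub> (inv\<^bsub>K\<^esub> (?p (l - 1)) \<otimes>\<^bsub>K\<^esub> inv\<^bsub>K\<^esub> \<pi>) =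
        (?p (l - 1) \<otimes>\<^bsub>K\<^esub> inv\<^bsub>K\<^esub> (?p (l - 1))) \<otimes>\<^bsub>K\<^esub> (\<pi> \<otimes>\<^bsub>K\<^esub> inv\<^bsub>K\<^esub> \<pi>)"
      using c by (simp only: K.m_ac K.m_closed)
    then have "inv\<^bsub>K\<^esub> (?p (l - 1) \<otimes>\<^bsub>K\<^esub> \<pi>) = inv\<^bsub>K\<^esub> (?p (l - 1)) \<otimes>\<^bsub>K\<^esub> inv\<^bsub>K\<^esub> \<pi>"
      using u c by (intro K.comm_inv_char) auto
    then have "?p (l - 1) \<otimes>\<^bsub>K\<^esub> inv\<^bsub>K\<^esub> (?p (l - 1) \<otimes>\<^bsub>K\<^esub> \<pi>) = (?p (l - 1) \<otimes>\<^bsub>K\<^esub> inv\<^bsub>K\<^esub> (?p (l - 1))) \<otimes>\<^bsub>K\<^esub> inv\<^bsub>K\<^esub> \<pi>"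
      using c by (simp add: K.m_assoc)
    then show ?thesis using u by simp
  qed
  finally show False using pi_not_unit by simp
qed

abbreviation "RG \<equiv> group_ring (K\<lparr>carrier := R\<rparr>) G"

lemma RG_carrier: "x \<in> carrier RG \<longleftrightarrow> (\<forall>y\<in>carrier G. x y \<in> R) \<and> (\<forall>y. y \<notin> carrier G \<longrightarrow> x y = \<zero>\<^bsub>K\<^esub>)"
  by (simp add: group_ring_carrier)

lemma RG_subset: "x \<in> carrier RG \<Longrightarrow> x \<in> carrier KG"
  using R_facts(1) by (auto simp: group_ring_carrier)

lemma RG_coeff: "x \<in> carrier RG \<Longrightarrow> x y \<in> R"
  using R_facts(2) by (cases "y \<in> carrier G") (auto simp: RG_carrier)

lemma RG_mult_in: "x \<in> carrier RG \<Longrightarrow> y \<in> carrier RG \<Longrightarrow> x \<otimes>\<^bsub>KG\<^esub> y \<in> carrier RG"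
  using R_facts by (auto simp: RG_carrier group_ring_mult RG_coeff
      intro!: K.finsum_subring_eq(2)[OF subring_R finite_G])

lemma RG_mult: "x \<in> carrier RG \<Longrightarrow> y \<in> carrier RG \<Longrightarrow> x \<otimes>\<^bsub>RG\<^esub> y = x \<otimes>\<^bsub>KG\<^esub> y"
  using R_facts RG_coeff
  by (intro ext) (auto simp: group_ring_mult intro!: K.finsum_subring_eq(1)[OF subring_R finite_G])

lemma ge_in_RG: "g \<in> carrier G \<Longrightarrow> ge g \<in> carrier RG"
  using R_facts by (auto simp: RG_carrier group_elem_def)

lemma Tr_in_RG: "P \<subseteq> carrier G \<Longrightarrow> Tr K G P \<in> carrier RG"
  using R_facts by (auto simp: RG_carrier Tr_eq)

text \<open>The value at \<open>y\<close> sums \<open>x\<close> over the left coset of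
  \<open>P\<close> through \<open>y\<close>, and this is also the coset through the translate of
  \<open>y\<close> by \<open>p\<close>.\<close>

lemma mult_Tr_invariant:
  assumes "subgroup P G" "x \<in> carrier KG" "y \<in> carrier G" "p \<in> P"
  shows "(x \<otimes>\<^bsub>KG\<^esub> Tr K G P) (y \<otimes>\<^bsub>G\<^esub> p) = (x \<otimes>\<^bsub>KG\<^esub> Tr K G P) y"
proof -
  interpret P: subgroup P G by fact
  have p: "p \<in> carrier G" using assms by auto
  have "inv\<^bsub>G\<^esub> z \<otimes>\<^bsub>G\<^esub> (y \<otimes>\<^bsub>G\<^esub> p) \<in> P \<longleftrightarrow> inv\<^bsub>G\<^esub> z \<otimes>\<^bsub>G\<^esub> y \<in> P" if "z \<in> carrier G" for z
  proof -
    let ?w = "inv\<^bsub>G\<^esub> z \<otimes>\<^bsub>G\<^esub> y"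
    have w: "?w \<in> carrier G" using that assms by simp
    have eq: "inv\<^bsub>G\<^esub> z \<otimes>\<^bsub>G\<^esub> (y \<otimes>\<^bsub>G\<^esub> p) = ?w \<otimes>\<^bsub>G\<^esub> p"
      using that assms p by (simp add: G.m_assoc)
    have "?w = (?w \<otimes>\<^bsub>G\<^esub> p) \<otimes>\<^bsub>G\<^esub> inv\<^bsub>G\<^esub> p" using w p by (simp add: G.m_assoc)
    then show ?thesis unfolding eq using assms(4) P.m_closed P.m_inv_closed by metis
  qed
  then show ?thesis
    using assms p coeff_closed[OF assms(2)]
    by (auto simp: group_ring_mult Tr_eq[OF P.subset] intro!: K.finsum_cong')
qed

text \<open>The exponent \<open>m i\<close> is paired with the next subgroup
  \<open>P (Suc i)\<close>, because modulo \<open>Q (m i)\<close> the first summand that can matter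
  has index \<open>Suc i\<close>. No congruence involves \<open>P 0\<close>, and the first clause
  bounds all denominators by the top exponent.\<close>

definition trace_cond :: "nat \<Rightarrow> (nat \<Rightarrow> nat) \<Rightarrow> (nat \<Rightarrow> 'g set) \<Rightarrow> ('g \<Rightarrow> 'k) \<Rightarrow> bool" where
  "trace_cond r m P f \<longleftrightarrow> (\<forall>x\<in>carrier G. f x \<in> Q (m r)) \<and>
     (\<forall>i<r. \<forall>x\<in>carrier G. \<forall>p\<in>P (Suc i). f x \<ominus>\<^bsub>K\<^esub> f (x \<otimes>\<^bsub>G\<^esub> p) \<in> Q (m i))"

text \<open>Splitting off the top summand leaves a trace sum of the same kind, which is what allows
  induction on \<open>r\<close>; the coefficient family is cut or extended at index
  \<open>Suc r\<close>.\<close>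

lemma trace_sum_Suc:
  assumes "\<And>i. i \<le> Suc r \<Longrightarrow> subgroup (P i) G" "\<And>i. i \<le> Suc r \<Longrightarrow> n i = int (m i)"
  shows "f \<in> trace_sum K R G \<pi> (Suc r) n P \<longleftrightarrow>
     (\<exists>e\<in>trace_sum K R G \<pi> r n P. \<exists>x\<in>carrier RG.
        f = (inv\<^bsub>K\<^esub> (\<pi> [^]\<^bsub>K\<^esub> m (Suc r)) \<odot>\<^bsub>KG\<^esub> (x \<otimes>\<^bsub>KG\<^esub> Tr K G (P (Suc r)))) \<oplus>\<^bsub>KG\<^esub> e)"
    (is "_ \<longleftrightarrow> ?rhs")
proof -
  define t where "t x i = (\<pi> [^]\<^bsub>K\<^esub> (- n i)) \<odot>\<^bsub>KG\<^esub> (x i \<otimes>\<^bsub>KG\<^esub> Tr K G (P i))" for x i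
  have t_closed: "t x i \<in> carrier KG" if "x i \<in> carrier RG" "i \<le> Suc r" for x i
  proof -
    have "x i \<otimes>\<^bsub>KG\<^esub> Tr K G (P i) \<in> carrier KG"
      using that assms(1) RG_subset Tr_closed subgroup.subset by blast
    moreover have "\<pi> [^]\<^bsub>K\<^esub> (- n i) \<in> carrier K"
      using that assms(2) pi_pow_Units R_in_K[OF pi_in_R]
      by (simp add: int_pow_uminus_int[OF K.field_axioms])
    ultimately show ?thesis unfolding t_def
      by (auto simp: group_ring_carrier)
  qed
  have pw: "\<pi> [^]\<^bsub>K\<^esub> (- n (Suc r)) = inv\<^bsub>K\<^esub> (\<pi> [^]\<^bsub>K\<^esub> m (Suc r))"
    using assms(2) R_in_K[OF pi_in_R] by (simp add: int_pow_uminus_int[OF K.field_axioms])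
  have ts: "f \<in> trace_sum K R G \<pi> r' n P \<longleftrightarrow> (\<exists>x. f = (\<Oplus>\<^bsub>KG\<^esub>i\<in>{..r'}. t x i) \<and> (\<forall>i\<le>r'. x i \<in> carrier RG))"
    for f r'
    unfolding trace_sum_def t_def by blast
  show ?thesis
  proof
    assume "f \<in> trace_sum K R G \<pi> (Suc r) n P"
    then obtain x where x: "f = (\<Oplus>\<^bsub>KG\<^esub>i\<in>{..Suc r}. t x i)" "\<forall>i\<le>Suc r. x i \<in> carrier RG"
      unfolding ts by blast
    have "f = t x (Suc r) \<oplus>\<^bsub>KG\<^esub> (\<Oplus>\<^bsub>KG\<^esub>i\<in>{..r}. t x i)"
      unfolding x(1) using x(2) t_closed by (intro KG.finsum_Suc) auto
    moreover have "(\<Oplus>\<^bsub>KG\<^esub>i\<in>{..r}. t x i) \<in> trace_sum K R G \<pi> r n P"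
      unfolding ts using x(2) by auto
    ultimately show ?rhs using x(2) unfolding t_def pw by blast
  next
    assume ?rhs
    then obtain e y where e: "e \<in> trace_sum K R G \<pi> r n P" and y: "y \<in> carrier RG"
      and f0: "f = (inv\<^bsub>K\<^esub> (\<pi> [^]\<^bsub>K\<^esub> m (Suc r)) \<odot>\<^bsub>KG\<^esub> (y \<otimes>\<^bsub>KG\<^esub> Tr K G (P (Suc r)))) \<oplus>\<^bsub>KG\<^esub> e"
      by blast
    from e obtain x where x: "\<forall>i\<le>r. x i \<in> carrier RG" and ex: "e = (\<Oplus>\<^bsub>KG\<^esub>i\<in>{..r}. t x i)"
      unfolding ts by blast
    note f = f0[unfolded ex]
    let ?x = "x(Suc r := y)"
    have x': "\<forall>i\<le>Suc r. ?x i \<in> carrier RG" using x y by auto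
    have "(\<Oplus>\<^bsub>KG\<^esub>i\<in>{..Suc r}. t ?x i) = t ?x (Suc r) \<oplus>\<^bsub>KG\<^esub> (\<Oplus>\<^bsub>KG\<^esub>i\<in>{..r}. t ?x i)"
      using x' t_closed by (intro KG.finsum_Suc) auto
    also have "(\<Oplus>\<^bsub>KG\<^esub>i\<in>{..r}. t ?x i) = (\<Oplus>\<^bsub>KG\<^esub>i\<in>{..r}. t x i)"
      using x t_closed by (intro KG.finsum_cong') (auto simp: t_def)
    also have "t ?x (Suc r) = inv\<^bsub>K\<^esub> (\<pi> [^]\<^bsub>K\<^esub> m (Suc r)) \<odot>\<^bsub>KG\<^esub> (y \<otimes>\<^bsub>KG\<^esub> Tr K G (P (Suc r)))"
      unfolding t_def pw by simp
    finally have "f = (\<Oplus>\<^bsub>KG\<^esub>i\<in>{..Suc r}. t ?x i)"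
      unfolding f by (rule sym)
    then show "f \<in> trace_sum K R G \<pi> (Suc r) n P"
      unfolding ts using x' by blast
  qed
qed

text \<open>The predicate inside \<open>SOME\<close> depends only on the left coset of
  \<open>x\<close>, so the chosen element is automatically constant on that coset.\<close>

lemma coset_representatives:
  assumes "subgroup P G"
  obtains rep where "\<And>x. x \<in> carrier G \<Longrightarrow> rep x \<in> carrier G"
    "\<And>x. x \<in> carrier G \<Longrightarrow> inv\<^bsub>G\<^esub> (rep x) \<otimes>\<^bsub>G\<^esub> x \<in> P"
    "\<And>x y. x \<in> carrier G \<Longrightarrow> y \<in> carrier G \<Longrightarrow> inv\<^bsub>G\<^esub> y \<otimes>\<^bsub>G\<^esub> x \<in> P \<Longrightarrow> rep x = rep y"
proof
  interpret P: subgroup P G by fact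
  define rep where "rep x = (SOME z. z \<in> carrier G \<and> inv\<^bsub>G\<^esub> z \<otimes>\<^bsub>G\<^esub> x \<in> P)" for x
  have r: "rep x \<in> carrier G \<and> inv\<^bsub>G\<^esub> (rep x) \<otimes>\<^bsub>G\<^esub> x \<in> P" if "x \<in> carrier G" for x
    unfolding rep_def by (rule someI[of _ x]) (use that in auto)
  show "rep x \<in> carrier G" "inv\<^bsub>G\<^esub> (rep x) \<otimes>\<^bsub>G\<^esub> x \<in> P" if "x \<in> carrier G" for x
    using r[OF that] by auto
  show "rep x = rep y" if xy: "x \<in> carrier G" "y \<in> carrier G" "inv\<^bsub>G\<^esub> y \<otimes>\<^bsub>G\<^esub> x \<in> P" for x y
  proof -
    have "inv\<^bsub>G\<^esub> z \<otimes>\<^bsub>G\<^esub> x \<in> P \<longleftrightarrow> inv\<^bsub>G\<^esub> z \<otimes>\<^bsub>G\<^esub> y \<in> P" if z: "z \<in> carrier G" for z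
    proof -
      have "inv\<^bsub>G\<^esub> z \<otimes>\<^bsub>G\<^esub> x = (inv\<^bsub>G\<^esub> z \<otimes>\<^bsub>G\<^esub> y) \<otimes>\<^bsub>G\<^esub> (inv\<^bsub>G\<^esub> y \<otimes>\<^bsub>G\<^esub> x)"
        using z xy by (simp add: G.m_assoc G.cancel_inv)
      moreover have "inv\<^bsub>G\<^esub> z \<otimes>\<^bsub>G\<^esub> y = (inv\<^bsub>G\<^esub> z \<otimes>\<^bsub>G\<^esub> x) \<otimes>\<^bsub>G\<^esub> inv\<^bsub>G\<^esub> (inv\<^bsub>G\<^esub> y \<otimes>\<^bsub>G\<^esub> x)"
        using z xy by (simp add: G.m_assoc G.inv_mult_group G.cancel_inv)
      ultimately show ?thesis using xy(3) P.m_closed P.m_inv_closed by metis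
    qed
    then show ?thesis unfolding rep_def by (metis (no_types, lifting))
  qed
qed

text \<open>With \<open>P 0\<close> trivial the only trace is the identity, and what remains is
  \<open>R[G]\<close> scaled by one power of \<open>\<pi>\<close>.\<close>

lemma trace_sum_0:
  assumes "P 0 = {\<one>\<^bsub>G\<^esub>}" "n 0 = int (m 0)"
  shows "f \<in> trace_sum K R G \<pi> 0 n P \<longleftrightarrow> f \<in> carrier KG \<and> (\<forall>x\<in>carrier G. f x \<in> Q (m 0))"
proof -
  let ?c = "inv\<^bsub>K\<^esub> (\<pi> [^]\<^bsub>K\<^esub> m 0)"
  have pw: "\<pi> [^]\<^bsub>K\<^esub> (- n 0) = ?c" "?c \<in> carrier K"
    using assms(2) R_in_K[OF pi_in_R] pi_pow_Units
    by (simp_all add: int_pow_uminus_int[OF K.field_axioms])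
  have Tr1: "Tr K G {\<one>\<^bsub>G\<^esub>} = \<one>\<^bsub>KG\<^esub>"
    by (auto simp: Tr_eq group_elem_def)
  have sum: "(\<Oplus>\<^bsub>KG\<^esub>i\<in>{..0::nat}. (\<pi> [^]\<^bsub>K\<^esub> (- n i)) \<odot>\<^bsub>KG\<^esub> (x i \<otimes>\<^bsub>KG\<^esub> Tr K G (P i))) = ?c \<odot>\<^bsub>KG\<^esub> x 0"
    if x: "x 0 \<in> carrier RG" for x :: "nat \<Rightarrow> 'g \<Rightarrow> 'k"
  proof -
    have "?c \<odot>\<^bsub>KG\<^esub> x 0 \<in> carrier KG"
      using RG_subset[OF x] pw(2) by (auto simp: group_ring_carrier)
    moreover have "(\<pi> [^]\<^bsub>K\<^esub> (- n 0)) \<odot>\<^bsub>KG\<^esub> (x 0 \<otimes>\<^bsub>KG\<^esub> Tr K G (P 0)) = ?c \<odot>\<^bsub>KG\<^esub> x 0"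
      unfolding assms(1) Tr1 pw(1) using RG_subset[OF x] by (simp only: KG.r_one)
    ultimately show ?thesis by (simp del: group_ring_simps)
  qed
  have "f \<in> trace_sum K R G \<pi> 0 n P \<longleftrightarrow> (\<exists>y\<in>carrier RG. f = ?c \<odot>\<^bsub>KG\<^esub> y)"
  proof
    assume "f \<in> trace_sum K R G \<pi> 0 n P"
    then show "\<exists>y\<in>carrier RG. f = ?c \<odot>\<^bsub>KG\<^esub> y"
      unfolding trace_sum_def using sum by blast
  next
    assume "\<exists>y\<in>carrier RG. f = ?c \<odot>\<^bsub>KG\<^esub> y"
    then obtain y where y: "y \<in> carrier RG" "f = ?c \<odot>\<^bsub>KG\<^esub> y" by blast
    show "f \<in> trace_sum K R G \<pi> 0 n P"
      unfolding trace_sum_def y(2) using sum[of "\<lambda>_. y"] y(1) by (intro CollectI exI[of _ "\<lambda>_. y"]) simp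
  qed
  also have "\<dots> \<longleftrightarrow> f \<in> carrier KG \<and> (\<forall>x\<in>carrier G. f x \<in> Q (m 0))"
  proof
    assume "\<exists>y\<in>carrier RG. f = ?c \<odot>\<^bsub>KG\<^esub> y"
    then show "f \<in> carrier KG \<and> (\<forall>x\<in>carrier G. f x \<in> Q (m 0))"
      using pw(2) inv_pi_pow_mult_in_Q R_in_K by (auto simp: group_ring_carrier)
  next
    assume f: "f \<in> carrier KG \<and> (\<forall>x\<in>carrier G. f x \<in> Q (m 0))"
    then have "f = ?c \<odot>\<^bsub>KG\<^esub> (\<pi> [^]\<^bsub>K\<^esub> m 0 \<odot>\<^bsub>KG\<^esub> f)"
      using pw(2) pi_pow_closed pi_pow_Units by (auto simp: coeff_closed simp flip: K.m_assoc)
    moreover have "\<pi> [^]\<^bsub>K\<^esub> m 0 \<odot>\<^bsub>KG\<^esub> f \<in> carrier RG"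
      using f pi_pow_closed by (auto simp: RG_carrier Q_def outside)
    ultimately show "\<exists>y\<in>carrier RG. f = ?c \<odot>\<^bsub>KG\<^esub> y" by blast
  qed
  finally show ?thesis .
qed

text \<open>Modulo \<open>\<pi>\<^sup>-\<^sup>n R\<close> with \<open>n = n i\<close>, only the summands with index above \<open>i\<close> survive, and those
  are invariant under right translation by \<open>P (i+1)\<close>. Conversely a function satisfying these
  congruences is stripped of its top summand by reading it off on coset representatives.\<close>

lemma trace_sum_iff:
  assumes "\<forall>i\<le>r. subgroup (P i) G" "P 0 = {\<one>\<^bsub>G\<^esub>}" "\<forall>i<r. P i \<subseteq> P (Suc i)"
    "\<forall>i\<le>r. n i = int (m i)" "\<forall>i<r. m i \<le> m (Suc i)"
  shows "f \<in> trace_sum K R G \<pi> r n P \<longleftrightarrow> f \<in> carrier KG \<and> trace_cond r m P f"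
  using assms
proof (induction r arbitrary: f)
  case 0
  then show ?case by (simp add: trace_sum_0 trace_cond_def)
next
  case (Suc r)
  let ?P = "P (Suc r)" and ?q = "\<pi> [^]\<^bsub>K\<^esub> m (Suc r)"
  interpret P: subgroup ?P G using Suc.prems by auto
  have IH: "e \<in> trace_sum K R G \<pi> r n P \<longleftrightarrow> e \<in> carrier KG \<and> trace_cond r m P e" for e
    using Suc.prems by (intro Suc.IH) auto
  have P_le: "P i \<subseteq> ?P" if "i \<le> Suc r" for i
    using that
  proof (induction rule: inc_induct)
    case (step j)
    then show ?case using Suc.prems(3) by blast
  qed simp
  have q: "?q \<in> carrier K" "inv\<^bsub>K\<^esub> ?q \<in> carrier K" "?q \<in> Units K"
    using pi_pow_closed pi_pow_Units by auto
  have step: "f \<in> trace_sum K R G \<pi> (Suc r) n P \<longleftrightarrow>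
     (\<exists>e\<in>trace_sum K R G \<pi> r n P. \<exists>x\<in>carrier RG.
        f = (inv\<^bsub>K\<^esub> ?q \<odot>\<^bsub>KG\<^esub> (x \<otimes>\<^bsub>KG\<^esub> Tr K G ?P)) \<oplus>\<^bsub>KG\<^esub> e)"
    using Suc.prems by (intro trace_sum_Suc) auto
  show ?case
  proof
    assume "f \<in> trace_sum K R G \<pi> (Suc r) n P"
    then obtain e x where e0: "e \<in> trace_sum K R G \<pi> r n P" and x: "x \<in> carrier RG"
      and f: "f = (inv\<^bsub>K\<^esub> ?q \<odot>\<^bsub>KG\<^esub> (x \<otimes>\<^bsub>KG\<^esub> Tr K G ?P)) \<oplus>\<^bsub>KG\<^esub> e"
      unfolding step by (elim bexE)
    have e: "e \<in> carrier KG" "trace_cond r m P e" using e0 IH by auto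
    define h where "h = inv\<^bsub>K\<^esub> ?q \<odot>\<^bsub>KG\<^esub> (x \<otimes>\<^bsub>KG\<^esub> Tr K G ?P)"
    have xT: "x \<otimes>\<^bsub>KG\<^esub> Tr K G ?P \<in> carrier RG"
      using x Tr_in_RG P.subset by (intro RG_mult_in) auto
    have hQ: "h y \<in> Q (m (Suc r))" for y
      unfolding h_def using RG_coeff[OF xT] by (auto intro: inv_pi_pow_mult_in_Q)
    have h: "h \<in> carrier KG"
      unfolding h_def using RG_subset[OF xT] q by (auto simp: group_ring_carrier)
    have inv_h: "h (y \<otimes>\<^bsub>G\<^esub> p) = h y" if "y \<in> carrier G" "p \<in> ?P" for y p
      unfolding h_def using mult_Tr_invariant[OF P.subgroup_axioms RG_subset[OF x] that] by simp
    have fy: "f y = h y \<oplus>\<^bsub>K\<^esub> e y" for y by (simp add: f h_def)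
    have fQ: "f y \<in> Q (m (Suc r))" if "y \<in> carrier G" for y
      unfolding fy using hQ e that Suc.prems(5) by (auto simp: trace_cond_def intro!: Q_add intro: Q_mono[of "m r" "m (Suc r)"])
    have "f y \<ominus>\<^bsub>K\<^esub> f (y \<otimes>\<^bsub>G\<^esub> p) \<in> Q (m i)" if y: "y \<in> carrier G" and i: "i < Suc r" and p: "p \<in> P (Suc i)" for y i p
    proof -
      have p': "p \<in> ?P" "p \<in> carrier G" using P_le[of "Suc i"] i p P.subset by auto
      have "f y \<ominus>\<^bsub>K\<^esub> f (y \<otimes>\<^bsub>G\<^esub> p) = (h y \<oplus>\<^bsub>K\<^esub> e y) \<ominus>\<^bsub>K\<^esub> (h y \<oplus>\<^bsub>K\<^esub> e (y \<otimes>\<^bsub>G\<^esub> p))"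
        unfolding fy using inv_h[OF y p'(1)] by simp
      also have "\<dots> = e y \<ominus>\<^bsub>K\<^esub> e (y \<otimes>\<^bsub>G\<^esub> p)"
        using coeff_closed[OF h] coeff_closed[OF e(1)] by (simp add: K.add_diff_cancel_left)
      also have "\<dots> \<in> Q (m i)"
      proof (cases "i = r")
        \<comment> \<open>At the top index the remainder \<open>e\<close> carries no congruence; the
          bound on its values by \<open>Q (m r)\<close> is used instead.\<close>
        case True
        then show ?thesis using e(2) y p' by (auto simp: trace_cond_def intro!: Q_minus)
      next
        case False
        then show ?thesis using e(2) y p i by (auto simp: trace_cond_def)
      qed
      finally show ?thesis .
    qed
    then have "trace_cond (Suc r) m P f" using fQ by (auto simp: trace_cond_def)
    moreover have "f \<in> carrier KG" using h e(1) unfolding f h_def[symmetric] by (rule KG.a_closed)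
    ultimately show "f \<in> carrier KG \<and> trace_cond (Suc r) m P f" by blast
  next
    assume "f \<in> carrier KG \<and> trace_cond (Suc r) m P f"
    then have f: "f \<in> carrier KG" "trace_cond (Suc r) m P f" by auto
    obtain rep where rep: "\<And>x. x \<in> carrier G \<Longrightarrow> rep x \<in> carrier G"
      "\<And>x. x \<in> carrier G \<Longrightarrow> inv\<^bsub>G\<^esub> (rep x) \<otimes>\<^bsub>G\<^esub> x \<in> ?P"
      "\<And>x y. x \<in> carrier G \<Longrightarrow> y \<in> carrier G \<Longrightarrow> inv\<^bsub>G\<^esub> y \<otimes>\<^bsub>G\<^esub> x \<in> ?P \<Longrightarrow> rep x = rep y"
      using coset_representatives[OF P.subgroup_axioms] by blast
    \<comment> \<open>\<open>x\<close> lives on representatives only, so its product with the trace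
      copies the value of \<open>f\<close> at \<open>rep y\<close> over the whole coset. The factor
      \<open>?q\<close> brings its values into \<open>R\<close> and is cancelled again in
      \<open>h\<close>.\<close>
    define x where "x y = (if y \<in> rep ` carrier G then ?q \<otimes>\<^bsub>K\<^esub> f y else \<zero>\<^bsub>K\<^esub>)" for y
    have x: "x \<in> carrier RG"
      using f(2) rep(1) R_facts by (auto simp: RG_carrier x_def trace_cond_def Q_def)
    have xT: "(x \<otimes>\<^bsub>KG\<^esub> Tr K G ?P) y = ?q \<otimes>\<^bsub>K\<^esub> f (rep y)" if y: "y \<in> carrier G" for y
    proof -
      have "(x \<otimes>\<^bsub>KG\<^esub> Tr K G ?P) y = (\<Oplus>\<^bsub>K\<^esub>z\<in>carrier G. x z \<otimes>\<^bsub>K\<^esub> Tr K G ?P (inv\<^bsub>G\<^esub> z \<otimes>\<^bsub>G\<^esub> y))"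
        using y by (simp add: group_ring_mult)
      also have "\<dots> = x (rep y) \<otimes>\<^bsub>K\<^esub> Tr K G ?P (inv\<^bsub>G\<^esub> (rep y) \<otimes>\<^bsub>G\<^esub> y)"
      proof (rule K.finsum_single)
        fix z assume z: "z \<in> carrier G" "z \<noteq> rep y"
        show "x z \<otimes>\<^bsub>K\<^esub> Tr K G ?P (inv\<^bsub>G\<^esub> z \<otimes>\<^bsub>G\<^esub> y) = \<zero>\<^bsub>K\<^esub>"
        proof (cases "z \<in> rep ` carrier G \<and> inv\<^bsub>G\<^esub> z \<otimes>\<^bsub>G\<^esub> y \<in> ?P")
          \<comment> \<open>A representative in the coset of \<open>y\<close> is
            \<open>rep y\<close> itself, because \<open>rep\<close> is idempotent and constant on
            cosets.\<close>
          case True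
          then obtain w where w: "w \<in> carrier G" "z = rep w" by auto
          have "rep w = rep (rep w)" "rep y = rep z"
            using rep w y z True by blast+
          with z w show ?thesis by simp
        next
          case False
          then show ?thesis
            using coeff_closed[OF Tr_closed[OF P.subset]] coeff_closed[OF RG_subset[OF x]]
            by (auto simp: Tr_eq[OF P.subset] x_def)
        qed
      qed (use y rep(1) coeff_closed[OF Tr_closed[OF P.subset]] coeff_closed[OF RG_subset[OF x]] finite_G in auto)
      also have "\<dots> = ?q \<otimes>\<^bsub>K\<^esub> f (rep y)"
        using rep(1,2) y q coeff_closed[OF f(1)] by (simp add: Tr_eq[OF P.subset] x_def)
      finally show ?thesis .
    qed
    define h where "h = inv\<^bsub>K\<^esub> ?q \<odot>\<^bsub>KG\<^esub> (x \<otimes>\<^bsub>KG\<^esub> Tr K G ?P)"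
    have h: "h \<in> carrier KG"
      unfolding h_def using KG.m_closed[OF RG_subset[OF x] Tr_closed[OF P.subset]] q
      by (auto simp: group_ring_carrier)
    have hy: "h y = f (rep y)" if "y \<in> carrier G" for y
      unfolding h_def using xT[OF that] q coeff_closed[OF f(1)] by (simp flip: K.m_assoc)
    define e where "e = f \<ominus>\<^bsub>KG\<^esub> h"
    have e: "e \<in> carrier KG" using f h by (simp add: e_def)
    have ey: "e y = f y \<ominus>\<^bsub>K\<^esub> f (rep y)" if "y \<in> carrier G" for y
      using uminus_apply[OF h] hy[OF that] by (simp add: e_def a_minus_def)
    \<comment> \<open>The congruence of index \<open>r\<close>, applied between \<open>rep y\<close>
      and \<open>y\<close>, bounds the remainder by \<open>Q (m r)\<close>; this is where the
      denominator drops.\<close>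
    have eQ: "e y \<in> Q (m r)" if y: "y \<in> carrier G" for y
    proof -
      have "f (rep y) \<ominus>\<^bsub>K\<^esub> f (rep y \<otimes>\<^bsub>G\<^esub> (inv\<^bsub>G\<^esub> (rep y) \<otimes>\<^bsub>G\<^esub> y)) \<in> Q (m r)"
        using f(2) rep y unfolding trace_cond_def by blast
      then have "\<ominus>\<^bsub>K\<^esub> (f (rep y) \<ominus>\<^bsub>K\<^esub> f y) \<in> Q (m r)"
        using rep(1) y by (simp add: G.cancel_inv Q_uminus)
      then show ?thesis
        using ey[OF y] coeff_closed[OF f(1)] by (simp add: K.minus_diff)
    qed
    have "e y \<ominus>\<^bsub>K\<^esub> e (y \<otimes>\<^bsub>G\<^esub> p) \<in> Q (m i)" if y: "y \<in> carrier G" and i: "i < r" and p: "p \<in> P (Suc i)" for y i p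
    proof -
      have p': "p \<in> ?P" "p \<in> carrier G" using P_le[of "Suc i"] i p P.subset by auto
      \<comment> \<open>The smaller subgroups lie in \<open>?P\<close>, so translating by
        \<open>p\<close> leaves the subtracted value unchanged.\<close>
      have "rep (y \<otimes>\<^bsub>G\<^esub> p) = rep y"
        using rep(3)[of "y \<otimes>\<^bsub>G\<^esub> p" y] y p' by (simp add: G.cancel_inv)
      then have "e y \<ominus>\<^bsub>K\<^esub> e (y \<otimes>\<^bsub>G\<^esub> p) = (f y \<ominus>\<^bsub>K\<^esub> f (rep y)) \<ominus>\<^bsub>K\<^esub> (f (y \<otimes>\<^bsub>G\<^esub> p) \<ominus>\<^bsub>K\<^esub> f (rep y))"
        using ey y p' by simp
      also have "\<dots> = f y \<ominus>\<^bsub>K\<^esub> f (y \<otimes>\<^bsub>G\<^esub> p)"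
        using coeff_closed[OF f(1)] by (simp add: K.diff_diff_cancel_right)
      also have "\<dots> \<in> Q (m i)" using f(2) i y p by (auto simp: trace_cond_def)
      finally show ?thesis .
    qed
    then have "trace_cond r m P e" using eQ by (auto simp: trace_cond_def)
    moreover have "f = h \<oplus>\<^bsub>KG\<^esub> e"
      unfolding e_def using f h by (rule_tac KG.add_diff_cancel[symmetric]) auto
    ultimately show "f \<in> trace_sum K R G \<pi> (Suc r) n P"
      unfolding step using x e by (intro bexI[of _ e] bexI[of _ x]) (simp_all only: IH h_def)
  qed
qed

end

section \<open>Tensor products\<close>

text \<open>The homomorphism out of the free abelian group determined by \<open>t\<close> on
  generators. It has the shape of the sum inside \<open>Ind_subset\<close>, so that both unfold to
  the same term.\<close>

definition frag_eval :: "('d, 'e) ring_scheme \<Rightarrow> ('u \<Rightarrow> 'd) \<Rightarrow> ('u \<Rightarrow>\<^sub>0 int) \<Rightarrow> 'd" where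
  "frag_eval D t c = (\<Oplus>\<^bsub>D\<^esub>u \<in> Poly_Mapping.keys c. [Poly_Mapping.lookup c u] \<cdot>\<^bsub>D\<^esub> t u)"

context abelian_group
begin

lemma diff_self: "x \<in> carrier G \<Longrightarrow> x \<ominus> x = \<zero>"
  by (simp add: a_minus_def r_neg)

lemma sum_diff_diff:
  assumes "x \<in> carrier G" "y \<in> carrier G"
  shows "(x \<oplus> y) \<ominus> x \<ominus> y = \<zero>"
proof -
  have "(x \<oplus> y) \<ominus> x \<ominus> y = (x \<oplus> \<ominus> x) \<oplus> (y \<oplus> \<ominus> y)"
    unfolding a_minus_def using assms by (simp only: a_ac a_closed a_inv_closed)
  then show ?thesis using assms by (simp add: r_neg)
qed

lemma int_add_pow_closed: "x \<in> carrier G \<Longrightarrow> add_pow G (i::int) x \<in> carrier G"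
  by (rule add.int_pow_closed)

lemma int_add_pow_diff: "x \<in> carrier G \<Longrightarrow> add_pow G ((i::int) - j) x = add_pow G (i) x \<ominus> add_pow G (j) x"
  unfolding a_minus_def by (rule add.int_pow_diff)

lemma int_add_pow_zero: "add_pow G (0::int) x = \<zero>"
  by (simp add: add_pow_def)

lemma int_add_pow_one: "x \<in> carrier G \<Longrightarrow> add_pow G (1::int) x = x"
  by (rule add.int_pow_1)

lemma frag_eval_superset:
  assumes "finite U" "Poly_Mapping.keys c \<subseteq> U" "\<And>u. u \<in> U \<Longrightarrow> t u \<in> carrier G"
  shows "frag_eval G t c = (\<Oplus>u\<in>U. add_pow G (Poly_Mapping.lookup c u) (t u))"
  unfolding frag_eval_def using assms
  by (intro add.finprod_mono_neutral_cong_left)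
     (auto simp: int_add_pow_zero int_add_pow_closed in_keys_iff)

lemma finsum_minusf:
  assumes "finite U" "\<And>u. u \<in> U \<Longrightarrow> f u \<in> carrier G" "\<And>u. u \<in> U \<Longrightarrow> g u \<in> carrier G"
  shows "(\<Oplus>u\<in>U. f u \<ominus> g u) = (\<Oplus>u\<in>U. f u) \<ominus> (\<Oplus>u\<in>U. g u)"
  using assms
proof (induction U rule: finite_induct)
  case empty
  then show ?case by (simp add: a_minus_def) (metis a_inv_closed l_zero r_neg zero_closed)
next
  case (insert a U)
  then have c: "f a \<in> carrier G" "g a \<in> carrier G" "(\<Oplus>u\<in>U. f u) \<in> carrier G" "(\<Oplus>u\<in>U. g u) \<in> carrier G"
    by (auto intro!: finsum_closed)
  have "(\<Oplus>u\<in>insert a U. f u \<ominus> g u) = (f a \<ominus> g a) \<oplus> ((\<Oplus>u\<in>U. f u) \<ominus> (\<Oplus>u\<in>U. g u))"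
    using insert by (simp add: Pi_def)
  also have "\<dots> = (f a \<oplus> (\<Oplus>u\<in>U. f u)) \<ominus> (g a \<oplus> (\<Oplus>u\<in>U. g u))"
    unfolding a_minus_def using c by (simp only: minus_add a_ac a_closed a_inv_closed)
  finally show ?case using insert by (simp add: Pi_def)
qed

lemma frag_eval_closed:
  assumes "\<And>u. u \<in> S \<Longrightarrow> t u \<in> carrier G" "Poly_Mapping.keys c \<subseteq> S"
  shows "frag_eval G t c \<in> carrier G"
  unfolding frag_eval_def using assms by (auto intro!: finsum_closed int_add_pow_closed)

text \<open>Subtraction is the basic operation here, since the induction rule for free abelian
  groups runs over zero, generators and differences; negation and addition are derived from
  it.\<close>

lemma frag_eval_diff:
  assumes "\<And>u. u \<in> S \<Longrightarrow> t u \<in> carrier G" "Poly_Mapping.keys c \<subseteq> S" "Poly_Mapping.keys d \<subseteq> S"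
  shows "frag_eval G t (c - d) = frag_eval G t c \<ominus> frag_eval G t d"
proof -
  let ?U = "Poly_Mapping.keys c \<union> Poly_Mapping.keys d"
  have tU: "t u \<in> carrier G" if "u \<in> ?U" for u using assms that by auto
  have "frag_eval G t (c - d) = (\<Oplus>u\<in>?U. add_pow G (Poly_Mapping.lookup (c - d) u) (t u))"
    using keys_diff[of c d] tU by (intro frag_eval_superset) auto
  also have "\<dots> = (\<Oplus>u\<in>?U. add_pow G (Poly_Mapping.lookup c u) (t u) \<ominus> add_pow G (Poly_Mapping.lookup d u) (t u))"
    using tU by (intro finsum_cong') (auto simp: lookup_minus int_add_pow_diff int_add_pow_closed)
  also have "\<dots> = frag_eval G t c \<ominus> frag_eval G t d"
    using tU frag_eval_superset[of ?U c t] frag_eval_superset[of ?U d t]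
    by (subst finsum_minusf) (auto simp: int_add_pow_closed)
  finally show ?thesis .
qed

lemma frag_eval_0: "frag_eval G t 0 = \<zero>"
  by (simp add: frag_eval_def)

lemma frag_eval_uminus:
  assumes "\<And>u. u \<in> S \<Longrightarrow> t u \<in> carrier G" "Poly_Mapping.keys c \<subseteq> S"
  shows "frag_eval G t (- c) = \<ominus> frag_eval G t c"
  using frag_eval_diff[of S t 0 c] assms frag_eval_closed[of S t c] by (simp add: frag_eval_0 a_minus_def)

lemma frag_eval_add:
  assumes "\<And>u. u \<in> S \<Longrightarrow> t u \<in> carrier G" "Poly_Mapping.keys c \<subseteq> S" "Poly_Mapping.keys d \<subseteq> S"
  shows "frag_eval G t (c + d) = frag_eval G t c \<oplus> frag_eval G t d"
  using frag_eval_diff[of S t c "- d"] frag_eval_uminus[of S t d] assms frag_eval_closed[of S t]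
  by (simp add: a_minus_def)

lemma frag_eval_frag_of: "t u \<in> carrier G \<Longrightarrow> frag_eval G t (frag_of u) = t u"
  by (simp add: frag_eval_def int_add_pow_one)

end

lemma subgroup_free_Abelian_group:
  assumes "subgroup N (free_Abelian_group S)"
  shows "0 \<in> N" "x \<in> N \<Longrightarrow> Poly_Mapping.keys x \<subseteq> S" "x \<in> N \<Longrightarrow> y \<in> N \<Longrightarrow> x + y \<in> N"
    "x \<in> N \<Longrightarrow> - x \<in> N" "x \<in> N \<Longrightarrow> y \<in> N \<Longrightarrow> x - y \<in> N"
proof -
  interpret subgroup N "free_Abelian_group S" by fact
  show "0 \<in> N" using one_closed by simp
  show sub: "x \<in> N \<Longrightarrow> Poly_Mapping.keys x \<subseteq> S" for x using mem_carrier by simp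
  show add: "x \<in> N \<Longrightarrow> y \<in> N \<Longrightarrow> x + y \<in> N" for x y using m_closed by fastforce
  show min: "x \<in> N \<Longrightarrow> - x \<in> N" for x using m_inv_closed[of x] sub[of x] by simp
  show "x \<in> N \<Longrightarrow> y \<in> N \<Longrightarrow> x - y \<in> N" using add[of x "- y"] min by simp
qed

lemma r_coset_free_Abelian_group:
  "N #>\<^bsub>free_Abelian_group S\<^esub> c = (\<lambda>x. x + c) ` N"
  by (auto simp: r_coset_def)

lemma r_coset_free_Abelian_group_eq_iff:
  assumes "subgroup N (free_Abelian_group S)"
  shows "N #>\<^bsub>free_Abelian_group S\<^esub> c = N #>\<^bsub>free_Abelian_group S\<^esub> d \<longleftrightarrow> c - d \<in> N"
    and "e \<in> N #>\<^bsub>free_Abelian_group S\<^esub> d \<longleftrightarrow> e - d \<in> N"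
proof -
  note N = subgroup_free_Abelian_group[OF assms]
  show mem: "e \<in> N #>\<^bsub>free_Abelian_group S\<^esub> d \<longleftrightarrow> e - d \<in> N" for e d
    unfolding r_coset_free_Abelian_group by (auto simp: image_iff intro!: bexI[of _ "e - d"])
  show "N #>\<^bsub>free_Abelian_group S\<^esub> c = N #>\<^bsub>free_Abelian_group S\<^esub> d \<longleftrightarrow> c - d \<in> N"
  proof
    assume "N #>\<^bsub>free_Abelian_group S\<^esub> c = N #>\<^bsub>free_Abelian_group S\<^esub> d"
    then show "c - d \<in> N" using mem[of c c] mem[of c d] N(1) by simp
  next
    assume cd: "c - d \<in> N"
    have "e - c \<in> N \<longleftrightarrow> e - d \<in> N" for e
      using N(3)[OF _ cd, of "e - c"] N(5)[OF _ cd, of "e - d"] by (auto simp: algebra_simps)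
    then show "N #>\<^bsub>free_Abelian_group S\<^esub> c = N #>\<^bsub>free_Abelian_group S\<^esub> d"
      using mem by blast
  qed
qed

locale tensor_product = A: ring A + V: abelian_group V
  for A :: "('a, 'c) ring_scheme" and B :: "'a set" and V :: "('a, 'v) module" +
  assumes B_subset: "B \<subseteq> carrier A"
    and B_smult_closed: "b \<in> B \<Longrightarrow> x \<in> carrier V \<Longrightarrow> b \<odot>\<^bsub>V\<^esub> x \<in> carrier V"
begin

abbreviation "AV \<equiv> carrier A \<times> carrier V"

abbreviation "cls \<equiv> tensor_class A B V"

abbreviation "rel \<equiv> tensor_relations A B V"

definition gens :: "(('a \<times> 'v) \<Rightarrow>\<^sub>0 int) set" where
  "gens = {frag_of (a \<oplus>\<^bsub>A\<^esub> a', x) - frag_of (a, x) - frag_of (a', x) | a a' x.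
          a \<in> carrier A \<and> a' \<in> carrier A \<and> x \<in> carrier V} \<union>
       {frag_of (a, x \<oplus>\<^bsub>V\<^esub> x') - frag_of (a, x) - frag_of (a, x') | a x x'.
          a \<in> carrier A \<and> x \<in> carrier V \<and> x' \<in> carrier V} \<union>
       {frag_of (a \<otimes>\<^bsub>A\<^esub> b, x) - frag_of (a, b \<odot>\<^bsub>V\<^esub> x) | a b x.
          a \<in> carrier A \<and> b \<in> B \<and> x \<in> carrier V}"

lemma rel_eq: "rel = generate (free_Abelian_group AV) gens"
  unfolding tensor_relations_def gens_def ..

lemma keys_diff_subset: "Poly_Mapping.keys x \<subseteq> S \<Longrightarrow> Poly_Mapping.keys y \<subseteq> S \<Longrightarrow> Poly_Mapping.keys (x - y) \<subseteq> S"
  for x y :: "'z \<Rightarrow>\<^sub>0 int"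
  using keys_diff[of x y] by blast

lemma gens_subset: "gens \<subseteq> carrier (free_Abelian_group AV)"
proof
  fix c assume "c \<in> gens"
  then show "c \<in> carrier (free_Abelian_group AV)"
    unfolding gens_def
    by (elim UnE CollectE exE conjE) (simp_all add: keys_diff_subset B_smult_closed subsetD[OF B_subset])
qed

lemma subgroup_rel: "subgroup rel (free_Abelian_group AV)"
  unfolding rel_eq using gens_subset by (intro group.generate_is_subgroup group_free_Abelian_group)

lemmas rel_facts = subgroup_free_Abelian_group[OF subgroup_rel]

lemma cls_eq_iff: "cls c = cls d \<longleftrightarrow> c - d \<in> rel"
  unfolding tensor_class_def by (rule r_coset_free_Abelian_group_eq_iff(1)[OF subgroup_rel])

lemma mem_cls_iff: "e \<in> cls d \<longleftrightarrow> e - d \<in> rel"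
  unfolding tensor_class_def by (rule r_coset_free_Abelian_group_eq_iff(2)[OF subgroup_rel])

lemma self_mem_cls: "c \<in> cls c"
  using rel_facts(1) by (simp add: mem_cls_iff)

lemma cls_eqI: "e \<in> cls d \<Longrightarrow> cls e = cls d"
  by (simp add: cls_eq_iff mem_cls_iff)

lemma gens_in_rel: "c \<in> gens \<Longrightarrow> c \<in> rel"
  unfolding rel_eq by (rule generate.incl)

lemma tensor_carrier: "carrier (tensor A B V) = cls ` {c. Poly_Mapping.keys c \<subseteq> AV}"
  by (auto simp: tensor_def Let_def FactGroup_def RCOSETS_def tensor_class_def)

lemma rel_normal: "rel \<lhd> free_Abelian_group AV"
  using comm_group.subgroup_imp_normal[OF abelian_free_Abelian_group subgroup_rel] .

lemma tensor_add:
  assumes "Poly_Mapping.keys c \<subseteq> AV" "Poly_Mapping.keys d \<subseteq> AV"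
  shows "cls c \<oplus>\<^bsub>tensor A B V\<^esub> cls d = cls (c + d)"
  using normal.rcos_sum[OF rel_normal, of c d] assms
  by (simp add: tensor_def Let_def FactGroup_def tensor_class_def)

lemma cls_add_cong: "cls c = cls c' \<Longrightarrow> cls d = cls d' \<Longrightarrow> cls (c + d) = cls (c' + d')"
  unfolding cls_eq_iff using rel_facts(3)[of "c - c'" "d - d'"] by (simp add: algebra_simps)

lemma cls_diff_cong: "cls c = cls c' \<Longrightarrow> cls d = cls d' \<Longrightarrow> cls (c - d) = cls (c' - d')"
  unfolding cls_eq_iff using rel_facts(5)[of "c - c'" "d - d'"] by (simp add: algebra_simps)

lemma cls_add_left:
  assumes "a \<in> carrier A" "a' \<in> carrier A" "x \<in> carrier V"
  shows "cls (frag_of (a \<oplus>\<^bsub>A\<^esub> a', x)) = cls (frag_of (a, x) + frag_of (a', x))"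
proof -
  have "frag_of (a \<oplus>\<^bsub>A\<^esub> a', x) - frag_of (a, x) - frag_of (a', x) \<in> rel"
    using assms by (intro gens_in_rel) (auto simp: gens_def)
  then show ?thesis by (simp add: cls_eq_iff diff_diff_eq)
qed

lemma cls_add_right:
  assumes "a \<in> carrier A" "x \<in> carrier V" "x' \<in> carrier V"
  shows "cls (frag_of (a, x \<oplus>\<^bsub>V\<^esub> x')) = cls (frag_of (a, x) + frag_of (a, x'))"
proof -
  have "frag_of (a, x \<oplus>\<^bsub>V\<^esub> x') - frag_of (a, x) - frag_of (a, x') \<in> rel"
    using assms by (intro gens_in_rel) (auto simp: gens_def)
  then show ?thesis by (simp add: cls_eq_iff diff_diff_eq)
qed

lemma cls_balanced:
  assumes "a \<in> carrier A" "b \<in> B" "x \<in> carrier V"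
  shows "cls (frag_of (a \<otimes>\<^bsub>A\<^esub> b, x)) = cls (frag_of (a, b \<odot>\<^bsub>V\<^esub> x))"
proof -
  have "frag_of (a \<otimes>\<^bsub>A\<^esub> b, x) - frag_of (a, b \<odot>\<^bsub>V\<^esub> x) \<in> rel"
    using assms by (intro gens_in_rel) (auto simp: gens_def)
  then show ?thesis by (simp add: cls_eq_iff)
qed

lemma cls_zero_left: "x \<in> carrier V \<Longrightarrow> cls (frag_of (\<zero>\<^bsub>A\<^esub>, x)) = cls 0"
  using cls_add_left[of "\<zero>\<^bsub>A\<^esub>" "\<zero>\<^bsub>A\<^esub>" x] rel_facts(4)[of "- frag_of (\<zero>\<^bsub>A\<^esub>, x)"]
  by (simp add: cls_eq_iff)

text \<open>Universal property of the tensor product: a biadditive balanced map kills the three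
  kinds of generating relations, hence the subgroup they generate, so its evaluation depends only on
  the coset.\<close>

lemma frag_eval_rel:
  assumes "abelian_group D"
    and closed: "\<And>a x. a \<in> carrier A \<Longrightarrow> x \<in> carrier V \<Longrightarrow> t (a, x) \<in> carrier D"
    and add_left: "\<And>a a' x. \<lbrakk>a \<in> carrier A; a' \<in> carrier A; x \<in> carrier V\<rbrakk> \<Longrightarrow>
      t (a \<oplus>\<^bsub>A\<^esub> a', x) = t (a, x) \<oplus>\<^bsub>D\<^esub> t (a', x)"
    and add_right: "\<And>a x x'. \<lbrakk>a \<in> carrier A; x \<in> carrier V; x' \<in> carrier V\<rbrakk> \<Longrightarrow>
      t (a, x \<oplus>\<^bsub>V\<^esub> x') = t (a, x) \<oplus>\<^bsub>D\<^esub> t (a, x')"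
    and balanced: "\<And>a b x. \<lbrakk>a \<in> carrier A; b \<in> B; x \<in> carrier V\<rbrakk> \<Longrightarrow> t (a \<otimes>\<^bsub>A\<^esub> b, x) = t (a, b \<odot>\<^bsub>V\<^esub> x)"
    and c: "c \<in> rel"
  shows "frag_eval D t c = \<zero>\<^bsub>D\<^esub>"
proof -
  interpret D: abelian_group D by fact
  have t: "\<And>u. u \<in> AV \<Longrightarrow> t u \<in> carrier D" using closed by auto
  note ev = D.frag_eval_diff[of AV, OF t] D.frag_eval_add[of AV, OF t] D.frag_eval_uminus[of AV, OF t]
  have keys: "Poly_Mapping.keys (frag_of (a, x) :: ('a \<times> 'v) \<Rightarrow>\<^sub>0 int) \<subseteq> AV"
    if "a \<in> carrier A" "x \<in> carrier V" for a x using that by simp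
  have of: "frag_eval D t (frag_of (a, x)) = t (a, x)" if "a \<in> carrier A" "x \<in> carrier V" for a x
    using that closed by (intro D.frag_eval_frag_of)
  have g: "frag_eval D t c = \<zero>\<^bsub>D\<^esub>" if "c \<in> gens" for c
    using that unfolding gens_def
    by (elim UnE CollectE exE conjE)
       (simp_all add: ev of keys_diff_subset subsetD[OF B_subset] B_smult_closed closed add_left
          add_right balanced D.sum_diff_diff D.diff_self)
  have gk: "Poly_Mapping.keys h \<subseteq> AV" if "h \<in> gens" for h
    using subsetD[OF gens_subset that] by simp
  \<comment> \<open>The support bound is carried along because additivity of the evaluation is
    available for combinations supported on \<open>AV\<close>.\<close>
  have "Poly_Mapping.keys c \<subseteq> AV \<and> frag_eval D t c = \<zero>\<^bsub>D\<^esub>"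
    using c[unfolded rel_eq]
  proof (induction rule: generate.induct)
    case (incl h)
    then show ?case using gk g by simp
  next
    case (inv h)
    then show ?case using gk[of h] g ev by simp
  next
    case (eng h1 h2)
    then show ?case using ev keys_add[of h1 h2] by auto
  qed (simp add: D.frag_eval_0)
  then show ?thesis ..
qed

end

section \<open>Restriction and induction of group ring submodules\<close>

locale group_ring_induction = valued_group_ring K G R \<pi>
  for K :: "('k, 'c) ring_scheme" and G :: "('g, 'd) monoid_scheme" and R \<pi> +
  fixes H :: "'g set"
  assumes subgroup_H: "subgroup H G"
begin

abbreviation "GH \<equiv> G\<lparr>carrier := H\<rparr>"

abbreviation "KH \<equiv> group_ring K GH"

abbreviation "RH \<equiv> group_ring (K\<lparr>carrier := R\<rparr>) GH"

sublocale H: subgroup H G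
  by (rule subgroup_H)

sublocale HR: valued_group_ring K GH R \<pi>
proof -
  have "finite H" using finite_subset[OF H.subset finite_G] .
  then have "finite_group_ring K GH"
    unfolding finite_group_ring_def finite_group_ring_axioms_def
    using K.ring_axioms H.subgroup_is_group[OF G.group_axioms] by simp
  then show "valued_group_ring K GH R \<pi>"
    unfolding valued_group_ring_def valued_group_ring_axioms_def
    using K.field_axioms subring_R pi_in_R pi_nonzero pi_not_unit by blast
qed

abbreviation mult_KG (infixl "\<star>" 70) where
  "f \<star> g \<equiv> f \<otimes>\<^bsub>KG\<^esub> g"

lemma inv_GH: "x \<in> H \<Longrightarrow> inv\<^bsub>GH\<^esub> x = inv\<^bsub>G\<^esub> x"
  using G.m_inv_consistent[OF subgroup_H] by simp

lemma KH_carrier: "f \<in> carrier KH \<longleftrightarrow> (\<forall>x\<in>H. f x \<in> carrier K) \<and> (\<forall>x. x \<notin> H \<longrightarrow> f x = \<zero>\<^bsub>K\<^esub>)"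
  by (simp add: group_ring_carrier)

lemma RH_carrier: "f \<in> carrier RH \<longleftrightarrow> (\<forall>x\<in>H. f x \<in> R) \<and> (\<forall>x. x \<notin> H \<longrightarrow> f x = \<zero>\<^bsub>K\<^esub>)"
  by (simp add: group_ring_carrier)

lemma KH_subset: "f \<in> carrier KH \<Longrightarrow> f \<in> carrier KG"
  using HR.coeff_closed[of f] HR.outside[of f] contra_subsetD[OF H.subset] unfolding group_ring_carrier[of f K G] by auto

lemma RH_subset_RG: "f \<in> carrier RH \<Longrightarrow> f \<in> carrier RG"
  using HR.RG_coeff[of f] HR.outside[OF HR.RG_subset, of f] contra_subsetD[OF H.subset] unfolding RG_carrier by auto

lemma inv_mult_mem_iff:
  assumes "x \<in> carrier G" "y \<in> H"
  shows "inv\<^bsub>G\<^esub> y \<otimes>\<^bsub>G\<^esub> x \<in> H \<longleftrightarrow> x \<in> H"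
proof
  assume "inv\<^bsub>G\<^esub> y \<otimes>\<^bsub>G\<^esub> x \<in> H"
  then have "y \<otimes>\<^bsub>G\<^esub> (inv\<^bsub>G\<^esub> y \<otimes>\<^bsub>G\<^esub> x) \<in> H" using assms(2) by (rule H.m_closed[rotated])
  then show "x \<in> H" using assms by (simp add: G.cancel_inv)
qed (use assms in auto)

lemma inv_mult_mem_iff':
  assumes "x \<in> H" "y \<in> carrier G"
  shows "inv\<^bsub>G\<^esub> y \<otimes>\<^bsub>G\<^esub> x \<in> H \<longleftrightarrow> y \<in> H"
proof
  assume a: "inv\<^bsub>G\<^esub> y \<otimes>\<^bsub>G\<^esub> x \<in> H"
  have "x \<otimes>\<^bsub>G\<^esub> inv\<^bsub>G\<^esub> (inv\<^bsub>G\<^esub> y \<otimes>\<^bsub>G\<^esub> x) = y"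
    using assms by (simp add: G.inv_mult_group G.cancel_inv)
  then show "y \<in> H" using H.m_closed[OF assms(1) H.m_inv_closed[OF a]] by simp
qed (use assms in auto)

text \<open>The two convolutions differ only by terms in which a factor is evaluated outside
  \<open>H\<close> and vanishes. Hence \<open>F[H]\<close> is a subring of \<open>F[G]\<close> and
  one multiplication serves for both.\<close>

lemma KH_mult:
  assumes f: "f \<in> carrier KH" and g: "g \<in> carrier KH"
  shows "f \<otimes>\<^bsub>KH\<^esub> g = f \<star> g"
proof
  fix x
  note [simp] = HR.coeff_closed[OF f] HR.coeff_closed[OF g]
  have f0: "f y = \<zero>\<^bsub>K\<^esub>" if "y \<notin> H" for y using f that by (simp add: KH_carrier)
  have g0: "g y = \<zero>\<^bsub>K\<^esub>" if "y \<notin> H" for y using g that by (simp add: KH_carrier)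
  show "(f \<otimes>\<^bsub>KH\<^esub> g) x = (f \<star> g) x"
  proof (cases "x \<in> H")
    case True
    have "(\<Oplus>\<^bsub>K\<^esub>y\<in>H. f y \<otimes>\<^bsub>K\<^esub> g (inv\<^bsub>GH\<^esub> y \<otimes>\<^bsub>G\<^esub> x)) = (\<Oplus>\<^bsub>K\<^esub>y\<in>carrier G. f y \<otimes>\<^bsub>K\<^esub> g (inv\<^bsub>G\<^esub> y \<otimes>\<^bsub>G\<^esub> x))"
      by (rule K.add.finprod_mono_neutral_cong_left) (use finite_G H.subset f0 in \<open>auto simp: inv_GH\<close>)
    then show ?thesis using True H.subset by (auto simp: group_ring_mult)
  next
    case False
    have "(\<Oplus>\<^bsub>K\<^esub>y\<in>carrier G. f y \<otimes>\<^bsub>K\<^esub> g (inv\<^bsub>G\<^esub> y \<otimes>\<^bsub>G\<^esub> x)) = (\<Oplus>\<^bsub>K\<^esub>y\<in>carrier G. \<zero>\<^bsub>K\<^esub>)" if "x \<in> carrier G"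
    proof (rule K.finsum_cong')
      fix y assume "y \<in> carrier G"
      then show "f y \<otimes>\<^bsub>K\<^esub> g (inv\<^bsub>G\<^esub> y \<otimes>\<^bsub>G\<^esub> x) = \<zero>\<^bsub>K\<^esub>"
        using False that f0 g0 inv_mult_mem_iff[of x y] by (cases "y \<in> H") auto
    qed auto
    then show ?thesis using False by (auto simp: group_ring_mult)
  qed
qed

lemma KH_mult_closed: "f \<in> carrier KH \<Longrightarrow> g \<in> carrier KH \<Longrightarrow> f \<star> g \<in> carrier KH"
  using HR.mult_closed[of f g] by (simp add: KH_mult)

text \<open>The projection of \<open>F[G]\<close> onto \<open>F[H]\<close> that forgets the group
  elements outside \<open>H\<close>. It is linear over \<open>F[H]\<close> on both sides, though in
  general not multiplicative.\<close>

definition res :: "('g \<Rightarrow> 'k) \<Rightarrow> ('g \<Rightarrow> 'k)" where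
  "res f = (\<lambda>x. if x \<in> H then f x else \<zero>\<^bsub>K\<^esub>)"

lemma res_closed: "f \<in> carrier KG \<Longrightarrow> res f \<in> carrier KH"
  by (auto simp: KH_carrier res_def coeff_closed)

lemma res_RG: "f \<in> carrier RG \<Longrightarrow> res f \<in> carrier RH"
  by (auto simp: RH_carrier res_def RG_coeff)

lemma res_id: "f \<in> carrier KH \<Longrightarrow> res f = f"
  by (auto simp: KH_carrier res_def)

lemma res_add: "res (f \<oplus>\<^bsub>KG\<^esub> g) = res f \<oplus>\<^bsub>KG\<^esub> res g"
  by (auto simp: res_def)

lemma res_uminus: "f \<in> carrier KG \<Longrightarrow> res (\<ominus>\<^bsub>KG\<^esub> f) = \<ominus>\<^bsub>KG\<^esub> res f"
  by (rule ext) (simp add: uminus_apply KH_subset[OF res_closed], simp add: res_def uminus_apply)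

lemma res_zero: "res \<zero>\<^bsub>KG\<^esub> = \<zero>\<^bsub>KG\<^esub>"
  by (auto simp: res_def)

text \<open>At a point \<open>x\<close> of \<open>H\<close> a term survives only if
  \<open>inv y x\<close> lies in \<open>H\<close>, which forces \<open>y\<close> into
  \<open>H\<close>; there \<open>f\<close> and \<open>res f\<close> agree.\<close>

lemma res_mult_right:
  assumes f: "f \<in> carrier KG" and l: "l \<in> carrier KH"
  shows "res (f \<star> l) = res f \<star> l"
proof
  fix x
  have l0: "l y = \<zero>\<^bsub>K\<^esub>" if "y \<notin> H" for y using l that by (simp add: KH_carrier)
  show "res (f \<star> l) x = (res f \<star> l) x"
  proof (cases "x \<in> H")
    case True
    have "(\<Oplus>\<^bsub>K\<^esub>y\<in>carrier G. f y \<otimes>\<^bsub>K\<^esub> l (inv\<^bsub>G\<^esub> y \<otimes>\<^bsub>G\<^esub> x)) = (\<Oplus>\<^bsub>K\<^esub>y\<in>carrier G. res f y \<otimes>\<^bsub>K\<^esub> l (inv\<^bsub>G\<^esub> y \<otimes>\<^bsub>G\<^esub> x))"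
    proof (rule K.finsum_cong')
      fix y assume "y \<in> carrier G"
      then show "f y \<otimes>\<^bsub>K\<^esub> l (inv\<^bsub>G\<^esub> y \<otimes>\<^bsub>G\<^esub> x) = res f y \<otimes>\<^bsub>K\<^esub> l (inv\<^bsub>G\<^esub> y \<otimes>\<^bsub>G\<^esub> x)"
        using True l0 inv_mult_mem_iff'[of x y] coeff_closed[OF f] by (auto simp: res_def)
    qed (use coeff_closed[OF KH_subset[OF res_closed[OF f]]] HR.coeff_closed[OF l] in auto)
    then show ?thesis using True H.subset by (auto simp: group_ring_mult res_def[of "f \<star> l"])
  next
    case False
    then show ?thesis
      using KH_mult_closed[OF res_closed[OF f] l] by (simp add: KH_carrier res_def[of "f \<star> l"])
  qed
qed

lemma res_mult_left:
  assumes f: "f \<in> carrier KG" and l: "l \<in> carrier KH"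
  shows "res (l \<star> f) = l \<star> res f"
proof
  fix x
  have l0: "l y = \<zero>\<^bsub>K\<^esub>" if "y \<notin> H" for y using l that by (simp add: KH_carrier)
  show "res (l \<star> f) x = (l \<star> res f) x"
  proof (cases "x \<in> H")
    case True
    have "(\<Oplus>\<^bsub>K\<^esub>y\<in>carrier G. l y \<otimes>\<^bsub>K\<^esub> f (inv\<^bsub>G\<^esub> y \<otimes>\<^bsub>G\<^esub> x)) = (\<Oplus>\<^bsub>K\<^esub>y\<in>carrier G. l y \<otimes>\<^bsub>K\<^esub> res f (inv\<^bsub>G\<^esub> y \<otimes>\<^bsub>G\<^esub> x))"
    proof (rule K.finsum_cong')
      fix y assume "y \<in> carrier G"
      then show "l y \<otimes>\<^bsub>K\<^esub> f (inv\<^bsub>G\<^esub> y \<otimes>\<^bsub>G\<^esub> x) = l y \<otimes>\<^bsub>K\<^esub> res f (inv\<^bsub>G\<^esub> y \<otimes>\<^bsub>G\<^esub> x)"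
        using True l0 inv_mult_mem_iff'[of x y] coeff_closed[OF f] by (auto simp: res_def)
    qed (use coeff_closed[OF KH_subset[OF res_closed[OF f]]] HR.coeff_closed[OF l] in auto)
    then show ?thesis using True H.subset by (auto simp: group_ring_mult res_def[of "l \<star> f"])
  next
    case False
    then show ?thesis
      using KH_mult_closed[OF l res_closed[OF f]] by (simp add: KH_carrier res_def[of "l \<star> f"])
  qed
qed

lemma res_ge_mult_apply:
  assumes "g \<in> carrier G" "y \<in> carrier KG" "x \<in> H"
  shows "res (ge g \<star> y) x = y (inv\<^bsub>G\<^esub> g \<otimes>\<^bsub>G\<^esub> x)"
  using assms group_elem_mult_apply[OF assms(1,2) H.mem_carrier[OF assms(3)]] by (simp add: res_def)

text \<open>The image of \<open>R[G] \<otimes> L\<close> in \<open>F[G]\<close>, for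
  \<open>L\<close> an \<open>R[H]\<close>-submodule of \<open>F[H]\<close>. Testing every left
  translate avoids the choice of a transversal of \<open>H\<close> and builds in stability under
  left translation by \<open>G\<close>.\<close>

definition indspan :: "('g \<Rightarrow> 'k) set \<Rightarrow> ('g \<Rightarrow> 'k) set" where
  "indspan L = {y \<in> carrier KG. \<forall>g\<in>carrier G. res (ge g \<star> y) \<in> L}"

definition RH_submodule :: "('g \<Rightarrow> 'k) set \<Rightarrow> bool" where
  "RH_submodule L \<longleftrightarrow> L \<subseteq> carrier KH \<and> subgroup L (add_monoid KG) \<and>
     (\<forall>x\<in>carrier RH. \<forall>l\<in>L. x \<star> l \<in> L)"

lemma RH_submoduleD:
  assumes "RH_submodule L"
  shows "l \<in> L \<Longrightarrow> l \<in> carrier KH" "\<zero>\<^bsub>KG\<^esub> \<in> L" "l \<in> L \<Longrightarrow> l' \<in> L \<Longrightarrow> l \<oplus>\<^bsub>KG\<^esub> l' \<in> L"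
    "l \<in> L \<Longrightarrow> \<ominus>\<^bsub>KG\<^esub> l \<in> L" "x \<in> carrier RH \<Longrightarrow> l \<in> L \<Longrightarrow> x \<star> l \<in> L"
proof -
  have S: "subgroup L (add_monoid KG)" using assms by (simp add: RH_submodule_def)
  show "\<zero>\<^bsub>KG\<^esub> \<in> L" "l \<in> L \<Longrightarrow> l' \<in> L \<Longrightarrow> l \<oplus>\<^bsub>KG\<^esub> l' \<in> L" "l \<in> L \<Longrightarrow> \<ominus>\<^bsub>KG\<^esub> l \<in> L"
    using subgroup.one_closed[OF S] subgroup.m_closed[OF S] subgroup.m_inv_closed[OF S]
    by (simp_all add: a_inv_def)
  show "l \<in> L \<Longrightarrow> l \<in> carrier KH" "x \<in> carrier RH \<Longrightarrow> l \<in> L \<Longrightarrow> x \<star> l \<in> L"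
    using assms unfolding RH_submodule_def by blast+
qed

lemma indspan_closed: "y \<in> indspan L \<Longrightarrow> y \<in> carrier KG"
  by (simp add: indspan_def)

lemma subgroup_indspan:
  assumes "RH_submodule L"
  shows "subgroup (indspan L) (add_monoid KG)"
proof (rule KG.add.subgroupI)
  note L = RH_submoduleD[OF assms]
  have "res (ge g \<star> \<zero>\<^bsub>KG\<^esub>) \<in> L" if "g \<in> carrier G" for g
    using L(2) KG.r_null[OF group_elem_closed[OF that]] res_zero by simp
  then show "indspan L \<noteq> {}"
    unfolding indspan_def using KG.zero_closed by blast
  show "indspan L \<subseteq> carrier KG" by (auto simp: indspan_def)
  fix a assume "a \<in> indspan L"
  then have a: "a \<in> carrier KG" "\<And>g. g \<in> carrier G \<Longrightarrow> res (ge g \<star> a) \<in> L"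
    by (auto simp: indspan_def)
  have "res (ge g \<star> \<ominus>\<^bsub>KG\<^esub> a) \<in> L" if "g \<in> carrier G" for g
    using that a L(4) group_elem_closed by (simp only: KG.r_minus res_uminus KG.m_closed)
  then show "\<ominus>\<^bsub>KG\<^esub> a \<in> indspan L"
    using a(1) by (simp add: indspan_def)
  fix b assume "b \<in> indspan L"
  then have b: "b \<in> carrier KG" "\<And>g. g \<in> carrier G \<Longrightarrow> res (ge g \<star> b) \<in> L"
    by (auto simp: indspan_def)
  have "res (ge g \<star> (a \<oplus>\<^bsub>KG\<^esub> b)) \<in> L" if "g \<in> carrier G" for g
    using that a b L(3) group_elem_closed by (simp only: KG.r_distr res_add)
  then show "a \<oplus>\<^bsub>KG\<^esub> b \<in> indspan L"
    unfolding indspan_def using KG.a_closed[OF a(1) b(1)] by blast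
qed

lemma res_ge_mult_mult:
  assumes "g \<in> carrier G" "x \<in> carrier KG" "l \<in> carrier KH"
  shows "res (ge g \<star> (x \<star> l)) = res (ge g \<star> x) \<star> l"
  using KG.m_assoc[OF group_elem_closed[OF assms(1)] assms(2) KH_subset[OF assms(3)]]
    res_mult_right[OF KG.m_closed[OF group_elem_closed[OF assms(1)] assms(2)] assms(3)] by simp

text \<open>Restriction affects only the left factor: restricting \<open>g x l\<close> gives the
  restriction of \<open>g x\<close> times \<open>l\<close>, and the former has coefficients in
  \<open>R\<close>.\<close>

lemma mult_in_indspan:
  assumes "RH_submodule L" "x \<in> carrier RG" "l \<in> L"
  shows "x \<star> l \<in> indspan L"
proof -
  note L = RH_submoduleD[OF assms(1)]
  have "res (ge g \<star> (x \<star> l)) \<in> L" if "g \<in> carrier G" for g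
    using res_ge_mult_mult[OF that RG_subset[OF assms(2)] L(1)[OF assms(3)]]
      L(5)[OF res_RG[OF RG_mult_in[OF ge_in_RG[OF that] assms(2)]] assms(3)] by simp
  moreover have "x \<star> l \<in> carrier KG"
    using RG_subset[OF assms(2)] KH_subset[OF L(1)[OF assms(3)]] by (rule KG.m_closed)
  ultimately show ?thesis by (simp add: indspan_def)
qed

text \<open>\<open>F[G]\<close> is the direct sum of the right \<open>F[H]\<close>-modules
  \<open>t F[H]\<close> over left cosets. The component at \<open>t\<close> is found by translating
  the coset \<open>t H\<close> onto \<open>H\<close>, restricting, and translating back.\<close>

lemma coset_decomposition:
  obtains T where "finite T" "T \<subseteq> carrier G"
    "\<And>y. y \<in> carrier KG \<Longrightarrow> y = (\<Oplus>\<^bsub>KG\<^esub>t\<in>T. ge t \<star> res (ge (inv\<^bsub>G\<^esub> t) \<star> y))"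
proof -
  obtain rep where rep: "\<And>x. x \<in> carrier G \<Longrightarrow> rep x \<in> carrier G"
    "\<And>x. x \<in> carrier G \<Longrightarrow> inv\<^bsub>G\<^esub> (rep x) \<otimes>\<^bsub>G\<^esub> x \<in> H"
    "\<And>x y. x \<in> carrier G \<Longrightarrow> y \<in> carrier G \<Longrightarrow> inv\<^bsub>G\<^esub> y \<otimes>\<^bsub>G\<^esub> x \<in> H \<Longrightarrow> rep x = rep y"
    using coset_representatives[OF subgroup_H] by blast
  let ?T = "rep ` carrier G"
  have T: "finite ?T" "?T \<subseteq> carrier G" using finite_G rep(1) by auto
  have "y = (\<Oplus>\<^bsub>KG\<^esub>t\<in>?T. ge t \<star> res (ge (inv\<^bsub>G\<^esub> t) \<star> y))" if y: "y \<in> carrier KG" for y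
  proof
    fix x
    have c: "ge t \<star> res (ge (inv\<^bsub>G\<^esub> t) \<star> y) \<in> carrier KG" if "t \<in> ?T" for t
      using that T y by (auto intro!: KG.m_closed group_elem_closed KH_subset[OF res_closed] rep(1))
    have "(\<Oplus>\<^bsub>KG\<^esub>t\<in>?T. ge t \<star> res (ge (inv\<^bsub>G\<^esub> t) \<star> y)) x
       = (\<Oplus>\<^bsub>K\<^esub>t\<in>?T. (ge t \<star> res (ge (inv\<^bsub>G\<^esub> t) \<star> y)) x)"
      using c by (rule finsum_apply)
    also have "\<dots> = y x"
    proof (cases "x \<in> carrier G")
      case x: True
      have val: "(ge t \<star> res (ge (inv\<^bsub>G\<^esub> t) \<star> y)) x = (if inv\<^bsub>G\<^esub> t \<otimes>\<^bsub>G\<^esub> x \<in> H then y x else \<zero>\<^bsub>K\<^esub>)"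
        if t: "t \<in> carrier G" for t
      proof -
        have "(ge t \<star> res (ge (inv\<^bsub>G\<^esub> t) \<star> y)) x = res (ge (inv\<^bsub>G\<^esub> t) \<star> y) (inv\<^bsub>G\<^esub> t \<otimes>\<^bsub>G\<^esub> x)"
          using t x y by (intro group_elem_mult_apply KH_subset[OF res_closed] KG.m_closed group_elem_closed) auto
        also have "\<dots> = (if inv\<^bsub>G\<^esub> t \<otimes>\<^bsub>G\<^esub> x \<in> H then y x else \<zero>\<^bsub>K\<^esub>)"
          using t x y by (auto simp: res_def group_elem_mult_apply G.cancel_inv)
        finally show ?thesis .
      qed
      have "(\<Oplus>\<^bsub>K\<^esub>t\<in>?T. (ge t \<star> res (ge (inv\<^bsub>G\<^esub> t) \<star> y)) x)
          = (ge (rep x) \<star> res (ge (inv\<^bsub>G\<^esub> (rep x)) \<star> y)) x"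
      proof (rule K.finsum_single)
        fix t assume t: "t \<in> ?T" "t \<noteq> rep x"
        then obtain w where w: "w \<in> carrier G" "t = rep w" by auto
        have "inv\<^bsub>G\<^esub> t \<otimes>\<^bsub>G\<^esub> x \<notin> H"
        proof
          assume "inv\<^bsub>G\<^esub> t \<otimes>\<^bsub>G\<^esub> x \<in> H"
          then have "rep x = rep t" using rep(1,3) x w by blast
          moreover have "rep w = rep t" using rep w by blast
          ultimately show False using t(2) w(2) by metis
        qed
        then show "(ge t \<star> res (ge (inv\<^bsub>G\<^esub> t) \<star> y)) x = \<zero>\<^bsub>K\<^esub>"
          using val w rep(1) by simp
      qed (use T x coeff_closed[OF c] in auto)
      then show ?thesis using val[OF rep(1)[OF x]] rep(2)[OF x] by simp
    next
      case False
      then have "(\<Oplus>\<^bsub>K\<^esub>t\<in>?T. (ge t \<star> res (ge (inv\<^bsub>G\<^esub> t) \<star> y)) x) = (\<Oplus>\<^bsub>K\<^esub>t\<in>?T. \<zero>\<^bsub>K\<^esub>)"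
        by (intro K.finsum_cong') (auto simp: mult_outside)
      then show ?thesis using False outside[OF y] by simp
    qed
    finally show "y x = (\<Oplus>\<^bsub>KG\<^esub>t\<in>?T. ge t \<star> res (ge (inv\<^bsub>G\<^esub> t) \<star> y)) x" by simp
  qed
  then show ?thesis using that T by blast
qed

text \<open>The elements \<open>t l\<close> with \<open>t\<close> in \<open>G\<close> and
  \<open>l\<close> in \<open>L\<close> generate, so stability is tested there. Translating
  \<open>a t l\<close> by \<open>g'\<close> and restricting gives \<open>res (g' a t)\<close> times
  \<open>l\<close>, which lies in \<open>L\<close> for all \<open>l\<close> precisely when
  \<open>res (g' a t)\<close> stabilises \<open>L\<close>.\<close>

lemma order_indspan_iff:
  assumes L: "RH_submodule L" and a: "a \<in> carrier KG"
  shows "(\<forall>y\<in>indspan L. a \<star> y \<in> indspan L) \<longleftrightarrow>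
    (\<forall>g\<in>carrier G. a \<star> ge g \<in> indspan {b \<in> carrier KH. \<forall>l\<in>L. b \<star> l \<in> L})"
proof
  note LD = RH_submoduleD[OF L]
  assume a_stab: "\<forall>y\<in>indspan L. a \<star> y \<in> indspan L"
  show "\<forall>g\<in>carrier G. a \<star> ge g \<in> indspan {b \<in> carrier KH. \<forall>l\<in>L. b \<star> l \<in> L}"
  proof
    fix g assume g: "g \<in> carrier G"
    have "res (ge g' \<star> (a \<star> ge g)) \<star> l \<in> L" if g': "g' \<in> carrier G" and l: "l \<in> L" for g' l
    proof -
      have lH: "l \<in> carrier KH" "l \<in> carrier KG" using LD(1)[OF l] KH_subset by auto
      have "a \<star> (ge g \<star> l) \<in> indspan L"
        using a_stab mult_in_indspan[OF L ge_in_RG[OF g] l] by blast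
      then have "res (ge g' \<star> (a \<star> (ge g \<star> l))) \<in> L"
        using g' by (simp add: indspan_def)
      also have "a \<star> (ge g \<star> l) = (a \<star> ge g) \<star> l"
        using a g lH group_elem_closed by (simp add: KG.m_assoc)
      finally show ?thesis using res_ge_mult_mult[OF g' _ lH(1)] a g group_elem_closed by simp
    qed
    then show "a \<star> ge g \<in> indspan {b \<in> carrier KH. \<forall>l\<in>L. b \<star> l \<in> L}"
      using a g group_elem_closed by (auto simp: indspan_def intro!: res_closed)
  qed
next
  note LD = RH_submoduleD[OF L]
  assume st: "\<forall>g\<in>carrier G. a \<star> ge g \<in> indspan {b \<in> carrier KH. \<forall>l\<in>L. b \<star> l \<in> L}"
  have gen: "a \<star> (ge t \<star> l) \<in> indspan L" if t: "t \<in> carrier G" and l: "l \<in> L" for t l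
  proof -
    have lH: "l \<in> carrier KH" "l \<in> carrier KG" using LD(1)[OF l] KH_subset by auto
    have eq: "a \<star> (ge t \<star> l) = (a \<star> ge t) \<star> l"
      using a t lH group_elem_closed by (simp add: KG.m_assoc)
    have "res (ge g \<star> ((a \<star> ge t) \<star> l)) \<in> L" if g: "g \<in> carrier G" for g
      using res_ge_mult_mult[OF g _ lH(1), of "a \<star> ge t"] st t g l a group_elem_closed
      by (auto simp: indspan_def)
    then show ?thesis unfolding eq using a t lH group_elem_closed by (auto simp: indspan_def)
  qed
  show "\<forall>y\<in>indspan L. a \<star> y \<in> indspan L"
  proof
    fix y assume y: "y \<in> indspan L"
    then have yc: "y \<in> carrier KG" by (rule indspan_closed)
    obtain T where T0: "finite T" "T \<subseteq> carrier G"
      "\<And>y. y \<in> carrier KG \<Longrightarrow> y = (\<Oplus>\<^bsub>KG\<^esub>t\<in>T. ge t \<star> res (ge (inv\<^bsub>G\<^esub> t) \<star> y))"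
      using coset_decomposition by blast
    note T = T0(1,2) T0(3)[OF yc]
    have l: "res (ge (inv\<^bsub>G\<^esub> t) \<star> y) \<in> L" if "t \<in> T" for t
      using y that T(2) by (auto simp: indspan_def)
    have "a \<star> (\<Oplus>\<^bsub>KG\<^esub>t\<in>T. ge t \<star> res (ge (inv\<^bsub>G\<^esub> t) \<star> y))
       = (\<Oplus>\<^bsub>KG\<^esub>t\<in>T. a \<star> (ge t \<star> res (ge (inv\<^bsub>G\<^esub> t) \<star> y)))"
      using T l LD(1) KH_subset a group_elem_closed by (intro KG.finsum_rdistr) (auto intro!: KG.m_closed)
    also have "\<dots> \<in> indspan L"
      using gen l T(2) by (intro KG.finsum_in_subgroup[OF subgroup_indspan[OF L]]) auto
    finally show "a \<star> y \<in> indspan L" unfolding T(3)[symmetric] .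
  qed
qed

text \<open>Restricting \<open>ge g \<star> y\<close> to \<open>H\<close> shows \<open>y\<close> on
  one left coset of \<open>H\<close>. Since every \<open>P i\<close> lies in \<open>H\<close>, the
  points compared by a congruence share such a coset, so no congruence for \<open>y\<close> is
  lost.\<close>

lemma indspan_trace_cond:
  assumes P: "\<forall>i\<le>r. subgroup (P i) G" "P 0 = {\<one>\<^bsub>G\<^esub>}" "\<forall>i<r. P i \<subseteq> P (Suc i)" "\<forall>i\<le>r. P i \<subseteq> H"
    and A: "\<And>f. f \<in> A \<longleftrightarrow> f \<in> carrier KH \<and> HR.trace_cond r m P f"
  shows "y \<in> indspan A \<longleftrightarrow> y \<in> carrier KG \<and> trace_cond r m P y"
proof (cases "y \<in> carrier KG")
  case y: True
  have "(\<forall>g\<in>carrier G. res (ge g \<star> y) \<in> A) \<longleftrightarrow> trace_cond r m P y"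
  proof
    assume a: "\<forall>g\<in>carrier G. res (ge g \<star> y) \<in> A"
    show "trace_cond r m P y"
      unfolding trace_cond_def
    proof (intro conjI ballI allI impI)
      fix x assume x: "x \<in> carrier G"
      \<comment> \<open>Translating by the inverse of \<open>x\<close> moves the pair
        \<open>x\<close>, \<open>x p\<close> to the identity and \<open>p\<close>, inside
        \<open>H\<close>.\<close>
      then have t: "HR.trace_cond r m P (res (ge (inv\<^bsub>G\<^esub> x) \<star> y))"
        using a A by auto
      have one: "res (ge (inv\<^bsub>G\<^esub> x) \<star> y) \<one>\<^bsub>G\<^esub> = y x"
        using x y by (simp add: res_ge_mult_apply)
      show "y x \<in> Q (m r)"
        using t one unfolding HR.trace_cond_def by (auto dest!: bspec[of H _ "\<one>\<^bsub>G\<^esub>"])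
      fix i p assume i: "i < r" and p: "p \<in> P (Suc i)"
      then have pH: "p \<in> H" "p \<in> carrier G" using P(4)[rule_format, of "Suc i"] H.subset by auto
      have "res (ge (inv\<^bsub>G\<^esub> x) \<star> y) p = y (x \<otimes>\<^bsub>G\<^esub> p)"
        using x y pH by (simp add: res_ge_mult_apply)
      then show "y x \<ominus>\<^bsub>K\<^esub> y (x \<otimes>\<^bsub>G\<^esub> p) \<in> Q (m i)"
        using t one i p pH unfolding HR.trace_cond_def by (force dest!: bspec[of H _ "\<one>\<^bsub>G\<^esub>"])
    qed
  next
    assume t: "trace_cond r m P y"
    show "\<forall>g\<in>carrier G. res (ge g \<star> y) \<in> A"
    proof
      fix g assume g: "g \<in> carrier G"
      have "res (ge g \<star> y) x \<ominus>\<^bsub>K\<^esub> res (ge g \<star> y) (x \<otimes>\<^bsub>G\<^esub> p) \<in> Q (m i)"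
        if x: "x \<in> H" and i: "i < r" and p: "p \<in> P (Suc i)" for x i p
      proof -
        have pH: "p \<in> H" "p \<in> carrier G" "x \<in> carrier G" using i p P(4)[rule_format, of "Suc i"] x H.subset by auto
        have "res (ge g \<star> y) (x \<otimes>\<^bsub>G\<^esub> p) = y ((inv\<^bsub>G\<^esub> g \<otimes>\<^bsub>G\<^esub> x) \<otimes>\<^bsub>G\<^esub> p)"
          using g y x pH by (simp add: res_ge_mult_apply G.m_assoc)
        then show ?thesis
          using t g y x pH i p by (simp add: res_ge_mult_apply trace_cond_def)
      qed
      moreover have "res (ge g \<star> y) x \<in> Q (m r)" if x: "x \<in> H" for x
        using t g y x H.subset by (auto simp: res_ge_mult_apply trace_cond_def)
      ultimately show "res (ge g \<star> y) \<in> A"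
        using g y group_elem_closed by (auto simp: A HR.trace_cond_def intro!: res_closed)
    qed
  qed
  then show ?thesis using y by (simp add: indspan_def)
qed (simp add: indspan_def)

end

section \<open>Evaluation of induced modules inside \<open>F[G]\<close>\<close>

lemma (in tensor_product) cls_image_eval:
  assumes ab: "abelian_group D"
    and t: "\<And>a x. a \<in> carrier A \<Longrightarrow> x \<in> carrier V \<Longrightarrow> t (a, x) \<in> carrier D"
    and kill: "\<And>c. c \<in> rel \<Longrightarrow> frag_eval D t c = \<zero>\<^bsub>D\<^esub>"
    and c: "Poly_Mapping.keys c \<subseteq> AV" and e: "e \<in> cls c"
  shows "frag_eval D t e = frag_eval D t c" "Poly_Mapping.keys e \<subseteq> AV"
proof -
  interpret D: abelian_group D by fact
  have t': "\<And>u. u \<in> AV \<Longrightarrow> t u \<in> carrier D" using t by auto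
  have ec: "e - c \<in> rel" using e by (simp add: mem_cls_iff)
  then have k: "Poly_Mapping.keys (e - c) \<subseteq> AV" by (rule rel_facts(2))
  have "frag_eval D t ((e - c) + c) = \<zero>\<^bsub>D\<^esub> \<oplus>\<^bsub>D\<^esub> frag_eval D t c"
    using D.frag_eval_add[of AV t "e - c" c, OF t' k c] kill[OF ec] by simp
  then show "frag_eval D t e = frag_eval D t c"
    using D.frag_eval_closed[of AV t c, OF t' c] by simp
  show "Poly_Mapping.keys e \<subseteq> AV" using keys_add[of "e - c" c] k c by auto
qed

context group_ring_induction
begin

lemma finite_group_ring_RG: "finite_group_ring (K\<lparr>carrier := R\<rparr>) G"
  unfolding finite_group_ring_def finite_group_ring_axioms_def
  using K.subring_is_ring[OF subring_R] G.group_axioms finite_G by simp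

lemma finite_group_ring_RH: "finite_group_ring (K\<lparr>carrier := R\<rparr>) GH"
  unfolding finite_group_ring_def finite_group_ring_axioms_def
  using K.subring_is_ring[OF subring_R] HR.G.group_axioms HR.finite_G by simp

lemma ring_RG: "ring RG"
  using finite_group_ring.ring_group_ring[OF finite_group_ring_RG] .

text \<open>The map sending \<open>a \<otimes> x\<close> to \<open>a\<close> times
  \<open>\<theta> x\<close>, on representatives. With the identity for \<open>\<theta>\<close> it is
  the canonical map of \<open>Ind_subset\<close>; the later choices are the coordinate maps on
  \<open>FM\<close> and on \<open>M\<close>.\<close>

definition teval :: "('v \<Rightarrow> ('g \<Rightarrow> 'k)) \<Rightarrow> ((('g \<Rightarrow> 'k) \<times> 'v) \<Rightarrow>\<^sub>0 int) \<Rightarrow> ('g \<Rightarrow> 'k)" where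
  "teval \<theta> = frag_eval KG (\<lambda>u. fst u \<star> \<theta> (snd u))"

lemma teval_rel:
  assumes "tensor_product A B V" and A: "carrier A \<subseteq> carrier KG"
    and add: "\<And>a b. a \<in> carrier A \<Longrightarrow> b \<in> carrier A \<Longrightarrow> a \<oplus>\<^bsub>A\<^esub> b = a \<oplus>\<^bsub>KG\<^esub> b"
    and mult: "\<And>a b. a \<in> carrier A \<Longrightarrow> b \<in> B \<Longrightarrow> a \<otimes>\<^bsub>A\<^esub> b = a \<star> b"
    and \<theta>: "\<And>x. x \<in> carrier V \<Longrightarrow> \<theta> x \<in> carrier KG"
    and \<theta>_add: "\<And>x y. x \<in> carrier V \<Longrightarrow> y \<in> carrier V \<Longrightarrow> \<theta> (x \<oplus>\<^bsub>V\<^esub> y) = \<theta> x \<oplus>\<^bsub>KG\<^esub> \<theta> y"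
    and \<theta>_smult: "\<And>b x. b \<in> B \<Longrightarrow> x \<in> carrier V \<Longrightarrow> \<theta> (b \<odot>\<^bsub>V\<^esub> x) = b \<star> \<theta> x"
    and c: "c \<in> tensor_relations A B V"
  shows "teval \<theta> c = \<zero>\<^bsub>KG\<^esub>"
proof -
  interpret T: tensor_product A B V by fact
  note A' = subsetD[OF A]
  show ?thesis
    unfolding teval_def
  proof (rule T.frag_eval_rel[OF KG.abelian_group_axioms _ _ _ _ c], unfold fst_conv snd_conv)
    fix a b x y assume a: "a \<in> carrier A" and x: "x \<in> carrier V"
    show "a \<star> \<theta> x \<in> carrier KG" using A'[OF a] \<theta>[OF x] by (rule KG.m_closed)
    show "(a \<oplus>\<^bsub>A\<^esub> b) \<star> \<theta> x = a \<star> \<theta> x \<oplus>\<^bsub>KG\<^esub> b \<star> \<theta> x" if "b \<in> carrier A"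
      unfolding add[OF a that] using A'[OF a] A'[OF that] \<theta>[OF x] by (rule KG.l_distr)
    show "a \<star> \<theta> (x \<oplus>\<^bsub>V\<^esub> y) = a \<star> \<theta> x \<oplus>\<^bsub>KG\<^esub> a \<star> \<theta> y" if "y \<in> carrier V"
      unfolding \<theta>_add[OF x that] using \<theta>[OF x] \<theta>[OF that] A'[OF a] by (rule KG.r_distr)
    show "(a \<otimes>\<^bsub>A\<^esub> b) \<star> \<theta> x = a \<star> \<theta> (b \<odot>\<^bsub>V\<^esub> x)" if "b \<in> B"
      unfolding mult[OF a that] \<theta>_smult[OF that x]
      using A'[OF a] A'[OF subsetD[OF T.B_subset that]] \<theta>[OF x] by (rule KG.m_assoc)
  qed
qed

lemma teval_facts:
  assumes A: "A \<subseteq> carrier KG" and \<theta>: "\<theta> ` V \<subseteq> carrier KG"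
  shows "teval \<theta> 0 = \<zero>\<^bsub>KG\<^esub>"
    "a \<in> A \<Longrightarrow> x \<in> V \<Longrightarrow> teval \<theta> (frag_of (a, x)) = a \<star> \<theta> x"
    "Poly_Mapping.keys c \<subseteq> A \<times> V \<Longrightarrow> teval \<theta> c \<in> carrier KG"
    "Poly_Mapping.keys c \<subseteq> A \<times> V \<Longrightarrow> Poly_Mapping.keys d \<subseteq> A \<times> V \<Longrightarrow>
       teval \<theta> (c - d) = teval \<theta> c \<ominus>\<^bsub>KG\<^esub> teval \<theta> d"
    "Poly_Mapping.keys c \<subseteq> A \<times> V \<Longrightarrow> Poly_Mapping.keys d \<subseteq> A \<times> V \<Longrightarrow>
       teval \<theta> (c + d) = teval \<theta> c \<oplus>\<^bsub>KG\<^esub> teval \<theta> d"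
proof -
  have t: "fst u \<star> \<theta> (snd u) \<in> carrier KG" if "u \<in> A \<times> V" for u
    using that A \<theta> by (intro KG.m_closed) auto
  show "teval \<theta> 0 = \<zero>\<^bsub>KG\<^esub>" unfolding teval_def by (rule KG.frag_eval_0)
  show "teval \<theta> (frag_of (a, x)) = a \<star> \<theta> x" if "a \<in> A" "x \<in> V"
    unfolding teval_def using KG.frag_eval_frag_of[of "\<lambda>u. fst u \<star> \<theta> (snd u)" "(a, x)"] t[of "(a, x)"] that by simp
  show "Poly_Mapping.keys c \<subseteq> A \<times> V \<Longrightarrow> teval \<theta> c \<in> carrier KG"
    unfolding teval_def using t by (rule KG.frag_eval_closed)
  show "Poly_Mapping.keys c \<subseteq> A \<times> V \<Longrightarrow> Poly_Mapping.keys d \<subseteq> A \<times> V \<Longrightarrow>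
       teval \<theta> (c - d) = teval \<theta> c \<ominus>\<^bsub>KG\<^esub> teval \<theta> d"
    unfolding teval_def using t by (rule KG.frag_eval_diff)
  show "Poly_Mapping.keys c \<subseteq> A \<times> V \<Longrightarrow> Poly_Mapping.keys d \<subseteq> A \<times> V \<Longrightarrow>
       teval \<theta> (c + d) = teval \<theta> c \<oplus>\<^bsub>KG\<^esub> teval \<theta> d"
    unfolding teval_def using t by (rule KG.frag_eval_add)
qed

text \<open>Pure tensors land in \<open>indspan L\<close> and differences stay there. Conversely,
  the coset components of \<open>y\<close> lie in \<open>L\<close> and are lifted one by one to
  \<open>V\<close>; the sum of the tensors \<open>ge t \<otimes> m t\<close> then evaluates to
  \<open>y\<close>.\<close>

lemma teval_image:
  assumes L: "RH_submodule L" and \<theta>: "\<theta> ` V = L"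
  shows "teval \<theta> ` {c. Poly_Mapping.keys c \<subseteq> carrier RG \<times> V} = indspan L"
proof -
  note LD = RH_submoduleD[OF L]
  have \<theta>K: "\<theta> x \<in> carrier KG" if "x \<in> V" for x using that \<theta> LD(1) KH_subset by blast
  have RGK: "carrier RG \<subseteq> carrier KG" using RG_subset by blast
  have "\<theta> ` V \<subseteq> carrier KG" using \<theta>K by blast
  note tv = teval_facts[OF RGK this]
  note sub = subgroup_indspan[OF L]
  have "teval \<theta> c \<in> indspan L" if "Poly_Mapping.keys c \<subseteq> carrier RG \<times> V" for c
  proof (rule free_Abelian_group_induct[OF that])
    show "teval \<theta> 0 \<in> indspan L" using subgroup.one_closed[OF sub] tv(1) by simp
  next
    fix x y assume xy: "Poly_Mapping.keys x \<subseteq> carrier RG \<times> V" "Poly_Mapping.keys y \<subseteq> carrier RG \<times> V"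
      "teval \<theta> x \<in> indspan L" "teval \<theta> y \<in> indspan L"
    have "teval \<theta> x \<ominus>\<^bsub>KG\<^esub> teval \<theta> y \<in> indspan L"
      unfolding a_minus_def a_inv_def
      using subgroup.m_closed[OF sub xy(3) subgroup.m_inv_closed[OF sub xy(4)]] by simp
    then show "teval \<theta> (x - y) \<in> indspan L" using tv(4)[OF xy(1,2)] by simp
  next
    fix a assume "a \<in> carrier RG \<times> V"
    then obtain g x where "a = (g, x)" "g \<in> carrier RG" "x \<in> V" by auto
    then show "teval \<theta> (frag_of a) \<in> indspan L"
      using tv(2)[of g x] mult_in_indspan[OF L, of g "\<theta> x"] \<theta> by auto
  qed
  moreover have "y \<in> teval \<theta> ` {c. Poly_Mapping.keys c \<subseteq> carrier RG \<times> V}" if y: "y \<in> indspan L" for y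
  proof -
    obtain T where T: "finite T" "T \<subseteq> carrier G"
      "\<And>y. y \<in> carrier KG \<Longrightarrow> y = (\<Oplus>\<^bsub>KG\<^esub>t\<in>T. ge t \<star> res (ge (inv\<^bsub>G\<^esub> t) \<star> y))"
      using coset_decomposition by blast
    have "\<exists>m. m \<in> V \<and> \<theta> m = res (ge (inv\<^bsub>G\<^esub> t) \<star> y)" if "t \<in> T" for t
    proof -
      have "res (ge (inv\<^bsub>G\<^esub> t) \<star> y) \<in> \<theta> ` V"
        unfolding \<theta> using y that T(2) by (auto simp: indspan_def)
      then show ?thesis by (metis imageE)
    qed
    then obtain m where m: "\<And>t. t \<in> T \<Longrightarrow> m t \<in> V" "\<And>t. t \<in> T \<Longrightarrow> \<theta> (m t) = res (ge (inv\<^bsub>G\<^esub> t) \<star> y)"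
      by metis
    have "\<exists>c. Poly_Mapping.keys c \<subseteq> carrier RG \<times> V \<and> teval \<theta> c = (\<Oplus>\<^bsub>KG\<^esub>t\<in>S. ge t \<star> \<theta> (m t))"
      if "S \<subseteq> T" for S
      using finite_subset[OF that T(1)] that
    proof (induction S rule: finite_induct)
      case empty
      show ?case by (rule exI[of _ 0]) (simp add: tv(1) del: group_ring_simps)
    next
      case (insert s S)
      then obtain c where c: "Poly_Mapping.keys c \<subseteq> carrier RG \<times> V" "teval \<theta> c = (\<Oplus>\<^bsub>KG\<^esub>t\<in>S. ge t \<star> \<theta> (m t))"
        by auto
      have s: "s \<in> carrier G" "m s \<in> V" using insert T(2) m(1) by auto
      have cl: "ge t \<star> \<theta> (m t) \<in> carrier KG" if "t \<in> insert s S" for t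
        using that insert.prems T(2) m(1) \<theta>K by (intro KG.m_closed group_elem_closed) auto
      let ?c = "frag_of (ge s, m s) + c"
      have k: "Poly_Mapping.keys (frag_of (ge s, m s) :: (('g \<Rightarrow> 'k) \<times> _) \<Rightarrow>\<^sub>0 int) \<subseteq> carrier RG \<times> V"
        using s ge_in_RG by simp
      have "Poly_Mapping.keys ?c \<subseteq> carrier RG \<times> V" using keys_add[of "frag_of (ge s, m s)" c] k c(1) by blast
      moreover have "teval \<theta> ?c = ge s \<star> \<theta> (m s) \<oplus>\<^bsub>KG\<^esub> (\<Oplus>\<^bsub>KG\<^esub>t\<in>S. ge t \<star> \<theta> (m t))"
        unfolding tv(5)[OF k c(1)] tv(2)[OF ge_in_RG[OF s(1)] s(2)] c(2) ..
      moreover have "\<dots> = (\<Oplus>\<^bsub>KG\<^esub>t\<in>insert s S. ge t \<star> \<theta> (m t))"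
        using insert(1,2) cl by (intro KG.finsum_insert[symmetric]) auto
      ultimately show ?case by (intro exI[of _ ?c] conjI) (simp_all only:)
    qed
    from this[OF subset_refl] obtain c where c: "Poly_Mapping.keys c \<subseteq> carrier RG \<times> V"
      "teval \<theta> c = (\<Oplus>\<^bsub>KG\<^esub>t\<in>T. ge t \<star> \<theta> (m t))" by blast
    have eq: "(\<Oplus>\<^bsub>KG\<^esub>t\<in>T. ge t \<star> \<theta> (m t)) = (\<Oplus>\<^bsub>KG\<^esub>t\<in>T. ge t \<star> res (ge (inv\<^bsub>G\<^esub> t) \<star> y))"
    proof (rule KG.finsum_cong')
      show "(\<lambda>t. ge t \<star> res (ge (inv\<^bsub>G\<^esub> t) \<star> y)) \<in> T \<rightarrow> carrier KG"
      proof
        fix t assume t: "t \<in> T"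
        show "ge t \<star> res (ge (inv\<^bsub>G\<^esub> t) \<star> y) \<in> carrier KG"
          unfolding m(2)[OF t, symmetric]
          using group_elem_closed[OF subsetD[OF T(2) t]] \<theta>K[OF m(1)[OF t]] by (rule KG.m_closed)
      qed
    qed (use m(2) in auto)
    have "teval \<theta> c = y"
      by (rule trans[OF trans[OF c(2) eq] T(3)[OF indspan_closed[OF y], symmetric]])
    then show ?thesis using c(1) by blast
  qed
  ultimately show ?thesis by blast
qed

lemma tensor_product_RG:
  assumes "abelian_group V" "\<And>b x. b \<in> carrier RH \<Longrightarrow> x \<in> carrier V \<Longrightarrow> b \<odot>\<^bsub>V\<^esub> x \<in> carrier V"
  shows "tensor_product RG (carrier RH) V"
  unfolding tensor_product_def tensor_product_axioms_def
  using ring_RG assms RH_subset_RG by blast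

lemma Ind_subset_eq_indspan:
  assumes S: "RH_submodule S"
  shows "Ind_subset K R G H S = indspan S"
proof -
  let ?V = "regular_module KH S"
  note SD = RH_submoduleD[OF S]
  have V: "carrier ?V = S" "\<And>x y. x \<oplus>\<^bsub>?V\<^esub> y = x \<oplus>\<^bsub>KG\<^esub> y" "\<And>x y. x \<odot>\<^bsub>?V\<^esub> y = x \<otimes>\<^bsub>KH\<^esub> y"
    "\<zero>\<^bsub>?V\<^esub> = \<zero>\<^bsub>KG\<^esub>"
    by (simp_all add: regular_module_def)
  have V_smult: "b \<odot>\<^bsub>?V\<^esub> x = b \<star> x" if "b \<in> carrier RH" "x \<in> S" for b x
    using KH_mult[OF HR.RG_subset[OF that(1)] SD(1)[OF that(2)]] by (simp add: V)
  have SK: "x \<in> carrier KG" if "x \<in> S" for x using SD(1)[OF that] KH_subset by blast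
  have "abelian_group ?V"
  proof (rule abelian_groupI, unfold V)
    fix x y z assume x: "x \<in> S" and y: "y \<in> S" and z: "z \<in> S"
    show "x \<oplus>\<^bsub>KG\<^esub> y \<in> S" using SD(3) x y .
    show "(x \<oplus>\<^bsub>KG\<^esub> y) \<oplus>\<^bsub>KG\<^esub> z = x \<oplus>\<^bsub>KG\<^esub> (y \<oplus>\<^bsub>KG\<^esub> z)" using SK x y z by (intro KG.a_assoc)
    show "x \<oplus>\<^bsub>KG\<^esub> y = y \<oplus>\<^bsub>KG\<^esub> x" using SK x y by (intro KG.a_comm)
  next
    fix x assume x: "x \<in> S"
    show "\<zero>\<^bsub>KG\<^esub> \<oplus>\<^bsub>KG\<^esub> x = x" using SK[OF x] by (rule KG.l_zero)
    show "\<exists>y\<in>S. y \<oplus>\<^bsub>KG\<^esub> x = \<zero>\<^bsub>KG\<^esub>" using SD(4)[OF x] KG.l_neg[OF SK[OF x]] by blast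
  qed (rule SD(2))
  then interpret T: tensor_product RG "carrier RH" ?V
    by (rule tensor_product_RG) (use V V_smult SD(5) in auto)
  have RGK: "carrier RG \<subseteq> carrier KG" using RG_subset by blast
  have kill: "teval id c = \<zero>\<^bsub>KG\<^esub>" if "c \<in> T.rel" for c
  proof (rule teval_rel[OF T.tensor_product_axioms RGK _ _ _ _ _ that])
    show "a \<otimes>\<^bsub>RG\<^esub> b = a \<star> b" if "a \<in> carrier RG" "b \<in> carrier RH" for a b
      using RG_mult[OF that(1) RH_subset_RG[OF that(2)]] .
  qed (use V V_smult SK in auto)
  \<comment> \<open>Evaluation is constant on a coset, so the image handed to
    \<open>the_elem\<close> is a singleton.\<close>
  have el: "the_elem (teval id ` T.cls c) = teval id c" if c: "Poly_Mapping.keys c \<subseteq> carrier RG \<times> carrier ?V" for c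
  proof -
    have "teval id e = teval id c" if "e \<in> T.cls c" for e
      unfolding teval_def
    proof (rule T.cls_image_eval(1)[OF KG.abelian_group_axioms _ _ c that])
      show "frag_eval KG (\<lambda>u. fst u \<star> id (snd u)) c = \<zero>\<^bsub>KG\<^esub>" if "c \<in> T.rel" for c
        using kill[OF that] unfolding teval_def .
    qed (use RGK SK V in \<open>auto intro!: KG.m_closed\<close>)
    then have "teval id ` T.cls c = {teval id c}" using T.self_mem_cls by blast
    then show ?thesis by simp
  qed
  have "Ind_subset K R G H S = (\<lambda>C. the_elem (teval id ` C)) ` carrier (tensor RG (carrier RH) ?V)"
    unfolding Ind_subset_def Ind_def teval_def frag_eval_def id_apply ..
  also have "\<dots> = teval id ` {c. Poly_Mapping.keys c \<subseteq> carrier RG \<times> S}"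
    unfolding T.tensor_carrier image_image using el V(1) by (auto simp: image_def)
  also have "\<dots> = indspan S"
    by (rule teval_image[OF S]) simp
  finally show ?thesis .
qed

end

context left_module
begin

lemma smult_zero_left:
  assumes "x \<in> carrier V"
  shows "\<zero>\<^bsub>A\<^esub> \<odot>\<^bsub>V\<^esub> x = \<zero>\<^bsub>V\<^esub>"
proof -
  have c: "\<zero>\<^bsub>A\<^esub> \<odot>\<^bsub>V\<^esub> x \<in> carrier V" using assms by (simp add: smult_closed)
  have "\<zero>\<^bsub>A\<^esub> \<odot>\<^bsub>V\<^esub> x \<oplus>\<^bsub>V\<^esub> \<zero>\<^bsub>A\<^esub> \<odot>\<^bsub>V\<^esub> x = \<zero>\<^bsub>A\<^esub> \<odot>\<^bsub>V\<^esub> x \<oplus>\<^bsub>V\<^esub> \<zero>\<^bsub>V\<^esub>"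
    using smult_l_distr[of "\<zero>\<^bsub>A\<^esub>" "\<zero>\<^bsub>A\<^esub>" x] assms c by simp
  then show ?thesis using c V.add.l_cancel by blast
qed

lemma smult_finsum_left:
  assumes "finite I" "\<And>i. i \<in> I \<Longrightarrow> f i \<in> carrier A" "x \<in> carrier V"
  shows "(\<Oplus>\<^bsub>A\<^esub>i\<in>I. f i) \<odot>\<^bsub>V\<^esub> x = (\<Oplus>\<^bsub>V\<^esub>i\<in>I. f i \<odot>\<^bsub>V\<^esub> x)"
  using assms
proof (induction I rule: finite_induct)
  case empty
  then show ?case by (simp add: smult_zero_left)
next
  case (insert a I)
  then show ?case by (simp add: Pi_def smult_l_distr smult_closed)
qed

end

context tensor_product
begin

lemma cls_sum_cong:
  assumes "finite I" "\<And>i. i \<in> I \<Longrightarrow> cls (f i) = cls (g i)"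
  shows "cls (\<Sum>i\<in>I. f i) = cls (\<Sum>i\<in>I. g i)"
  using assms
proof (induction I rule: finite_induct)
  case (insert i I)
  then have "cls (f i + (\<Sum>i\<in>I. f i)) = cls (g i + (\<Sum>i\<in>I. g i))"
    by (intro cls_add_cong) auto
  then show ?case using insert by simp
qed simp

lemma cls_finsum_right:
  assumes "finite I" "a \<in> carrier A" "\<And>i. i \<in> I \<Longrightarrow> f i \<in> carrier V"
  shows "cls (\<Sum>i\<in>I. frag_of (a, f i)) = cls (frag_of (a, \<Oplus>\<^bsub>V\<^esub>i\<in>I. f i))"
  using assms
proof (induction I rule: finite_induct)
  case empty
  have "cls (frag_of (a, \<zero>\<^bsub>V\<^esub> \<oplus>\<^bsub>V\<^esub> \<zero>\<^bsub>V\<^esub>)) = cls (frag_of (a, \<zero>\<^bsub>V\<^esub>) + frag_of (a, \<zero>\<^bsub>V\<^esub>))"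
    using empty by (intro cls_add_right) auto
  then show ?case using rel_facts(4)[of "- frag_of (a, \<zero>\<^bsub>V\<^esub>)"] rel_facts(4)[of "frag_of (a, \<zero>\<^bsub>V\<^esub>)"]
    by (simp add: cls_eq_iff)
next
  case (insert j I)
  have "cls (\<Sum>i\<in>insert j I. frag_of (a, f i)) = cls (frag_of (a, f j) + frag_of (a, \<Oplus>\<^bsub>V\<^esub>i\<in>I. f i))"
  proof -
    have "cls (frag_of (a, f j) + (\<Sum>i\<in>I. frag_of (a, f i))) = cls (frag_of (a, f j) + frag_of (a, \<Oplus>\<^bsub>V\<^esub>i\<in>I. f i))"
      using insert by (intro cls_add_cong) auto
    then show ?thesis using insert by simp
  qed
  also have "\<dots> = cls (frag_of (a, f j \<oplus>\<^bsub>V\<^esub> (\<Oplus>\<^bsub>V\<^esub>i\<in>I. f i)))"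
    using insert by (intro cls_add_right[symmetric] V.finsum_closed) auto
  finally show ?case using insert by (simp add: Pi_def)
qed

end

section \<open>The generic fibre of a lattice\<close>

text \<open>The free generator \<open>v\<close> of \<open>FM\<close> is a parameter because it fixes
  the identification of \<open>FM\<close> with \<open>F[H]\<close> on which all coordinates below
  depend.\<close>

locale induced_lattice = group_ring_induction K G R \<pi> H
  for K :: "('k, 'c) ring_scheme" and G :: "('g, 'd) monoid_scheme" and R \<pi> H +
  fixes M :: "('g \<Rightarrow> 'k, 'm) module" and v :: "(('k \<times> 'm) \<Rightarrow>\<^sub>0 int) set"
  assumes fractions: "x \<in> carrier K \<Longrightarrow> \<exists>a\<in>R. \<exists>b\<in>R - {\<zero>\<^bsub>K\<^esub>}. x = a \<otimes>\<^bsub>K\<^esub> inv\<^bsub>K\<^esub> b"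
    and left_module_M: "left_module RH M"
    and left_module_FM: "left_module KH (generic_fibre K R GH M)"
    and v_closed: "v \<in> carrier (generic_fibre K R GH M)"
    and v_basis: "bij_betw (\<lambda>l. l \<odot>\<^bsub>generic_fibre K R GH M\<^esub> v) (carrier KH) (carrier (generic_fibre K R GH M))"
begin

abbreviation "FM \<equiv> generic_fibre K R GH M"

abbreviation "MR \<equiv> coeff_module (K\<lparr>carrier := R\<rparr>) GH M"

sublocale M: left_module RH M
  by (rule left_module_M)

sublocale FM: left_module KH FM
  by (rule left_module_FM)

lemma MR_simps [simp]: "carrier MR = carrier M" "add MR = add M" "ring.zero MR = ring.zero M"
  by (simp_all add: coeff_module_def)

text \<open>The scalar multiple of the identity by \<open>k\<close>. As a bare function it is at
  once an element of \<open>F[H]\<close>, of \<open>F[G]\<close> and, for \<open>k\<close> in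
  \<open>R\<close>, of \<open>R[H]\<close>.\<close>

definition const :: "'k \<Rightarrow> ('g \<Rightarrow> 'k)" where
  "const k = (\<lambda>x. if x = \<one>\<^bsub>G\<^esub> then k else \<zero>\<^bsub>K\<^esub>)"

lemma const_KH: "k \<in> carrier K \<Longrightarrow> const k \<in> carrier KH"
  by (auto simp: const_def KH_carrier)

lemma const_RH: "k \<in> R \<Longrightarrow> const k \<in> carrier RH"
  using R_facts(2) by (auto simp: const_def RH_carrier)

lemma MR_smult: "k \<in> R \<Longrightarrow> k \<odot>\<^bsub>MR\<^esub> x = const k \<odot>\<^bsub>M\<^esub> x"
proof -
  assume k: "k \<in> R"
  have "k \<odot>\<^bsub>RH\<^esub> \<one>\<^bsub>RH\<^esub> = const k"
    using R_in_K[OF k] by (auto simp: group_elem_def const_def)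
  then show ?thesis unfolding coeff_module_def by simp
qed

sublocale T: tensor_product K R MR
proof -
  have "abelian_group MR"
  proof (rule abelian_groupI, unfold MR_simps)
    fix x assume "x \<in> carrier M"
    then show "\<exists>y\<in>carrier M. y \<oplus>\<^bsub>M\<^esub> x = \<zero>\<^bsub>M\<^esub>"
      using M.V.l_neg M.V.a_inv_closed by blast
  qed (auto simp: M.V.a_assoc intro: M.V.a_comm)
  then show "tensor_product K R MR"
    unfolding tensor_product_def tensor_product_axioms_def
    using K.ring_axioms R_facts(1) M.smult_closed const_RH by (auto simp: MR_smult)
qed

lemma MR_finsum:
  assumes "finite I" "\<And>i. i \<in> I \<Longrightarrow> f i \<in> carrier M"
  shows "(\<Oplus>\<^bsub>MR\<^esub>i\<in>I. f i) = (\<Oplus>\<^bsub>M\<^esub>i\<in>I. f i)"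
  using assms
proof (induction I rule: finite_induct)
  case (insert i I)
  then show ?case
    using T.V.finsum_insert[of I i f] M.V.finsum_insert[of I i f] by (auto simp: Pi_def)
qed simp

lemma FM_simps: "carrier FM = carrier (tensor K R MR)" "add FM = add (tensor K R MR)" "ring.zero FM = ring.zero (tensor K R MR)"
  by (simp_all add: generic_fibre_def Let_def)

abbreviation act :: "('g \<Rightarrow> 'k) \<Rightarrow> 'k \<times> 'm \<Rightarrow> (('k \<times> 'm) \<Rightarrow>\<^sub>0 int)" where
  "act l \<equiv> (\<lambda>(f, m). \<Sum>h\<in>H. frag_of (l h \<otimes>\<^bsub>K\<^esub> f, ge h \<odot>\<^bsub>M\<^esub> m))"

text \<open>Well-definedness of the action need not be checked: the module axioms say that the union
  defining it is a single coset, so it is the coset of any member.\<close>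

lemma FM_smult:
  assumes l: "l \<in> carrier KH" and c: "Poly_Mapping.keys c \<subseteq> carrier K \<times> carrier M"
  shows "l \<odot>\<^bsub>FM\<^esub> T.cls c = T.cls (frag_extend (act l) c)"
proof -
  have eq: "l \<odot>\<^bsub>FM\<^esub> C = (\<Union>c\<in>C. T.cls (frag_extend (act l) c))" for C
    by (simp add: generic_fibre_def Let_def tensor_lift_def)
  have "T.cls c \<in> carrier FM" using c by (auto simp: FM_simps T.tensor_carrier)
  then have "l \<odot>\<^bsub>FM\<^esub> T.cls c \<in> carrier FM" using l by (rule FM.smult_closed[rotated])
  then obtain d where d: "l \<odot>\<^bsub>FM\<^esub> T.cls c = T.cls d"
    by (auto simp: FM_simps T.tensor_carrier)
  have "frag_extend (act l) c \<in> l \<odot>\<^bsub>FM\<^esub> T.cls c"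
    unfolding eq using T.self_mem_cls by blast
  then show ?thesis unfolding d using T.cls_eqI by simp
qed

abbreviation "iota \<equiv> to_generic_fibre K R GH M"

lemma iota_eq: "iota m = T.cls (frag_of (\<one>\<^bsub>K\<^esub>, m))"
  by (simp add: to_generic_fibre_def)

lemma iota_closed: "m \<in> carrier M \<Longrightarrow> iota m \<in> carrier FM"
  by (auto simp: FM_simps T.tensor_carrier iota_eq)

lemma iota_add: "m \<in> carrier M \<Longrightarrow> m' \<in> carrier M \<Longrightarrow> iota (m \<oplus>\<^bsub>M\<^esub> m') = iota m \<oplus>\<^bsub>FM\<^esub> iota m'"
  using T.cls_add_right[of "\<one>\<^bsub>K\<^esub>" m m'] T.tensor_add[of "frag_of (\<one>\<^bsub>K\<^esub>, m)" "frag_of (\<one>\<^bsub>K\<^esub>, m')"]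
  by (simp add: iota_eq FM_simps)

lemma ge_RH: "h \<in> H \<Longrightarrow> ge h \<in> carrier RH"
  using HR.ge_in_RG by simp

text \<open>The action on \<open>FM\<close> is defined by a sum over single group elements, whereas
  the module axioms of \<open>M\<close> speak of whole elements of \<open>R[H]\<close>; this
  expansion connects the two.\<close>

lemma RH_decomposition:
  assumes b: "b \<in> carrier RH"
  shows "b = (\<Oplus>\<^bsub>RH\<^esub>h\<in>H. const (b h) \<otimes>\<^bsub>RH\<^esub> ge h)"
proof
  interpret B: finite_group_ring "K\<lparr>carrier := R\<rparr>" GH by (rule finite_group_ring_RH)
  have ge_eq: "group_elem (K\<lparr>carrier := R\<rparr>) h = ge h" for h by (simp add: group_elem_def cong: if_cong)
  have bR: "b x \<in> R" for x by (rule HR.RG_coeff[OF b])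
  fix x
  have val: "(const (b h) \<otimes>\<^bsub>RH\<^esub> ge h) x = (if x = h then b h else \<zero>\<^bsub>K\<^esub>)" if h: "h \<in> H" for h
  proof (cases "x \<in> H")
    case True
    have "(const (b h) \<otimes>\<^bsub>RH\<^esub> ge h) x = const (b h) (x \<otimes>\<^bsub>G\<^esub> inv\<^bsub>G\<^esub> h)"
      using B.mult_group_elem_apply[of h "const (b h)" x] const_RH[OF bR] True h by (simp add: ge_eq inv_GH)
    moreover have "x \<otimes>\<^bsub>G\<^esub> inv\<^bsub>G\<^esub> h = \<one>\<^bsub>G\<^esub> \<longleftrightarrow> x = h"
      using H.mem_carrier[OF True] H.mem_carrier[OF h]
      by (metis G.inv_closed G.inv_inv G.inv_equality G.r_inv)
    ultimately show ?thesis by (simp add: const_def)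
  next
    case False
    then show ?thesis using B.mult_outside[of x] h by auto
  qed
  have "(\<Oplus>\<^bsub>RH\<^esub>h\<in>H. const (b h) \<otimes>\<^bsub>RH\<^esub> ge h) x = (\<Oplus>\<^bsub>K\<lparr>carrier := R\<rparr>\<^esub>h\<in>H. (const (b h) \<otimes>\<^bsub>RH\<^esub> ge h) x)"
    using const_RH[OF bR] ge_RH by (intro B.finsum_apply B.mult_closed) auto
  also have "\<dots> = (\<Oplus>\<^bsub>K\<lparr>carrier := R\<rparr>\<^esub>h\<in>H. if x = h then b h else \<zero>\<^bsub>K\<^esub>)"
    using val bR R_facts(2) by (intro B.K.finsum_cong') auto
  also have "\<dots> = b x"
  proof (cases "x \<in> H")
    case True
    then have "(\<Oplus>\<^bsub>K\<lparr>carrier := R\<rparr>\<^esub>h\<in>H. if x = h then b h else \<zero>\<^bsub>K\<^esub>) = (if x = x then b x else \<zero>\<^bsub>K\<^esub>)"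
      using B.finite_G bR by (intro B.K.finsum_single) auto
    then show ?thesis by simp
  next
    case False
    then have "(\<Oplus>\<^bsub>K\<lparr>carrier := R\<rparr>\<^esub>h\<in>H. if x = h then b h else \<zero>\<^bsub>K\<^esub>) = (\<Oplus>\<^bsub>K\<lparr>carrier := R\<rparr>\<^esub>h\<in>H. \<zero>\<^bsub>K\<lparr>carrier := R\<rparr>\<^esub>)"
      using R_facts(2) by (intro B.K.finsum_cong') auto
    then show ?thesis using False b B.K.finsum_zero[of H] by (simp add: RH_carrier)
  qed
  finally show "b x = (\<Oplus>\<^bsub>RH\<^esub>h\<in>H. const (b h) \<otimes>\<^bsub>RH\<^esub> ge h) x" by simp
qed

text \<open>The coefficients of \<open>b\<close> lie in \<open>R\<close>, so each one moves across
  the tensor sign from the first slot to the second; there the terms add up to \<open>b\<close>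
  acting on \<open>m\<close>.\<close>

lemma iota_smult:
  assumes b: "b \<in> carrier RH" and m: "m \<in> carrier M"
  shows "iota (b \<odot>\<^bsub>M\<^esub> m) = b \<odot>\<^bsub>FM\<^esub> iota m"
proof -
  have bR: "b x \<in> R" for x by (rule HR.RG_coeff[OF b])
  have bK: "b x \<in> carrier K" for x using bR R_in_K by blast
  have gm: "ge h \<odot>\<^bsub>M\<^esub> m \<in> carrier M" if "h \<in> H" for h using M.smult_closed[OF ge_RH[OF that] m] .
  have "b \<odot>\<^bsub>FM\<^esub> iota m = T.cls (frag_extend (act b) (frag_of (\<one>\<^bsub>K\<^esub>, m)))"
    unfolding iota_eq using m by (intro FM_smult HR.RG_subset b) auto
  also have "\<dots> = T.cls (\<Sum>h\<in>H. frag_of (b h \<otimes>\<^bsub>K\<^esub> \<one>\<^bsub>K\<^esub>, ge h \<odot>\<^bsub>M\<^esub> m))"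
    by simp
  also have "\<dots> = T.cls (\<Sum>h\<in>H. frag_of (\<one>\<^bsub>K\<^esub>, const (b h) \<odot>\<^bsub>M\<^esub> (ge h \<odot>\<^bsub>M\<^esub> m)))"
  proof (rule T.cls_sum_cong)
    show "finite H" using HR.finite_G by simp
    fix h assume h: "h \<in> H"
    show "T.cls (frag_of (b h \<otimes>\<^bsub>K\<^esub> \<one>\<^bsub>K\<^esub>, ge h \<odot>\<^bsub>M\<^esub> m)) = T.cls (frag_of (\<one>\<^bsub>K\<^esub>, const (b h) \<odot>\<^bsub>M\<^esub> (ge h \<odot>\<^bsub>M\<^esub> m)))"
      using T.cls_balanced[of "\<one>\<^bsub>K\<^esub>" "b h" "ge h \<odot>\<^bsub>M\<^esub> m"] gm[OF h] bR bK by (simp add: MR_smult)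
  qed
  also have "\<dots> = T.cls (frag_of (\<one>\<^bsub>K\<^esub>, \<Oplus>\<^bsub>MR\<^esub>h\<in>H. const (b h) \<odot>\<^bsub>M\<^esub> (ge h \<odot>\<^bsub>M\<^esub> m)))"
    using HR.finite_G gm const_RH[OF bR] by (intro T.cls_finsum_right) (auto intro: M.smult_closed)
  also have "(\<Oplus>\<^bsub>MR\<^esub>h\<in>H. const (b h) \<odot>\<^bsub>M\<^esub> (ge h \<odot>\<^bsub>M\<^esub> m)) = (\<Oplus>\<^bsub>M\<^esub>h\<in>H. const (b h) \<odot>\<^bsub>M\<^esub> (ge h \<odot>\<^bsub>M\<^esub> m))"
    using HR.finite_G gm const_RH[OF bR] by (intro MR_finsum) (auto intro: M.smult_closed)
  also have "\<dots> = (\<Oplus>\<^bsub>M\<^esub>h\<in>H. (const (b h) \<otimes>\<^bsub>RH\<^esub> ge h) \<odot>\<^bsub>M\<^esub> m)"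
    using const_RH[OF bR] ge_RH m by (intro M.V.finsum_cong') (auto simp: M.smult_assoc intro!: M.smult_closed)
  also have "\<dots> = (\<Oplus>\<^bsub>RH\<^esub>h\<in>H. const (b h) \<otimes>\<^bsub>RH\<^esub> ge h) \<odot>\<^bsub>M\<^esub> m"
    using HR.finite_G const_RH[OF bR] ge_RH m by (intro M.smult_finsum_left[symmetric] M.A.m_closed) auto
  also have "\<dots> = b \<odot>\<^bsub>M\<^esub> m" using RH_decomposition[OF b] by simp
  finally show ?thesis unfolding iota_eq by (rule sym)
qed

lemma const_smult_cls:
  assumes k: "k \<in> carrier K" and f: "f \<in> carrier K" and m: "m \<in> carrier M"
  shows "const k \<odot>\<^bsub>FM\<^esub> T.cls (frag_of (f, m)) = T.cls (frag_of (k \<otimes>\<^bsub>K\<^esub> f, m))"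
proof -
  have "const k \<odot>\<^bsub>FM\<^esub> T.cls (frag_of (f, m)) = T.cls (\<Sum>h\<in>H. frag_of (const k h \<otimes>\<^bsub>K\<^esub> f, ge h \<odot>\<^bsub>M\<^esub> m))"
    using FM_smult[OF const_KH[OF k], of "frag_of (f, m)"] f m by simp
  also have "\<dots> = T.cls (\<Sum>h\<in>H. if h = \<one>\<^bsub>G\<^esub> then frag_of (k \<otimes>\<^bsub>K\<^esub> f, m) else 0)"
  proof (rule T.cls_sum_cong)
    \<comment> \<open>For \<open>h\<close> different from the identity the first slot is zero, and
      such a tensor vanishes.\<close>
    fix h assume h: "h \<in> H"
    have one: "ge \<one>\<^bsub>G\<^esub> \<odot>\<^bsub>M\<^esub> m = m" using M.smult_one[OF m] by (simp add: group_elem_def cong: if_cong)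
    show "T.cls (frag_of (const k h \<otimes>\<^bsub>K\<^esub> f, ge h \<odot>\<^bsub>M\<^esub> m)) = T.cls (if h = \<one>\<^bsub>G\<^esub> then frag_of (k \<otimes>\<^bsub>K\<^esub> f, m) else 0)"
      using T.cls_zero_left[of "ge h \<odot>\<^bsub>M\<^esub> m"] M.smult_closed[OF ge_RH[OF h] m] f one
      by (auto simp: const_def)
  qed (use HR.finite_G in simp)
  also have "(\<Sum>h\<in>H. if h = \<one>\<^bsub>G\<^esub> then frag_of (k \<otimes>\<^bsub>K\<^esub> f, m) else 0) = frag_of (k \<otimes>\<^bsub>K\<^esub> f, m)"
    using HR.finite_G by simp
  finally show ?thesis .
qed

lemma const_mult: "j \<in> carrier K \<Longrightarrow> k \<in> carrier K \<Longrightarrow> const j \<otimes>\<^bsub>KH\<^esub> const k = const (j \<otimes>\<^bsub>K\<^esub> k)"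
proof
  fix x assume jk: "j \<in> carrier K" "k \<in> carrier K"
  show "(const j \<otimes>\<^bsub>KH\<^esub> const k) x = const (j \<otimes>\<^bsub>K\<^esub> k) x"
  proof (cases "x \<in> H")
    case True
    have "(\<Oplus>\<^bsub>K\<^esub>y\<in>H. const j y \<otimes>\<^bsub>K\<^esub> const k (inv\<^bsub>GH\<^esub> y \<otimes>\<^bsub>G\<^esub> x)) =
       const j \<one>\<^bsub>G\<^esub> \<otimes>\<^bsub>K\<^esub> const k (inv\<^bsub>GH\<^esub> \<one>\<^bsub>G\<^esub> \<otimes>\<^bsub>G\<^esub> x)"
      using HR.finite_G jk by (intro K.finsum_single) (auto simp: const_def)
    then show ?thesis using True jk H.mem_carrier[OF True] by (simp add: group_ring_mult inv_GH) (simp add: const_def)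
  next
    case False
    then show ?thesis using H.one_closed by (auto simp: group_ring_mult const_def)
  qed
qed

text \<open>A tensor is a finite integral combination of pure tensors \<open>f \<otimes> m\<close>,
  and if \<open>f\<close> is the fraction of \<open>a\<close> by \<open>b\<close> then
  \<open>b\<close> clears it. For a difference the product of two denominators works.\<close>

lemma denominator:
  assumes "x \<in> carrier FM"
  shows "\<exists>d\<in>R - {\<zero>\<^bsub>K\<^esub>}. const d \<odot>\<^bsub>FM\<^esub> x \<in> iota ` carrier M"
proof -
  obtain c where x: "x = T.cls c" and c: "Poly_Mapping.keys c \<subseteq> carrier K \<times> carrier M"
    using assms by (auto simp: FM_simps T.tensor_carrier)
  have cc: "T.cls c \<in> carrier FM" if "Poly_Mapping.keys c \<subseteq> carrier K \<times> carrier M" for c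
    using that by (auto simp: FM_simps T.tensor_carrier)
  have scale: "const e \<odot>\<^bsub>FM\<^esub> (iota m) = iota (const e \<odot>\<^bsub>M\<^esub> m)" "const e \<odot>\<^bsub>M\<^esub> m \<in> carrier M"
    if "e \<in> R" "m \<in> carrier M" for e m
    using iota_smult[OF const_RH] M.smult_closed[OF const_RH] that by simp_all
  have "\<exists>d\<in>R - {\<zero>\<^bsub>K\<^esub>}. const d \<odot>\<^bsub>FM\<^esub> T.cls c \<in> iota ` carrier M"
  proof (rule free_Abelian_group_induct[OF c])
    have "const \<one>\<^bsub>K\<^esub> \<odot>\<^bsub>FM\<^esub> T.cls 0 = T.cls 0"
      using FM_smult[OF const_KH[OF K.one_closed], of 0] by simp
    also have "T.cls 0 = iota \<zero>\<^bsub>M\<^esub>"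
      unfolding iota_eq using T.cls_finsum_right[of "{}" "\<one>\<^bsub>K\<^esub>"] by simp
    finally show "\<exists>d\<in>R - {\<zero>\<^bsub>K\<^esub>}. const d \<odot>\<^bsub>FM\<^esub> T.cls 0 \<in> iota ` carrier M"
      using R_facts(3) by (intro bexI[of _ "\<one>\<^bsub>K\<^esub>"]) auto
  next
    fix u assume "u \<in> carrier K \<times> carrier M"
    then obtain f m where u: "u = (f, m)" "f \<in> carrier K" "m \<in> carrier M" by auto
    obtain a b where ab: "a \<in> R" "b \<in> R" "b \<noteq> \<zero>\<^bsub>K\<^esub>" "f = a \<otimes>\<^bsub>K\<^esub> inv\<^bsub>K\<^esub> b"
      using fractions[OF u(2)] by auto
    have abK: "a \<in> carrier K" "b \<in> carrier K" "b \<in> Units K"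
      using ab R_in_K K.field_Units by auto
    have "b \<otimes>\<^bsub>K\<^esub> f = a \<otimes>\<^bsub>K\<^esub> (b \<otimes>\<^bsub>K\<^esub> inv\<^bsub>K\<^esub> b)"
      unfolding ab(4) using abK K.Units_inv_closed[OF abK(3)] by (simp only: K.m_ac K.m_closed)
    then have bf: "b \<otimes>\<^bsub>K\<^esub> f = \<one>\<^bsub>K\<^esub> \<otimes>\<^bsub>K\<^esub> a" using abK by simp
    have "const b \<odot>\<^bsub>FM\<^esub> T.cls (frag_of u) = T.cls (frag_of (\<one>\<^bsub>K\<^esub> \<otimes>\<^bsub>K\<^esub> a, m))"
      unfolding u(1) const_smult_cls[OF abK(2) u(2,3)] bf ..
    also have "\<dots> = iota (const a \<odot>\<^bsub>M\<^esub> m)"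
      using T.cls_balanced[of "\<one>\<^bsub>K\<^esub>" a m] ab(1) u(3) by (simp add: MR_smult iota_eq)
    finally show "\<exists>d\<in>R - {\<zero>\<^bsub>K\<^esub>}. const d \<odot>\<^bsub>FM\<^esub> T.cls (frag_of u) \<in> iota ` carrier M"
      using ab(2,3) scale(2)[OF ab(1) u(3)] by (intro bexI[of _ b]) auto
  next
    fix c1 c2 assume k: "Poly_Mapping.keys c1 \<subseteq> carrier K \<times> carrier M" "Poly_Mapping.keys c2 \<subseteq> carrier K \<times> carrier M"
      and ex: "\<exists>d\<in>R - {\<zero>\<^bsub>K\<^esub>}. const d \<odot>\<^bsub>FM\<^esub> T.cls c1 \<in> iota ` carrier M"
        "\<exists>d\<in>R - {\<zero>\<^bsub>K\<^esub>}. const d \<odot>\<^bsub>FM\<^esub> T.cls c2 \<in> iota ` carrier M"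
    obtain d1 m1 where d1: "d1 \<in> R" "d1 \<noteq> \<zero>\<^bsub>K\<^esub>" "m1 \<in> carrier M" "const d1 \<odot>\<^bsub>FM\<^esub> T.cls c1 = iota m1"
      using ex(1) by auto
    obtain d2 m2 where d2: "d2 \<in> R" "d2 \<noteq> \<zero>\<^bsub>K\<^esub>" "m2 \<in> carrier M" "const d2 \<odot>\<^bsub>FM\<^esub> T.cls c2 = iota m2"
      using ex(2) by auto
    have K12: "d1 \<in> carrier K" "d2 \<in> carrier K" using d1 d2 R_in_K by auto
    note kH = const_KH[OF K12(1)] const_KH[OF K12(2)]
    let ?d = "const (d1 \<otimes>\<^bsub>K\<^esub> d2)"
    have dd: "?d = const d2 \<otimes>\<^bsub>KH\<^esub> const d1" "?d = const d1 \<otimes>\<^bsub>KH\<^esub> const d2"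
      using const_mult[OF K12] const_mult[OF K12(2,1)] K12 by (simp_all add: K.m_comm)
    have dH: "?d \<in> carrier KH" using K12 by (intro const_KH) simp
    let ?n1 = "const d2 \<odot>\<^bsub>M\<^esub> m1" and ?n2 = "const d1 \<odot>\<^bsub>M\<^esub> m2"
    have n: "?n1 \<in> carrier M" "?n2 \<in> carrier M"
      using scale(2)[OF d2(1) d1(3)] scale(2)[OF d1(1) d2(3)] by auto
    have e1: "?d \<odot>\<^bsub>FM\<^esub> T.cls c1 = iota ?n1"
      unfolding dd(1) using FM.smult_assoc[OF kH(2) kH(1) cc[OF k(1)]] d1(4) scale(1)[OF d2(1) d1(3)] by simp
    have e2: "?d \<odot>\<^bsub>FM\<^esub> T.cls c2 = iota ?n2"
      unfolding dd(2) using FM.smult_assoc[OF kH(1) kH(2) cc[OF k(2)]] d2(4) scale(1)[OF d1(1) d2(3)] by simp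
    have k': "Poly_Mapping.keys (c1 - c2) \<subseteq> carrier K \<times> carrier M" using keys_diff[of c1 c2] k by blast
    have i: "iota (\<ominus>\<^bsub>M\<^esub> ?n2) \<in> carrier FM" "iota ?n1 \<in> carrier FM" "iota ?n2 \<in> carrier FM"
      using n iota_closed by auto
    \<comment> \<open>The multiple of the difference is identified by cancellation: adding
      \<open>iota ?n2\<close> to it, or to the expected value, gives
      \<open>iota ?n1\<close>.\<close>
    have "?d \<odot>\<^bsub>FM\<^esub> T.cls (c1 - c2) \<oplus>\<^bsub>FM\<^esub> iota ?n2 = iota ?n1"
    proof -
      have "T.cls c1 = T.cls (c1 - c2) \<oplus>\<^bsub>FM\<^esub> T.cls c2"
        using T.tensor_add[of "c1 - c2" c2] k k' by (simp add: FM_simps)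
      then have "?d \<odot>\<^bsub>FM\<^esub> T.cls c1 = ?d \<odot>\<^bsub>FM\<^esub> T.cls (c1 - c2) \<oplus>\<^bsub>FM\<^esub> ?d \<odot>\<^bsub>FM\<^esub> T.cls c2"
        using FM.smult_r_distr[OF dH cc[OF k'] cc[OF k(2)]] by simp
      then show ?thesis using e1 e2 by simp
    qed
    moreover have "iota (?n1 \<oplus>\<^bsub>M\<^esub> \<ominus>\<^bsub>M\<^esub> ?n2) \<oplus>\<^bsub>FM\<^esub> iota ?n2 = iota ?n1"
      using n iota_add[of "?n1 \<oplus>\<^bsub>M\<^esub> \<ominus>\<^bsub>M\<^esub> ?n2" ?n2] by (simp add: M.V.a_assoc M.V.l_neg)
    ultimately have "?d \<odot>\<^bsub>FM\<^esub> T.cls (c1 - c2) = iota (?n1 \<oplus>\<^bsub>M\<^esub> \<ominus>\<^bsub>M\<^esub> ?n2)"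
      using FM.V.add.r_cancel[of "?d \<odot>\<^bsub>FM\<^esub> T.cls (c1 - c2)" "iota ?n2" "iota (?n1 \<oplus>\<^bsub>M\<^esub> \<ominus>\<^bsub>M\<^esub> ?n2)"]
        FM.smult_closed[OF dH cc[OF k']] i n iota_closed by simp
    moreover have "d1 \<otimes>\<^bsub>K\<^esub> d2 \<in> R - {\<zero>\<^bsub>K\<^esub>}"
      using d1(1,2) d2(1,2) K12 R_facts(6) K.integral_iff by auto
    ultimately show "\<exists>d\<in>R - {\<zero>\<^bsub>K\<^esub>}. const d \<odot>\<^bsub>FM\<^esub> T.cls (c1 - c2) \<in> iota ` carrier M"
      using n by (intro bexI[of _ "d1 \<otimes>\<^bsub>K\<^esub> d2"]) auto
  qed
  then show ?thesis unfolding x .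
qed

end

section \<open>Coordinates with respect to the generator \<open>v\<close>\<close>

context induced_lattice
begin

text \<open>The coordinate along \<open>v\<close>: an \<open>F[H]\<close>-linear isomorphism from
  \<open>FM\<close> onto \<open>F[H]\<close> that sends \<open>v\<close> to the identity.\<close>

definition phi :: "(('k \<times> 'm) \<Rightarrow>\<^sub>0 int) set \<Rightarrow> ('g \<Rightarrow> 'k)" where
  "phi = inv_into (carrier KH) (\<lambda>l. l \<odot>\<^bsub>FM\<^esub> v)"

lemma phi_closed: "x \<in> carrier FM \<Longrightarrow> phi x \<in> carrier KH"
  unfolding phi_def using v_basis by (metis bij_betw_imp_surj_on inv_into_into)

lemma phi_v: "x \<in> carrier FM \<Longrightarrow> phi x \<odot>\<^bsub>FM\<^esub> v = x"
  unfolding phi_def using bij_betw_inv_into_right[OF v_basis] by simp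

lemma phi_smult_v: "l \<in> carrier KH \<Longrightarrow> phi (l \<odot>\<^bsub>FM\<^esub> v) = l"
  unfolding phi_def using bij_betw_inv_into_left[OF v_basis] by simp

lemma phi_add:
  assumes "x \<in> carrier FM" "y \<in> carrier FM"
  shows "phi (x \<oplus>\<^bsub>FM\<^esub> y) = phi x \<oplus>\<^bsub>KG\<^esub> phi y"
proof -
  have "(phi x \<oplus>\<^bsub>KH\<^esub> phi y) \<odot>\<^bsub>FM\<^esub> v = x \<oplus>\<^bsub>FM\<^esub> y"
    using FM.smult_l_distr[OF phi_closed[OF assms(1)] phi_closed[OF assms(2)] v_closed] phi_v assms by simp
  moreover have "phi x \<oplus>\<^bsub>KH\<^esub> phi y \<in> carrier KH"
    using phi_closed assms by (intro HR.KG.a_closed)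
  ultimately have "phi (x \<oplus>\<^bsub>FM\<^esub> y) = phi x \<oplus>\<^bsub>KH\<^esub> phi y" using phi_smult_v by metis
  then show ?thesis by simp
qed

lemma phi_smult:
  assumes "l \<in> carrier KH" "x \<in> carrier FM"
  shows "phi (l \<odot>\<^bsub>FM\<^esub> x) = l \<star> phi x"
proof -
  have "(l \<otimes>\<^bsub>KH\<^esub> phi x) \<odot>\<^bsub>FM\<^esub> v = l \<odot>\<^bsub>FM\<^esub> x"
    using FM.smult_assoc[OF assms(1) phi_closed[OF assms(2)] v_closed] phi_v[OF assms(2)] by simp
  moreover have "l \<otimes>\<^bsub>KH\<^esub> phi x \<in> carrier KH"
    using phi_closed assms by (intro HR.KG.m_closed)
  ultimately have "phi (l \<odot>\<^bsub>FM\<^esub> x) = l \<otimes>\<^bsub>KH\<^esub> phi x" using phi_smult_v by metis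
  then show ?thesis using KH_mult[OF assms(1) phi_closed[OF assms(2)]] by simp
qed

lemma inj_phi: "x \<in> carrier FM \<Longrightarrow> y \<in> carrier FM \<Longrightarrow> phi x = phi y \<Longrightarrow> x = y"
  using phi_v by metis

text \<open>The lattice \<open>M\<close> seen inside \<open>F[H]\<close>; from here on
  \<open>M\<close> is studied through this set.\<close>

definition lat :: "('g \<Rightarrow> 'k) set" where
  "lat = phi ` lattice_in K R GH M"

definition theta :: "'m \<Rightarrow> ('g \<Rightarrow> 'k)" where
  "theta m = phi (iota m)"

lemma lat_eq: "lat = theta ` carrier M"
  by (simp add: lat_def lattice_in_def theta_def image_image)

lemma theta_closed: "m \<in> carrier M \<Longrightarrow> theta m \<in> carrier KH"
  by (simp add: theta_def phi_closed iota_closed)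

lemma theta_add: "m \<in> carrier M \<Longrightarrow> m' \<in> carrier M \<Longrightarrow> theta (m \<oplus>\<^bsub>M\<^esub> m') = theta m \<oplus>\<^bsub>KG\<^esub> theta m'"
  unfolding theta_def iota_add by (intro phi_add iota_closed)

lemma theta_smult: "b \<in> carrier RH \<Longrightarrow> m \<in> carrier M \<Longrightarrow> theta (b \<odot>\<^bsub>M\<^esub> m) = b \<star> theta m"
  unfolding theta_def iota_smult by (intro phi_smult iota_closed HR.RG_subset)

lemma RH_submodule_lat: "RH_submodule lat"
proof -
  have tK: "theta m \<in> carrier KG" if "m \<in> carrier M" for m using KH_subset[OF theta_closed[OF that]] .
  have "subgroup lat (add_monoid KG)"
  proof (rule KG.add.subgroupI)
    show "lat \<subseteq> carrier KG" using tK by (auto simp: lat_eq)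
    show "lat \<noteq> {}" using M.V.zero_closed by (auto simp: lat_eq)
    fix a b assume "a \<in> lat" "b \<in> lat"
    then obtain m n where mn: "a = theta m" "m \<in> carrier M" "b = theta n" "n \<in> carrier M" by (auto simp: lat_eq)
    then show "a \<oplus>\<^bsub>KG\<^esub> b \<in> lat" using theta_add[of m n] M.V.a_closed by (metis imageI lat_eq)
  next
    fix a assume "a \<in> lat"
    then obtain m where m: "a = theta m" "m \<in> carrier M" by (auto simp: lat_eq)
    have "theta m \<oplus>\<^bsub>KG\<^esub> theta \<zero>\<^bsub>M\<^esub> = theta m \<oplus>\<^bsub>KG\<^esub> \<zero>\<^bsub>KG\<^esub>"
      using theta_add[OF m(2) M.V.zero_closed] m KG.r_zero[OF tK[OF m(2)]] by (simp del: group_ring_simps)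
    then have z: "theta \<zero>\<^bsub>M\<^esub> = \<zero>\<^bsub>KG\<^esub>"
      using KG.add.l_cancel tK[OF m(2)] tK[OF M.V.zero_closed] KG.zero_closed by blast
    have "theta (\<ominus>\<^bsub>M\<^esub> m) \<oplus>\<^bsub>KG\<^esub> theta m = \<zero>\<^bsub>KG\<^esub>"
      using theta_add[of "\<ominus>\<^bsub>M\<^esub> m" m] m(2) z M.V.l_neg by (simp del: group_ring_simps)
    then have "\<ominus>\<^bsub>KG\<^esub> a = theta (\<ominus>\<^bsub>M\<^esub> m)"
      using KG.minus_equality[OF _ tK[OF m(2)] tK[OF M.V.a_inv_closed[OF m(2)]]] m by blast
    then show "\<ominus>\<^bsub>KG\<^esub> a \<in> lat" using m(2) by (auto simp: lat_eq)
  qed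
  moreover have "x \<star> l \<in> lat" if "x \<in> carrier RH" "l \<in> lat" for x l
    using that theta_smult[OF that(1)] M.smult_closed by (force simp: lat_eq)
  ultimately show ?thesis using theta_closed by (auto simp: RH_submodule_def lat_eq)
qed

text \<open>\<open>phi\<close> is injective and linear over \<open>F[H]\<close>, so stabilising the
  lattice in \<open>FM\<close> and stabilising its coordinates are the same condition.\<close>

lemma order_of_lattice_eq:
  "order_of_lattice K R G H M = {b \<in> carrier KH. \<forall>l\<in>lat. b \<star> l \<in> lat}"
proof -
  have L: "x \<in> carrier FM" if "x \<in> lattice_in K R GH M" for x
    using that iota_closed by (auto simp: lattice_in_def)
  have "b \<odot>\<^bsub>FM\<^esub> x \<in> lattice_in K R GH M \<longleftrightarrow> b \<star> phi x \<in> lat"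
    if b: "b \<in> carrier KH" and x: "x \<in> lattice_in K R GH M" for b x
  proof
    assume "b \<odot>\<^bsub>FM\<^esub> x \<in> lattice_in K R GH M"
    then show "b \<star> phi x \<in> lat" using phi_smult[OF b L[OF x]] unfolding lat_def by (metis imageI)
  next
    assume "b \<star> phi x \<in> lat"
    then obtain y where y: "y \<in> lattice_in K R GH M" "phi (b \<odot>\<^bsub>FM\<^esub> x) = phi y"
      using phi_smult[OF b L[OF x]] by (auto simp: lat_def)
    then have "b \<odot>\<^bsub>FM\<^esub> x = y" using inj_phi FM.smult_closed[OF b L[OF x]] L by blast
    then show "b \<odot>\<^bsub>FM\<^esub> x \<in> lattice_in K R GH M" using y by simp
  qed
  then show ?thesis unfolding assoc_order_def lat_def by auto
qed

text \<open>The generator \<open>v\<close> has a denominator \<open>d\<close>, and the coordinate of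
  \<open>d\<close> times \<open>v\<close> is the scalar \<open>d\<close>. The projective case
  evaluates its dual maps at this nonzero central element of the lattice.\<close>

lemma const_in_lat: "\<exists>d\<in>R - {\<zero>\<^bsub>K\<^esub>}. const d \<in> lat"
proof -
  obtain d where d: "d \<in> R - {\<zero>\<^bsub>K\<^esub>}" "const d \<odot>\<^bsub>FM\<^esub> v \<in> iota ` carrier M"
    using denominator[OF v_closed] by blast
  then have "phi (const d \<odot>\<^bsub>FM\<^esub> v) \<in> lat" by (auto simp: lat_def lattice_in_def)
  then show ?thesis using d(1) phi_smult_v[OF const_KH] R_in_K by auto
qed

sublocale T2: tensor_product KG "carrier KH" FM
  unfolding tensor_product_def tensor_product_axioms_def
  using KG.ring_axioms FM.V.abelian_group_axioms KH_subset FM.smult_closed by blast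

abbreviation "IndFM \<equiv> Ind K G H FM"

lemma IndFM_eq: "IndFM = tensor KG (carrier KH) FM"
  by (simp add: Ind_def)

text \<open>Inverse of the map from \<open>Ind FM\<close> to \<open>F[G]\<close> induced by
  \<open>phi\<close>. It exhibits \<open>Ind FM\<close> as free of rank one on the class of
  \<open>1 \<otimes> v\<close>.\<close>

definition psi :: "('g \<Rightarrow> 'k) \<Rightarrow> ((('g \<Rightarrow> 'k) \<times> (('k \<times> 'm) \<Rightarrow>\<^sub>0 int) set) \<Rightarrow>\<^sub>0 int) set" where
  "psi a = T2.cls (frag_of (a, v))"

lemma phi_KG: "phi ` carrier FM \<subseteq> carrier KG"
  using phi_closed KH_subset by blast

lemmas tphi = teval_facts[OF subset_refl phi_KG]

lemma teval_phi_rel: "c \<in> T2.rel \<Longrightarrow> teval phi c = \<zero>\<^bsub>KG\<^esub>"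
  by (rule teval_rel[OF T2.tensor_product_axioms]) (use phi_KG phi_add phi_smult in blast)+

text \<open>Since \<open>x\<close> is \<open>phi x\<close> acting on \<open>v\<close>, the factor
  \<open>phi x\<close> moves across the tensor sign, and a pure tensor \<open>a \<otimes> x\<close>
  becomes one whose second factor is \<open>v\<close>.\<close>

lemma cls_psi:
  assumes "Poly_Mapping.keys c \<subseteq> carrier KG \<times> carrier FM"
  shows "T2.cls c = psi (teval phi c)"
proof (rule free_Abelian_group_induct[OF assms])
  show "T2.cls 0 = psi (teval phi 0)"
    unfolding tphi(1) psi_def using T2.cls_zero_left[OF v_closed] by (rule sym)
next
  fix c d assume cd: "Poly_Mapping.keys c \<subseteq> carrier KG \<times> carrier FM" "Poly_Mapping.keys d \<subseteq> carrier KG \<times> carrier FM"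
    "T2.cls c = psi (teval phi c)" "T2.cls d = psi (teval phi d)"
  let ?a = "teval phi c" and ?b = "teval phi d"
  have ab: "?a \<in> carrier KG" "?b \<in> carrier KG" using tphi(3) cd by auto
  \<comment> \<open>The relations provide additivity rather than subtraction, so \<open>?a\<close>
    is written as \<open>?b\<close> plus the difference.\<close>
  have "T2.cls (frag_of (?b \<oplus>\<^bsub>KG\<^esub> (?a \<ominus>\<^bsub>KG\<^esub> ?b), v)) = T2.cls (frag_of (?b, v) + frag_of (?a \<ominus>\<^bsub>KG\<^esub> ?b, v))"
    using ab v_closed by (intro T2.cls_add_left KG.minus_closed)
  then have a: "T2.cls (frag_of (?a, v)) = T2.cls (frag_of (?b, v) + frag_of (?a \<ominus>\<^bsub>KG\<^esub> ?b, v))"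
    unfolding KG.add_diff_cancel[OF ab] .
  have "T2.cls (c - d) = T2.cls (frag_of (?a, v) - frag_of (?b, v))"
    using cd(3,4) unfolding psi_def by (intro T2.cls_diff_cong)
  also have "\<dots> = T2.cls ((frag_of (?b, v) + frag_of (?a \<ominus>\<^bsub>KG\<^esub> ?b, v)) - frag_of (?b, v))"
    using a by (intro T2.cls_diff_cong) auto
  finally show "T2.cls (c - d) = psi (teval phi (c - d))"
    unfolding tphi(4)[OF cd(1,2)] psi_def by simp
next
  fix u assume "u \<in> carrier KG \<times> carrier FM"
  then obtain a x where u: "u = (a, x)" "a \<in> carrier KG" "x \<in> carrier FM" by auto
  show "T2.cls (frag_of u) = psi (teval phi (frag_of u))"
    unfolding u(1) tphi(2)[OF u(2,3)] psi_def
    using T2.cls_balanced[OF u(2) phi_closed[OF u(3)] v_closed] phi_v[OF u(3)] by simp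
qed

lemma phi_v_one: "phi v = \<one>\<^bsub>KG\<^esub>"
proof -
  have "phi (\<one>\<^bsub>KH\<^esub> \<odot>\<^bsub>FM\<^esub> v) = \<one>\<^bsub>KH\<^esub>" using HR.KG.one_closed by (rule phi_smult_v)
  then show ?thesis using FM.smult_one[OF v_closed] by simp
qed

text \<open>Every representative of the class evaluates back to \<open>a\<close>. This yields
  injectivity of \<open>psi\<close> and controls the unions over representatives that define the
  actions.\<close>

lemma teval_mem_psi:
  assumes a: "a \<in> carrier KG" and c: "c \<in> psi a"
  shows "teval phi c = a" "Poly_Mapping.keys c \<subseteq> carrier KG \<times> carrier FM"
proof -
  have k: "Poly_Mapping.keys (frag_of (a, v) :: _ \<Rightarrow>\<^sub>0 int) \<subseteq> carrier KG \<times> carrier FM" using a v_closed by simp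
  have t: "\<And>a x. a \<in> carrier KG \<Longrightarrow> x \<in> carrier FM \<Longrightarrow> fst (a, x) \<star> phi (snd (a, x)) \<in> carrier KG"
    using phi_KG by (auto intro!: KG.m_closed)
  have r: "\<And>c. c \<in> T2.rel \<Longrightarrow> frag_eval KG (\<lambda>u. fst u \<star> phi (snd u)) c = \<zero>\<^bsub>KG\<^esub>"
    using teval_phi_rel unfolding teval_def .
  note ev = T2.cls_image_eval[OF KG.abelian_group_axioms t r k c[unfolded psi_def]]
  show "teval phi c = a"
    using ev(1) tphi(2)[OF a v_closed] phi_v_one KG.r_one[OF a] unfolding teval_def by simp
  show "Poly_Mapping.keys c \<subseteq> carrier KG \<times> carrier FM" by (rule ev(2))
qed

lemma psi_self: "frag_of (a, v) \<in> psi a"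
  unfolding psi_def by (rule T2.self_mem_cls)

lemma psi_inj: "a \<in> carrier KG \<Longrightarrow> b \<in> carrier KG \<Longrightarrow> psi a = psi b \<Longrightarrow> a = b"
  using teval_mem_psi(1)[of a] teval_mem_psi(1)[of b] psi_self by metis

lemma psi_add:
  assumes "a \<in> carrier KG" "b \<in> carrier KG"
  shows "psi a \<oplus>\<^bsub>IndFM\<^esub> psi b = psi (a \<oplus>\<^bsub>KG\<^esub> b)"
  unfolding IndFM_eq psi_def T2.cls_add_left[OF assms v_closed]
  using assms v_closed by (intro T2.tensor_add) auto

text \<open>The action is a union over all representatives of a class. Evaluation shows that each of
  them contributes the class of the same element \<open>l \<star> a\<close>, so the union is a
  single class.\<close>

lemma psi_smult:
  assumes l: "l \<in> carrier KG" and a: "a \<in> carrier KG"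
  shows "l \<odot>\<^bsub>IndFM\<^esub> psi a = psi (l \<star> a)"
proof -
  let ?g = "\<lambda>(a', x). frag_of (l \<star> a', x)"
  have ext: "Poly_Mapping.keys (frag_extend ?g c) \<subseteq> carrier KG \<times> carrier FM \<and>
      teval phi (frag_extend ?g c) = l \<star> teval phi c"
    if c: "Poly_Mapping.keys c \<subseteq> carrier KG \<times> carrier FM" for c
  proof (rule free_Abelian_group_induct[OF c])
    show "Poly_Mapping.keys (frag_extend ?g 0) \<subseteq> carrier KG \<times> carrier FM \<and>
      teval phi (frag_extend ?g 0) = l \<star> teval phi 0"
      using tphi(1) KG.r_null[OF l] by simp
  next
    fix c d assume c: "Poly_Mapping.keys c \<subseteq> carrier KG \<times> carrier FM" and d: "Poly_Mapping.keys d \<subseteq> carrier KG \<times> carrier FM"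
      and cI: "Poly_Mapping.keys (frag_extend ?g c) \<subseteq> carrier KG \<times> carrier FM \<and>
        teval phi (frag_extend ?g c) = l \<star> teval phi c"
      and dI: "Poly_Mapping.keys (frag_extend ?g d) \<subseteq> carrier KG \<times> carrier FM \<and>
        teval phi (frag_extend ?g d) = l \<star> teval phi d"
    have "l \<star> (teval phi c \<ominus>\<^bsub>KG\<^esub> teval phi d) = l \<star> teval phi c \<ominus>\<^bsub>KG\<^esub> l \<star> teval phi d"
      unfolding a_minus_def using l tphi(3)[OF c] tphi(3)[OF d] by (simp only: KG.r_distr KG.r_minus KG.a_inv_closed)
    moreover have "teval phi (frag_extend ?g c - frag_extend ?g d) = teval phi (frag_extend ?g c) \<ominus>\<^bsub>KG\<^esub> teval phi (frag_extend ?g d)"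
      using cI dI by (intro tphi(4)) auto
    ultimately have "teval phi (frag_extend ?g (c - d)) = l \<star> teval phi (c - d)"
      unfolding tphi(4)[OF c d] frag_extend_diff using cI dI by simp
    moreover have "Poly_Mapping.keys (frag_extend ?g (c - d)) \<subseteq> carrier KG \<times> carrier FM"
      unfolding frag_extend_diff using cI dI T2.keys_diff_subset by blast
    ultimately show "Poly_Mapping.keys (frag_extend ?g (c - d)) \<subseteq> carrier KG \<times> carrier FM \<and>
      teval phi (frag_extend ?g (c - d)) = l \<star> teval phi (c - d)" by blast
  next
    fix u assume "u \<in> carrier KG \<times> carrier FM"
    then obtain a x where u: "u = (a, x)" "a \<in> carrier KG" "x \<in> carrier FM" by auto
    have la: "l \<star> a \<in> carrier KG" using l u(2) by (rule KG.m_closed)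
    have "teval phi (frag_of (l \<star> a, x)) = l \<star> teval phi (frag_of (a, x))"
      unfolding tphi(2)[OF la u(3)] tphi(2)[OF u(2,3)]
      using l u(2) phi_KG u(3) by (intro KG.m_assoc) auto
    then show "Poly_Mapping.keys (frag_extend ?g (frag_of u)) \<subseteq> carrier KG \<times> carrier FM \<and>
      teval phi (frag_extend ?g (frag_of u)) = l \<star> teval phi (frag_of u)"
      using la u by simp
  qed
  have "T2.cls (frag_extend ?g c) = psi (l \<star> a)" if "c \<in> psi a" for c
    using cls_psi ext[OF teval_mem_psi(2)[OF a that]] teval_mem_psi(1)[OF a that] by simp
  moreover have "l \<odot>\<^bsub>IndFM\<^esub> psi a = (\<Union>c\<in>psi a. T2.cls (frag_extend ?g c))"
    unfolding IndFM_eq by (simp add: tensor_def Let_def tensor_lift_def)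
  ultimately show ?thesis using psi_self[of a] by auto
qed

text \<open>The canonical map sends \<open>x \<otimes> m\<close> to
  \<open>x \<otimes> iota m\<close>, whose value in \<open>F[G]\<close> is \<open>x\<close> times
  \<open>theta m\<close>. So under \<open>psi\<close> the lattice is the image of
  \<open>teval theta\<close>, and \<open>teval_image\<close> applies.\<close>

lemma Ind_lattice_eq: "Ind_lattice K R G H M = psi ` indspan lat"
proof -
  let ?g = "\<lambda>(x, m). frag_of (x, iota m)"
  interpret TR: tensor_product RG "carrier RH" M
    using M.V.abelian_group_axioms M.smult_closed by (rule tensor_product_RG)
  have RGK: "carrier RG \<subseteq> carrier KG" using RG_subset by blast
  have tK: "theta ` carrier M \<subseteq> carrier KG" using theta_closed KH_subset by blast
  note tt = teval_facts[OF RGK tK]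
  have ext: "Poly_Mapping.keys (frag_extend ?g c) \<subseteq> carrier KG \<times> carrier FM \<and>
      teval phi (frag_extend ?g c) = teval theta c"
    if c: "Poly_Mapping.keys c \<subseteq> carrier RG \<times> carrier M" for c
  proof (rule free_Abelian_group_induct[OF c])
    show "Poly_Mapping.keys (frag_extend ?g 0) \<subseteq> carrier KG \<times> carrier FM \<and>
      teval phi (frag_extend ?g 0) = teval theta 0"
      using tphi(1) tt(1) by simp
  next
    fix c d assume c: "Poly_Mapping.keys c \<subseteq> carrier RG \<times> carrier M" and d: "Poly_Mapping.keys d \<subseteq> carrier RG \<times> carrier M"
      and cI: "Poly_Mapping.keys (frag_extend ?g c) \<subseteq> carrier KG \<times> carrier FM \<and>
        teval phi (frag_extend ?g c) = teval theta c"
      and dI: "Poly_Mapping.keys (frag_extend ?g d) \<subseteq> carrier KG \<times> carrier FM \<and>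
        teval phi (frag_extend ?g d) = teval theta d"
    have "teval phi (frag_extend ?g c - frag_extend ?g d) = teval phi (frag_extend ?g c) \<ominus>\<^bsub>KG\<^esub> teval phi (frag_extend ?g d)"
      using cI dI by (intro tphi(4)) auto
    then have "teval phi (frag_extend ?g (c - d)) = teval theta (c - d)"
      unfolding tt(4)[OF c d] frag_extend_diff using cI dI by simp
    moreover have "Poly_Mapping.keys (frag_extend ?g (c - d)) \<subseteq> carrier KG \<times> carrier FM"
      unfolding frag_extend_diff using cI dI T2.keys_diff_subset by blast
    ultimately show "Poly_Mapping.keys (frag_extend ?g (c - d)) \<subseteq> carrier KG \<times> carrier FM \<and>
      teval phi (frag_extend ?g (c - d)) = teval theta (c - d)" by blast
  next
    fix u assume "u \<in> carrier RG \<times> carrier M"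
    then obtain a x where u: "u = (a, x)" "a \<in> carrier RG" "x \<in> carrier M" by auto
    then show "Poly_Mapping.keys (frag_extend ?g (frag_of u)) \<subseteq> carrier KG \<times> carrier FM \<and>
      teval phi (frag_extend ?g (frag_of u)) = teval theta (frag_of u)"
      using tphi(2)[OF RG_subset[OF u(2)] iota_closed[OF u(3)]] tt(2)[OF u(2,3)] RG_subset iota_closed
      by (simp add: theta_def)
  qed
  have kill: "teval theta c = \<zero>\<^bsub>KG\<^esub>" if "c \<in> TR.rel" for c
  proof (rule teval_rel[OF TR.tensor_product_axioms RGK _ _ _ _ _ that])
    show "a \<otimes>\<^bsub>RG\<^esub> b = a \<star> b" if "a \<in> carrier RG" "b \<in> carrier RH" for a b
      using RG_mult[OF that(1) RH_subset_RG[OF that(2)]] .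
  qed (use tK theta_add theta_smult in auto)
  have t: "\<And>a x. a \<in> carrier RG \<Longrightarrow> x \<in> carrier M \<Longrightarrow> fst (a, x) \<star> theta (snd (a, x)) \<in> carrier KG"
    using tK RGK by (auto intro!: KG.m_closed)
  have r: "\<And>c. c \<in> TR.rel \<Longrightarrow> frag_eval KG (\<lambda>u. fst u \<star> theta (snd u)) c = \<zero>\<^bsub>KG\<^esub>"
    using kill unfolding teval_def .
  have lift: "tensor_lift KG (carrier KH) FM ?g (TR.cls c) = psi (teval theta c)"
    if c: "Poly_Mapping.keys c \<subseteq> carrier RG \<times> carrier M" for c
  proof -
    have "T2.cls (frag_extend ?g e) = psi (teval theta c)" if e: "e \<in> TR.cls c" for e
    proof -
      note ev = TR.cls_image_eval[OF KG.abelian_group_axioms t r c e]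
      show ?thesis using cls_psi ext[OF ev(2)] ev(1) unfolding teval_def by simp
    qed
    then show ?thesis unfolding tensor_lift_def using TR.self_mem_cls[of c] by auto
  qed
  have "Ind_lattice K R G H M = tensor_lift KG (carrier KH) FM ?g ` (TR.cls ` {c. Poly_Mapping.keys c \<subseteq> carrier RG \<times> carrier M})"
    unfolding Ind_lattice_def Ind_def TR.tensor_carrier ..
  also have "\<dots> = psi ` (teval theta ` {c. Poly_Mapping.keys c \<subseteq> carrier RG \<times> carrier M})"
    unfolding image_image using lift by (auto simp: image_def)
  also have "teval theta ` {c. Poly_Mapping.keys c \<subseteq> carrier RG \<times> carrier M} = indspan lat"
    using RH_submodule_lat lat_eq[symmetric] by (rule teval_image)
  finally show ?thesis .
qed

lemma order_of_Ind_eq: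
  "order_of_Ind K R G H M = {a \<in> carrier KG. \<forall>y\<in>indspan lat. a \<star> y \<in> indspan lat}"
proof -
  have "a \<odot>\<^bsub>IndFM\<^esub> psi y \<in> psi ` indspan lat \<longleftrightarrow> a \<star> y \<in> indspan lat"
    if a: "a \<in> carrier KG" and y: "y \<in> indspan lat" for a y
  proof -
    have yK: "y \<in> carrier KG" by (rule indspan_closed[OF y])
    have "a \<odot>\<^bsub>IndFM\<^esub> psi y = psi (a \<star> y)" by (rule psi_smult[OF a yK])
    then show ?thesis
      using psi_inj[OF KG.m_closed[OF a yK]] indspan_closed by auto
  qed
  then show ?thesis unfolding assoc_order_def Ind_lattice_eq by auto
qed

end

section \<open>Normal closures, scalars, and congruences for translates\<close>

lemma (in group) ncl_normal: "P \<subseteq> carrier G \<Longrightarrow> ncl G P \<lhd> G"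
proof -
  assume P: "P \<subseteq> carrier G"
  \<comment> \<open>The whole group is a member of the family, so the intersection is over a
    nonempty family of subgroups.\<close>
  have ne: "carrier G \<in> {N. N \<lhd> G \<and> P \<subseteq> N}"
    using P by (auto simp: normal_inv_iff subgroup_self)
  have "subgroup (\<Inter>{N. N \<lhd> G \<and> P \<subseteq> N}) G"
    using ne by (intro subgroups_Inter) (auto simp: normal_inv_iff)
  then show ?thesis
    unfolding ncl_def normal_inv_iff by (auto simp: normal_inv_iff)
qed

lemma ncl_superset: "P \<subseteq> ncl G P"
  by (auto simp: ncl_def)

lemma ncl_least: "N \<lhd> G \<Longrightarrow> P \<subseteq> N \<Longrightarrow> ncl G P \<subseteq> N"
  by (auto simp: ncl_def)

lemma ncl_eq: "P \<lhd> G \<Longrightarrow> ncl G P = P"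
  using ncl_superset[of P G] ncl_least[of P G P] by blast

lemma ncl_mono: "P \<subseteq> P' \<Longrightarrow> ncl G P \<subseteq> ncl G P'"
  by (auto simp: ncl_def)

context valued_group_ring
begin

lemma mult_comm:
  assumes "comm_group G" and f: "f \<in> carrier KG" and g: "g \<in> carrier KG"
  shows "f \<otimes>\<^bsub>KG\<^esub> g = g \<otimes>\<^bsub>KG\<^esub> f"
proof
  interpret C: comm_group G by fact
  fix x
  note [simp] = coeff_closed[OF f] coeff_closed[OF g]
  show "(f \<otimes>\<^bsub>KG\<^esub> g) x = (g \<otimes>\<^bsub>KG\<^esub> f) x"
  proof (cases "x \<in> carrier G")
    case x: True
    \<comment> \<open>In an abelian group the map from \<open>z\<close> to \<open>inv z x\<close> is
      an involution, and as a substitution in the convolution it exchanges the two factors.\<close>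
    let ?h = "\<lambda>z. inv\<^bsub>G\<^esub> z \<otimes>\<^bsub>G\<^esub> x"
    have hh: "?h (?h z) = z" if "z \<in> carrier G" for z
    proof -
      have "?h (?h z) = inv\<^bsub>G\<^esub> x \<otimes>\<^bsub>G\<^esub> z \<otimes>\<^bsub>G\<^esub> x" using that x by (simp add: G.inv_mult_group)
      also have "\<dots> = z" using that x by (simp add: C.m_comm[of _ x] G.cancel_inv)
      finally show ?thesis .
    qed
    have inj: "inj_on ?h (carrier G)" using hh by (rule inj_on_inverseI)
    have img: "?h ` carrier G = carrier G"
    proof
      show "carrier G \<subseteq> ?h ` carrier G"
      proof
        fix z assume "z \<in> carrier G"
        then show "z \<in> ?h ` carrier G" using hh[of z] x by (intro image_eqI[of z ?h "?h z"]) auto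
      qed
    qed (use x in auto)
    have "(\<Oplus>\<^bsub>K\<^esub>y\<in>?h ` carrier G. f y \<otimes>\<^bsub>K\<^esub> g (?h y)) = (\<Oplus>\<^bsub>K\<^esub>z\<in>carrier G. f (?h z) \<otimes>\<^bsub>K\<^esub> g (?h (?h z)))"
      using inj by (intro K.finsum_reindex) auto
    also have "\<dots> = (\<Oplus>\<^bsub>K\<^esub>z\<in>carrier G. g z \<otimes>\<^bsub>K\<^esub> f (?h z))"
      using hh by (intro K.finsum_cong') (auto simp: K.m_comm)
    finally show ?thesis using x img by (simp add: group_ring_mult)
  qed (simp add: group_ring_mult)
qed

lemma scalar_mult:
  assumes "k \<in> carrier K" "a \<in> carrier KG"
  shows "(k \<odot>\<^bsub>KG\<^esub> \<one>\<^bsub>KG\<^esub>) \<otimes>\<^bsub>KG\<^esub> a = k \<odot>\<^bsub>KG\<^esub> a" "a \<otimes>\<^bsub>KG\<^esub> (k \<odot>\<^bsub>KG\<^esub> \<one>\<^bsub>KG\<^esub>) = k \<odot>\<^bsub>KG\<^esub> a"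
proof -
  note [simp] = coeff_closed[OF assms(2)]
  have a0: "a x = \<zero>\<^bsub>K\<^esub>" if "x \<notin> carrier G" for x using outside[OF assms(2) that] .
  show "(k \<odot>\<^bsub>KG\<^esub> \<one>\<^bsub>KG\<^esub>) \<otimes>\<^bsub>KG\<^esub> a = k \<odot>\<^bsub>KG\<^esub> a"
  proof
    fix x
    have "(\<Oplus>\<^bsub>K\<^esub>y\<in>carrier G. k \<otimes>\<^bsub>K\<^esub> ge \<one>\<^bsub>G\<^esub> y \<otimes>\<^bsub>K\<^esub> a (inv\<^bsub>G\<^esub> y \<otimes>\<^bsub>G\<^esub> x)) = k \<otimes>\<^bsub>K\<^esub> ge \<one>\<^bsub>G\<^esub> \<one>\<^bsub>G\<^esub> \<otimes>\<^bsub>K\<^esub> a (inv\<^bsub>G\<^esub> \<one>\<^bsub>G\<^esub> \<otimes>\<^bsub>G\<^esub> x)"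
      using assms finite_G by (intro K.finsum_single) (auto simp: group_elem_def)
    then show "((k \<odot>\<^bsub>KG\<^esub> \<one>\<^bsub>KG\<^esub>) \<otimes>\<^bsub>KG\<^esub> a) x = (k \<odot>\<^bsub>KG\<^esub> a) x"
      using assms(1) a0 by (auto simp: group_ring_mult group_elem_def)
  qed
  show "a \<otimes>\<^bsub>KG\<^esub> (k \<odot>\<^bsub>KG\<^esub> \<one>\<^bsub>KG\<^esub>) = k \<odot>\<^bsub>KG\<^esub> a"
  proof
    fix x
    have "(\<Oplus>\<^bsub>K\<^esub>y\<in>carrier G. a y \<otimes>\<^bsub>K\<^esub> (k \<otimes>\<^bsub>K\<^esub> ge \<one>\<^bsub>G\<^esub> (inv\<^bsub>G\<^esub> y \<otimes>\<^bsub>G\<^esub> x))) = a x \<otimes>\<^bsub>K\<^esub> (k \<otimes>\<^bsub>K\<^esub> ge \<one>\<^bsub>G\<^esub> (inv\<^bsub>G\<^esub> x \<otimes>\<^bsub>G\<^esub> x))"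
      if x: "x \<in> carrier G"
    proof (rule K.finsum_single)
      fix y assume y: "y \<in> carrier G" "y \<noteq> x"
      then have "inv\<^bsub>G\<^esub> y \<otimes>\<^bsub>G\<^esub> x \<noteq> \<one>\<^bsub>G\<^esub>" using x by (metis G.cancel_inv(1) G.r_one)
      then show "a y \<otimes>\<^bsub>K\<^esub> (k \<otimes>\<^bsub>K\<^esub> ge \<one>\<^bsub>G\<^esub> (inv\<^bsub>G\<^esub> y \<otimes>\<^bsub>G\<^esub> x)) = \<zero>\<^bsub>K\<^esub>"
        using assms(1) by (simp add: group_elem_def)
    qed (use x assms finite_G in \<open>auto simp: group_elem_def\<close>)
    then show "(a \<otimes>\<^bsub>KG\<^esub> (k \<odot>\<^bsub>KG\<^esub> \<one>\<^bsub>KG\<^esub>)) x = (k \<odot>\<^bsub>KG\<^esub> a) x"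
      using assms(1) a0 by (auto simp: group_ring_mult group_elem_def K.m_comm)
  qed
qed

text \<open>The denominators of the finitely many coefficients are multiplied together, one group
  element at a time.\<close>

lemma common_denominator:
  assumes fractions: "\<And>x. x \<in> carrier K \<Longrightarrow> \<exists>a\<in>R. \<exists>b\<in>R - {\<zero>\<^bsub>K\<^esub>}. x = a \<otimes>\<^bsub>K\<^esub> inv\<^bsub>K\<^esub> b"
    and y: "y \<in> carrier KG"
  shows "\<exists>e\<in>R - {\<zero>\<^bsub>K\<^esub>}. e \<odot>\<^bsub>KG\<^esub> y \<in> carrier RG"
proof -
  have "\<exists>e\<in>R - {\<zero>\<^bsub>K\<^esub>}. \<forall>x\<in>S. e \<otimes>\<^bsub>K\<^esub> y x \<in> R" if "finite S" for S
    using that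
  proof (induction S rule: finite_induct)
    case empty
    then show ?case using R_facts(3) by (intro bexI[of _ "\<one>\<^bsub>K\<^esub>"]) auto
  next
    case (insert s S)
    then obtain e where e: "e \<in> R" "e \<noteq> \<zero>\<^bsub>K\<^esub>" "\<forall>x\<in>S. e \<otimes>\<^bsub>K\<^esub> y x \<in> R" by auto
    obtain a b where ab: "a \<in> R" "b \<in> R" "b \<noteq> \<zero>\<^bsub>K\<^esub>" "y s = a \<otimes>\<^bsub>K\<^esub> inv\<^bsub>K\<^esub> b"
      using fractions[OF coeff_closed[OF y, of s]] by auto
    have c: "e \<in> carrier K" "a \<in> carrier K" "b \<in> carrier K" "b \<in> Units K" "inv\<^bsub>K\<^esub> b \<in> carrier K"
      using e ab R_in_K K.field_Units by auto
    have "e \<otimes>\<^bsub>K\<^esub> b \<otimes>\<^bsub>K\<^esub> y s = e \<otimes>\<^bsub>K\<^esub> a \<otimes>\<^bsub>K\<^esub> (b \<otimes>\<^bsub>K\<^esub> inv\<^bsub>K\<^esub> b)"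
      unfolding ab(4) using c by (simp only: K.m_ac K.m_closed)
    then have "e \<otimes>\<^bsub>K\<^esub> b \<otimes>\<^bsub>K\<^esub> y s \<in> R" using c e ab R_facts(6) by simp
    moreover have "e \<otimes>\<^bsub>K\<^esub> b \<otimes>\<^bsub>K\<^esub> y x \<in> R" if "x \<in> S" for x
    proof -
      have "e \<otimes>\<^bsub>K\<^esub> b \<otimes>\<^bsub>K\<^esub> y x = b \<otimes>\<^bsub>K\<^esub> (e \<otimes>\<^bsub>K\<^esub> y x)"
        using c coeff_closed[OF y] by (simp only: K.m_ac K.m_closed)
      then show ?thesis using e ab that R_facts(6) by simp
    qed
    moreover have "e \<otimes>\<^bsub>K\<^esub> b \<in> R - {\<zero>\<^bsub>K\<^esub>}" using e ab c R_facts(6) K.integral_iff by auto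
    ultimately show ?case by (intro bexI[of _ "e \<otimes>\<^bsub>K\<^esub> b"]) auto
  qed
  from this[OF finite_G] obtain e where "e \<in> R - {\<zero>\<^bsub>K\<^esub>}" "\<forall>x\<in>carrier G. e \<otimes>\<^bsub>K\<^esub> y x \<in> R" by blast
  then show ?thesis
    using outside[OF y] R_in_K by (intro bexI[of _ e]) (auto simp: RG_carrier)
qed

lemma smult_cancel:
  assumes "k \<in> carrier K" "k \<noteq> \<zero>\<^bsub>K\<^esub>" "a \<in> carrier KG" "b \<in> carrier KG" "k \<odot>\<^bsub>KG\<^esub> a = k \<odot>\<^bsub>KG\<^esub> b"
  shows "a = b"
proof
  fix x
  have "k \<otimes>\<^bsub>K\<^esub> a x = k \<otimes>\<^bsub>K\<^esub> b x" using fun_cong[OF assms(5), of x] by simp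
  then show "a x = b x" using K.m_lcancel assms coeff_closed by blast
qed

text \<open>The congruences for all right translates of \<open>a\<close> say that a set of elements stable under
  conjugation is contained in the subgroup of \<open>p\<close> with \<open>a x \<equiv> a (x p)\<close>; so they extend to normal
  closures.\<close>

lemma trace_cond_translates_iff:
  assumes a: "a \<in> carrier KG" and P: "\<forall>i\<le>r. P i \<subseteq> carrier G"
  shows "(\<forall>g\<in>carrier G. trace_cond r m P (a \<otimes>\<^bsub>KG\<^esub> ge g)) \<longleftrightarrow> trace_cond r m (\<lambda>i. ncl G (P i)) a"
proof
  note ac = coeff_closed[OF a]
  assume t: "\<forall>g\<in>carrier G. trace_cond r m P (a \<otimes>\<^bsub>KG\<^esub> ge g)"
  have "a x \<in> Q (m r)" if "x \<in> carrier G" for x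
    using t[rule_format, OF G.one_closed] that mult_group_elem_apply[OF G.one_closed a that]
    by (auto simp: trace_cond_def)
  moreover have "a x \<ominus>\<^bsub>K\<^esub> a (x \<otimes>\<^bsub>G\<^esub> p) \<in> Q (m i)" if i: "i < r" and x: "x \<in> carrier G" and p: "p \<in> ncl G (P (Suc i))" for i x p
  proof -
    have Pi: "P (Suc i) \<subseteq> carrier G" using P i by auto
    \<comment> \<open>Quantifying over all conjugates makes \<open>N\<close> normal by construction;
      the congruence for \<open>p\<close> itself is recovered from \<open>g\<close> equal to the
      identity.\<close>
    define N where "N = {p \<in> carrier G. \<forall>g\<in>carrier G. \<forall>x\<in>carrier G.
      a x \<ominus>\<^bsub>K\<^esub> a (x \<otimes>\<^bsub>G\<^esub> (g \<otimes>\<^bsub>G\<^esub> p \<otimes>\<^bsub>G\<^esub> inv\<^bsub>G\<^esub> g)) \<in> Q (m i)}"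
    have "subgroup N G"
    proof (rule G.subgroupI)
      show "N \<subseteq> carrier G" by (auto simp: N_def)
      have "\<one>\<^bsub>G\<^esub> \<in> N" using ac Q_zero by (auto simp: N_def K.diff_self)
      then show "N \<noteq> {}" by blast
    next
      fix p assume p: "p \<in> N"
      then have pG: "p \<in> carrier G" by (simp add: N_def)
      have "a x \<ominus>\<^bsub>K\<^esub> a (x \<otimes>\<^bsub>G\<^esub> (g \<otimes>\<^bsub>G\<^esub> inv\<^bsub>G\<^esub> p \<otimes>\<^bsub>G\<^esub> inv\<^bsub>G\<^esub> g)) \<in> Q (m i)"
        if g: "g \<in> carrier G" and x: "x \<in> carrier G" for g x
      proof -
        \<comment> \<open>Taking this translate as the base point lets the congruence for
          \<open>p\<close> be read backwards, as one for its inverse.\<close>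
        let ?y = "x \<otimes>\<^bsub>G\<^esub> (g \<otimes>\<^bsub>G\<^esub> inv\<^bsub>G\<^esub> p \<otimes>\<^bsub>G\<^esub> inv\<^bsub>G\<^esub> g)"
        have "?y \<otimes>\<^bsub>G\<^esub> (g \<otimes>\<^bsub>G\<^esub> p \<otimes>\<^bsub>G\<^esub> inv\<^bsub>G\<^esub> g) = x"
          using g x pG by (simp add: G.m_assoc G.cancel_inv)
        moreover have "a ?y \<ominus>\<^bsub>K\<^esub> a (?y \<otimes>\<^bsub>G\<^esub> (g \<otimes>\<^bsub>G\<^esub> p \<otimes>\<^bsub>G\<^esub> inv\<^bsub>G\<^esub> g)) \<in> Q (m i)"
          using p g x pG by (simp add: N_def)
        ultimately have "\<ominus>\<^bsub>K\<^esub> (a ?y \<ominus>\<^bsub>K\<^esub> a x) \<in> Q (m i)" using Q_uminus by simp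
        then show ?thesis using ac by (simp add: K.minus_diff)
      qed
      then show "inv\<^bsub>G\<^esub> p \<in> N" using pG by (simp add: N_def)
    next
      fix p q assume pq: "p \<in> N" "q \<in> N"
      then have pG: "p \<in> carrier G" "q \<in> carrier G" by (auto simp: N_def)
      have "a x \<ominus>\<^bsub>K\<^esub> a (x \<otimes>\<^bsub>G\<^esub> (g \<otimes>\<^bsub>G\<^esub> (p \<otimes>\<^bsub>G\<^esub> q) \<otimes>\<^bsub>G\<^esub> inv\<^bsub>G\<^esub> g)) \<in> Q (m i)"
        if g: "g \<in> carrier G" and x: "x \<in> carrier G" for g x
      proof -
        \<comment> \<open>The congruence for \<open>p\<close> at \<open>x\<close> and the one for
          \<open>q\<close> at the translate \<open>?y\<close> telescope.\<close>
        let ?y = "x \<otimes>\<^bsub>G\<^esub> (g \<otimes>\<^bsub>G\<^esub> p \<otimes>\<^bsub>G\<^esub> inv\<^bsub>G\<^esub> g)"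
        let ?z = "x \<otimes>\<^bsub>G\<^esub> (g \<otimes>\<^bsub>G\<^esub> (p \<otimes>\<^bsub>G\<^esub> q) \<otimes>\<^bsub>G\<^esub> inv\<^bsub>G\<^esub> g)"
        have "?y \<otimes>\<^bsub>G\<^esub> (g \<otimes>\<^bsub>G\<^esub> q \<otimes>\<^bsub>G\<^esub> inv\<^bsub>G\<^esub> g) = ?z"
          using g x pG by (simp add: G.m_assoc G.cancel_inv)
        moreover have "a ?y \<ominus>\<^bsub>K\<^esub> a (?y \<otimes>\<^bsub>G\<^esub> (g \<otimes>\<^bsub>G\<^esub> q \<otimes>\<^bsub>G\<^esub> inv\<^bsub>G\<^esub> g)) \<in> Q (m i)"
          using pq g x pG by (simp add: N_def)
        moreover have "a x \<ominus>\<^bsub>K\<^esub> a ?y \<in> Q (m i)" using pq g x pG by (simp add: N_def)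
        ultimately have "(a x \<ominus>\<^bsub>K\<^esub> a ?y) \<oplus>\<^bsub>K\<^esub> (a ?y \<ominus>\<^bsub>K\<^esub> a ?z) \<in> Q (m i)" using Q_add by simp
        also have "(a x \<ominus>\<^bsub>K\<^esub> a ?y) \<oplus>\<^bsub>K\<^esub> (a ?y \<ominus>\<^bsub>K\<^esub> a ?z) = a x \<ominus>\<^bsub>K\<^esub> a ?z"
        proof -
          have "(a x \<ominus>\<^bsub>K\<^esub> a ?y) \<oplus>\<^bsub>K\<^esub> (a ?y \<ominus>\<^bsub>K\<^esub> a ?z) = (a ?y \<oplus>\<^bsub>K\<^esub> (a x \<ominus>\<^bsub>K\<^esub> a ?y)) \<ominus>\<^bsub>K\<^esub> a ?z"
            unfolding a_minus_def using ac by (simp only: K.a_ac K.a_closed K.a_inv_closed)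
          then show ?thesis using ac by (simp add: K.add_diff_cancel)
        qed
        finally show ?thesis .
      qed
      then show "p \<otimes>\<^bsub>G\<^esub> q \<in> N" using pG by (simp add: N_def)
    qed
    moreover have "h \<otimes>\<^bsub>G\<^esub> p \<otimes>\<^bsub>G\<^esub> inv\<^bsub>G\<^esub> h \<in> N" if h: "h \<in> carrier G" and p: "p \<in> N" for h p
    proof -
      have pG: "p \<in> carrier G" using p by (simp add: N_def)
      have "g \<otimes>\<^bsub>G\<^esub> (h \<otimes>\<^bsub>G\<^esub> p \<otimes>\<^bsub>G\<^esub> inv\<^bsub>G\<^esub> h) \<otimes>\<^bsub>G\<^esub> inv\<^bsub>G\<^esub> g = (g \<otimes>\<^bsub>G\<^esub> h) \<otimes>\<^bsub>G\<^esub> p \<otimes>\<^bsub>G\<^esub> inv\<^bsub>G\<^esub> (g \<otimes>\<^bsub>G\<^esub> h)"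
        if "g \<in> carrier G" for g
        using that h pG by (simp add: G.m_assoc G.inv_mult_group)
      then show ?thesis using h p pG by (simp add: N_def)
    qed
    ultimately have "N \<lhd> G" by (simp add: G.normal_inv_iff)
    moreover have "P (Suc i) \<subseteq> N"
    proof
      fix p assume p: "p \<in> P (Suc i)"
      then have pG: "p \<in> carrier G" using Pi by auto
      have "a x \<ominus>\<^bsub>K\<^esub> a (x \<otimes>\<^bsub>G\<^esub> (g \<otimes>\<^bsub>G\<^esub> p \<otimes>\<^bsub>G\<^esub> inv\<^bsub>G\<^esub> g)) \<in> Q (m i)"
        if g: "g \<in> carrier G" and x: "x \<in> carrier G" for g x
      proof -
        \<comment> \<open>A right translate by \<open>g\<close>, evaluated at \<open>x g\<close> and
          \<open>x g p\<close>, compares \<open>a\<close> at \<open>x\<close> with \<open>a\<close>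
          at \<open>x\<close> times the conjugate of \<open>p\<close>.\<close>
        have "(a \<otimes>\<^bsub>KG\<^esub> ge g) (x \<otimes>\<^bsub>G\<^esub> g) \<ominus>\<^bsub>K\<^esub> (a \<otimes>\<^bsub>KG\<^esub> ge g) (x \<otimes>\<^bsub>G\<^esub> g \<otimes>\<^bsub>G\<^esub> p) \<in> Q (m i)"
          using t g x p i by (simp add: trace_cond_def)
        moreover have "(a \<otimes>\<^bsub>KG\<^esub> ge g) (x \<otimes>\<^bsub>G\<^esub> g) = a x"
          using g x a by (simp add: mult_group_elem_apply G.m_assoc)
        moreover have "(a \<otimes>\<^bsub>KG\<^esub> ge g) (x \<otimes>\<^bsub>G\<^esub> g \<otimes>\<^bsub>G\<^esub> p) = a (x \<otimes>\<^bsub>G\<^esub> (g \<otimes>\<^bsub>G\<^esub> p \<otimes>\<^bsub>G\<^esub> inv\<^bsub>G\<^esub> g))"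
          using g x a pG by (simp add: mult_group_elem_apply G.m_assoc)
        ultimately show ?thesis by simp
      qed
      then show "p \<in> N" using pG by (simp add: N_def)
    qed
    ultimately have "p \<in> N" using p ncl_least by blast
    then have "a x \<ominus>\<^bsub>K\<^esub> a (x \<otimes>\<^bsub>G\<^esub> (\<one>\<^bsub>G\<^esub> \<otimes>\<^bsub>G\<^esub> p \<otimes>\<^bsub>G\<^esub> inv\<^bsub>G\<^esub> \<one>\<^bsub>G\<^esub>)) \<in> Q (m i)" and pG: "p \<in> carrier G"
      using x unfolding N_def by blast+
    then show ?thesis by simp
  qed
  ultimately show "trace_cond r m (\<lambda>i. ncl G (P i)) a" by (simp add: trace_cond_def)
next
  assume t: "trace_cond r m (\<lambda>i. ncl G (P i)) a"
  show "\<forall>g\<in>carrier G. trace_cond r m P (a \<otimes>\<^bsub>KG\<^esub> ge g)"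
  proof
    fix g assume g: "g \<in> carrier G"
    have "(a \<otimes>\<^bsub>KG\<^esub> ge g) x \<in> Q (m r)" if "x \<in> carrier G" for x
      using t g that a by (simp add: mult_group_elem_apply trace_cond_def)
    moreover have "(a \<otimes>\<^bsub>KG\<^esub> ge g) x \<ominus>\<^bsub>K\<^esub> (a \<otimes>\<^bsub>KG\<^esub> ge g) (x \<otimes>\<^bsub>G\<^esub> p) \<in> Q (m i)"
      if i: "i < r" and x: "x \<in> carrier G" and p: "p \<in> P (Suc i)" for i x p
    proof -
      have Pi: "P (Suc i) \<subseteq> carrier G" using P i by auto
      then have pG: "p \<in> carrier G" using p by auto
      \<comment> \<open>Passing from \<open>a\<close> to its right translate by \<open>g\<close>
        replaces \<open>p\<close> by a conjugate, which the normal closure contains.\<close>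
      have "g \<otimes>\<^bsub>G\<^esub> p \<otimes>\<^bsub>G\<^esub> inv\<^bsub>G\<^esub> g \<in> ncl G (P (Suc i))"
        using G.ncl_normal[OF Pi] ncl_superset[of "P (Suc i)" G] p g by (auto simp: G.normal_inv_iff)
      then have "a (x \<otimes>\<^bsub>G\<^esub> inv\<^bsub>G\<^esub> g) \<ominus>\<^bsub>K\<^esub> a (x \<otimes>\<^bsub>G\<^esub> inv\<^bsub>G\<^esub> g \<otimes>\<^bsub>G\<^esub> (g \<otimes>\<^bsub>G\<^esub> p \<otimes>\<^bsub>G\<^esub> inv\<^bsub>G\<^esub> g)) \<in> Q (m i)"
        using t i x g by (simp add: trace_cond_def)
      moreover have "x \<otimes>\<^bsub>G\<^esub> inv\<^bsub>G\<^esub> g \<otimes>\<^bsub>G\<^esub> (g \<otimes>\<^bsub>G\<^esub> p \<otimes>\<^bsub>G\<^esub> inv\<^bsub>G\<^esub> g) = x \<otimes>\<^bsub>G\<^esub> p \<otimes>\<^bsub>G\<^esub> inv\<^bsub>G\<^esub> g"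
        using x g pG by (simp add: G.m_assoc G.cancel_inv)
      ultimately show ?thesis using x g pG a by (simp add: mult_group_elem_apply)
    qed
    ultimately show "trace_cond r m P (a \<otimes>\<^bsub>KG\<^esub> ge g)" by (simp add: trace_cond_def)
  qed
qed

end

section \<open>Orders generated by traces\<close>

text \<open>The basis is the identity alone. The result is applied to the induced order once that is
  known to be the order of the induced lattice.\<close>

lemma (in ring) is_free_regular_module:
  assumes B: "subring B R"
  shows "is_free (R\<lparr>carrier := B\<rparr>) (regular_module R B)"
proof -
  let ?A = "R\<lparr>carrier := B\<rparr>" and ?V = "regular_module R B"
  note sub = subringE[OF B]
  have V: "carrier ?V = B" "\<And>x y. x \<oplus>\<^bsub>?V\<^esub> y = x \<oplus> y" "\<zero>\<^bsub>?V\<^esub> = \<zero>" "\<And>x y. x \<odot>\<^bsub>?V\<^esub> y = x \<otimes> y"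
    by (simp_all add: regular_module_def)
  have BR: "x \<in> carrier R" if "x \<in> B" for x using that sub(1) by blast
  interpret A: ring ?A by (rule subring_is_ring[OF B])
  interpret V: abelian_group ?V
  proof (rule abelian_groupI, unfold V)
    fix x assume "x \<in> B"
    then show "\<exists>y\<in>B. y \<oplus> x = \<zero>" using sub(5) BR l_neg by blast
  qed (use sub BR in \<open>auto simp: a_ac\<close>)
  have lm: "left_module ?A ?V"
    by unfold_locales (use sub BR in \<open>auto simp: V l_distr r_distr m_assoc\<close>)
  have lin: "lin_comb ?A ?V c = c \<one>" if c: "c \<in> carrier (free_module ?A {\<one>})" for c
  proof -
    have c1: "c \<one> \<in> B" and c0: "\<And>i. i \<noteq> \<one> \<Longrightarrow> c i = \<zero>" using c by (auto simp: free_module_def)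
    \<comment> \<open>\<open>lin_comb\<close> sums over the support, so a zero coefficient at the
      identity leaves an empty sum.\<close>
    have "{b. c b \<noteq> \<zero>} = (if c \<one> = \<zero> then {} else {\<one>})"
      using c0 by (auto, metis)
    then show ?thesis
      using c1 BR V.finsum_insert[of "{}" \<one> "\<lambda>b. c b \<odot>\<^bsub>?V\<^esub> b"] V.finsum_empty sub(7)
      by (auto simp: lin_comb_def V V.r_zero[unfolded V])
  qed
  have "bij_betw (lin_comb ?A ?V) (carrier (free_module ?A {\<one>})) (carrier ?V)"
  proof (rule bij_betwI[where g = "\<lambda>b i. if i = \<one> then b else \<zero>"])
    show "lin_comb ?A ?V \<in> carrier (free_module ?A {\<one>}) \<rightarrow> carrier ?V"
      using lin by (auto simp: V free_module_def)
    show g: "(\<lambda>b i. if i = \<one> then b else \<zero>) \<in> carrier ?V \<rightarrow> carrier (free_module ?A {\<one>})"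
      using sub(2) by (auto simp: V free_module_def)
    show "(\<lambda>i. if i = \<one> then lin_comb ?A ?V c else \<zero>) = c" if "c \<in> carrier (free_module ?A {\<one>})" for c
      using that lin[OF that] by (auto simp: free_module_def)
    show "lin_comb ?A ?V (\<lambda>i. if i = \<one> then b else \<zero>) = b" if "b \<in> carrier ?V" for b
      using lin[OF funcset_mem[OF g that]] by simp
  qed
  then have "module_basis ?A ?V {\<one>}" using sub(3) by (simp add: module_basis_def V)
  then show ?thesis using lm unfolding is_free_def by blast
qed

text \<open>Exponents occur twice: as integers \<open>n\<close> in \<open>trace_sum\<close> and as
  naturals \<open>m\<close> for the ideals \<open>Q (m i)\<close>, with \<open>n_eq\<close> linking
  the two.\<close>

locale trace_lattice = induced_lattice K G R \<pi> H M v
  for K :: "('k, 'c) ring_scheme" and G :: "('g, 'd) monoid_scheme" and R \<pi> H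
    and M :: "('g \<Rightarrow> 'k, 'm) module" and v +
  fixes r :: nat and n :: "nat \<Rightarrow> int" and P :: "nat \<Rightarrow> 'g set" and m :: "nat \<Rightarrow> nat"
  assumes n_eq: "\<forall>i\<le>r. n i = int (m i)"
    and m_less: "\<forall>i<r. m i < m (Suc i)"
    and P_0: "P 0 = {\<one>\<^bsub>G\<^esub>}"
    and P_Suc: "\<forall>i<r. P i \<subseteq> P (Suc i)"
    and P_r: "P r \<subseteq> H"
    and P_subgroup: "\<forall>i\<le>r. subgroup (P i) G"
    and order_eq: "order_of_lattice K R G H M = trace_sum K R GH \<pi> r n P"
begin

abbreviation "order_H \<equiv> order_of_lattice K R G H M"

abbreviation "order_G \<equiv> order_of_Ind K R G H M"

abbreviation "tsum \<equiv> trace_sum K R G \<pi> r n P"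

lemma P_mono: "i \<le> j \<Longrightarrow> j \<le> r \<Longrightarrow> P i \<subseteq> P j"
proof (induction j rule: dec_induct)
  case (step j)
  then show ?case using P_Suc by (meson Suc_le_lessD order.trans less_imp_le)
qed simp

lemma m_mono: "i \<le> j \<Longrightarrow> j \<le> r \<Longrightarrow> m i \<le> m j"
proof (induction j rule: dec_induct)
  case (step j)
  then have "m i \<le> m j" "m j < m (Suc j)" using m_less by auto
  then show ?case by simp
qed simp

lemma P_subset_H: "i \<le> r \<Longrightarrow> P i \<subseteq> H"
  using P_mono[of i r] P_r by blast

lemma P_subset_G: "i \<le> r \<Longrightarrow> P i \<subseteq> carrier G"
  using P_subset_H H.subset by blast

lemma m_le: "\<forall>i<r. m i \<le> m (Suc i)"
  using m_less by (auto simp: less_imp_le)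

lemma tsum_iff: "f \<in> tsum \<longleftrightarrow> f \<in> carrier KG \<and> trace_cond r m P f"
  using P_subgroup P_0 P_Suc n_eq m_le by (rule trace_sum_iff)

lemma order_H_iff: "f \<in> order_H \<longleftrightarrow> f \<in> carrier KH \<and> HR.trace_cond r m P f"
proof -
  have "\<forall>i\<le>r. subgroup (P i) GH"
    using P_subgroup P_subset_H subgroup_H by (auto intro: G.subgroup_incl)
  moreover have "P 0 = {\<one>\<^bsub>GH\<^esub>}" using P_0 by simp
  ultimately show ?thesis unfolding order_eq using P_Suc n_eq m_le by (rule HR.trace_sum_iff)
qed

lemma indspan_order_H: "indspan order_H = tsum"
proof -
  have "y \<in> indspan order_H \<longleftrightarrow> y \<in> tsum" for y
    unfolding tsum_iff
    by (rule indspan_trace_cond[OF P_subgroup P_0 P_Suc _ order_H_iff]) (use P_subset_H in auto)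
  then show ?thesis by blast
qed

lemma RH_submodule_order_H: "RH_submodule order_H"
proof -
  note L = RH_submoduleD[OF RH_submodule_lat]
  have K: "a \<in> carrier KG" "\<And>l. l \<in> lat \<Longrightarrow> a \<star> l \<in> lat" if "a \<in> order_H" for a
    using that KH_subset unfolding order_of_lattice_eq by auto
  have lK: "l \<in> carrier KG" if "l \<in> lat" for l using KH_subset[OF L(1)[OF that]] .
  have "subgroup order_H (add_monoid KG)"
  proof (rule KG.add.subgroupI)
    show "order_H \<subseteq> carrier KG" using K(1) by blast
    have "\<one>\<^bsub>KG\<^esub> \<in> order_H"
      using KG.l_one[OF lK] HR.KG.one_closed unfolding order_of_lattice_eq by simp
    then show "order_H \<noteq> {}" by blast
  next
    fix a assume a: "a \<in> order_H"
    then have "a \<in> carrier KH" by (simp add: order_of_lattice_eq)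
    then have "\<ominus>\<^bsub>KH\<^esub> a \<in> carrier KH" by (rule HR.KG.a_inv_closed)
    moreover have "\<ominus>\<^bsub>KH\<^esub> a = \<ominus>\<^bsub>KG\<^esub> a"
      using HR.uminus_apply[OF \<open>a \<in> carrier KH\<close>] uminus_apply[OF K(1)[OF a]] by auto
    moreover have "(\<ominus>\<^bsub>KG\<^esub> a) \<star> l \<in> lat" if l: "l \<in> lat" for l
      using KG.l_minus[OF K(1)[OF a] lK[OF l]] L(4)[OF K(2)[OF a l]] by simp
    ultimately show "\<ominus>\<^bsub>KG\<^esub> a \<in> order_H" unfolding order_of_lattice_eq by simp
  next
    fix a b assume ab: "a \<in> order_H" "b \<in> order_H"
    then have "a \<in> carrier KH" "b \<in> carrier KH" by (simp_all add: order_of_lattice_eq)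
    then have "a \<oplus>\<^bsub>KG\<^esub> b \<in> carrier KH" using HR.KG.a_closed by simp
    moreover have "(a \<oplus>\<^bsub>KG\<^esub> b) \<star> l \<in> lat" if l: "l \<in> lat" for l
      unfolding KG.l_distr[OF K(1)[OF ab(1)] K(1)[OF ab(2)] lK[OF l]]
      using K(2)[OF ab(1) l] K(2)[OF ab(2) l] by (rule L(3))
    ultimately show "a \<oplus>\<^bsub>KG\<^esub> b \<in> order_H" unfolding order_of_lattice_eq by blast
  qed
  moreover have "x \<star> a \<in> order_H" if x: "x \<in> carrier RH" and a: "a \<in> order_H" for x a
  proof -
    have aH: "a \<in> carrier KH" using a by (simp add: order_of_lattice_eq)
    have xH: "x \<in> carrier KH" by (rule HR.RG_subset[OF x])
    have "(x \<star> a) \<star> l \<in> lat" if l: "l \<in> lat" for l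
      unfolding KG.m_assoc[OF KH_subset[OF xH] KH_subset[OF aH] lK[OF l]]
      using x K(2)[OF a l] by (rule L(5))
    then show ?thesis using KH_mult_closed[OF xH aH] unfolding order_of_lattice_eq by blast
  qed
  ultimately show ?thesis unfolding RH_submodule_def by (auto simp: order_of_lattice_eq)
qed

lemma Ind_subset_order_H: "Ind_subset K R G H order_H = tsum"
  using Ind_subset_eq_indspan[OF RH_submodule_order_H] indspan_order_H by simp

text \<open>\<open>order_indspan_iff\<close> expresses the order of the induced lattice through
  right translates lying in the induced order of \<open>H\<close>, and that set is already known to
  be \<open>tsum\<close>.\<close>

lemma order_G_iff: "a \<in> order_G \<longleftrightarrow> a \<in> carrier KG \<and> (\<forall>g\<in>carrier G. a \<star> ge g \<in> tsum)"
  using order_indspan_iff[OF RH_submodule_lat, of a]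
  unfolding order_of_Ind_eq indspan_order_H[symmetric] order_of_lattice_eq by blast

lemma order_G_iff_ncl: "a \<in> order_G \<longleftrightarrow> a \<in> carrier KG \<and> trace_cond r m (\<lambda>i. ncl G (P i)) a"
proof -
  have "\<forall>i\<le>r. P i \<subseteq> carrier G" using P_subset_G by blast
  then show ?thesis
    unfolding order_G_iff tsum_iff
    using trace_cond_translates_iff[of a r P m] KG.m_closed[OF _ group_elem_closed] by blast
qed

lemma order_G_eq: "order_G = trace_sum K R G \<pi> r n (\<lambda>i. ncl G (P i))"
proof -
  have "f \<in> trace_sum K R G \<pi> r n (\<lambda>i. ncl G (P i)) \<longleftrightarrow> f \<in> carrier KG \<and> trace_cond r m (\<lambda>i. ncl G (P i)) f" for f
  proof (rule trace_sum_iff[OF _ _ _ n_eq m_le])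
    show "\<forall>i\<le>r. subgroup (ncl G (P i)) G"
      using G.ncl_normal[OF P_subset_G] by (auto simp: G.normal_inv_iff)
    have "{\<one>\<^bsub>G\<^esub>} \<lhd> G" by (rule G.one_is_normal)
    then show "ncl G (P 0) = {\<one>\<^bsub>G\<^esub>}" unfolding P_0 by (rule ncl_eq)
    show "\<forall>i<r. ncl G (P i) \<subseteq> ncl G (P (Suc i))" using P_Suc ncl_mono by blast
  qed
  then show ?thesis using order_G_iff_ncl by blast
qed

lemma subring_order_G: "subring order_G KG"
proof (rule KG.subringI)
  note S = subgroup_indspan[OF RH_submodule_lat]
  have K: "a \<in> carrier KG" "\<And>y. y \<in> indspan lat \<Longrightarrow> a \<star> y \<in> indspan lat" if "a \<in> order_G" for a
    using that unfolding order_of_Ind_eq by auto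
  note yK = indspan_closed[of _ lat]
  show "order_G \<subseteq> carrier KG" using K(1) by blast
  show "\<one>\<^bsub>KG\<^esub> \<in> order_G"
    unfolding order_of_Ind_eq using KG.l_one[OF yK] KG.one_closed by simp
  fix a assume a: "a \<in> order_G"
  have "(\<ominus>\<^bsub>KG\<^esub> a) \<star> y \<in> indspan lat" if y: "y \<in> indspan lat" for y
    unfolding KG.l_minus[OF K(1)[OF a] yK[OF y]]
    using subgroup.m_inv_closed[OF S K(2)[OF a y]] by (simp add: a_inv_def)
  then show "\<ominus>\<^bsub>KG\<^esub> a \<in> order_G"
    unfolding order_of_Ind_eq using KG.a_inv_closed[OF K(1)[OF a]] by blast
  fix b assume b: "b \<in> order_G"
  have "(a \<star> b) \<star> y \<in> indspan lat" if y: "y \<in> indspan lat" for y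
    unfolding KG.m_assoc[OF K(1)[OF a] K(1)[OF b] yK[OF y]] using K(2)[OF a K(2)[OF b y]] .
  then show "a \<star> b \<in> order_G"
    unfolding order_of_Ind_eq using KG.m_closed[OF K(1)[OF a] K(1)[OF b]] by blast
  have "(a \<oplus>\<^bsub>KG\<^esub> b) \<star> y \<in> indspan lat" if y: "y \<in> indspan lat" for y
    unfolding KG.l_distr[OF K(1)[OF a] K(1)[OF b] yK[OF y]]
    using subgroup.m_closed[OF S K(2)[OF a y] K(2)[OF b y]] by simp
  then show "a \<oplus>\<^bsub>KG\<^esub> b \<in> order_G"
    unfolding order_of_Ind_eq using KG.a_closed[OF K(1)[OF a] K(1)[OF b]] by blast
qed

lemma order_G_eq_tsum:
  assumes "\<forall>i\<le>r. P i \<lhd> G"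
  shows "order_G = tsum"
proof -
  have "ncl G (P (Suc i)) = P (Suc i)" if "i < r" for i using assms that by (intro ncl_eq) auto
  then have "trace_cond r m (\<lambda>i. ncl G (P i)) f \<longleftrightarrow> trace_cond r m P f" for f
    unfolding trace_cond_def by auto
  then show ?thesis using order_G_iff_ncl tsum_iff by blast
qed

text \<open>The generator of the summand of index \<open>i\<close>, a negative power of
  \<open>\<pi>\<close> times a trace, written out as a function because its values at single points
  are what is compared.\<close>

definition scaled_trace :: "nat \<Rightarrow> 'g \<Rightarrow> 'k" where
  "scaled_trace i = (\<lambda>x. if x \<in> P i then inv\<^bsub>K\<^esub> (\<pi> [^]\<^bsub>K\<^esub> m i) else \<zero>\<^bsub>K\<^esub>)"

lemma scaled_trace_in_Q: "scaled_trace i x \<in> Q (m i)"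
  unfolding scaled_trace_def using inv_pi_pow_mult_in_Q[OF R_facts(3), of "m i"] pi_pow_Units[of "m i"] Q_zero by simp

lemma scaled_trace_KH: "i \<le> r \<Longrightarrow> scaled_trace i \<in> carrier KH"
  using P_subset_H[of i] Q_closed[OF scaled_trace_in_Q[of i]] unfolding KH_carrier by (auto simp: scaled_trace_def)

text \<open>For indices below \<open>i\<close> the subgroup in the congruence is contained in
  \<open>P i\<close>, under which the function is invariant; from \<open>i\<close> on, its values
  already lie in the ideal of the congruence.\<close>

lemma trace_cond_scaled_trace:
  assumes i: "i \<le> r"
  shows "trace_cond r m P (scaled_trace i)"
  unfolding trace_cond_def
proof (intro conjI ballI allI impI)
  fix x assume x: "x \<in> carrier G"
  show "scaled_trace i x \<in> Q (m r)" using Q_mono[OF m_mono[OF i order.refl] scaled_trace_in_Q] .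
  fix j p assume j: "j < r" and p: "p \<in> P (Suc j)"
  show "scaled_trace i x \<ominus>\<^bsub>K\<^esub> scaled_trace i (x \<otimes>\<^bsub>G\<^esub> p) \<in> Q (m j)"
  proof (cases "Suc j \<le> i")
    case True
    interpret Pi: subgroup "P i" G using P_subgroup i by blast
    have pi: "p \<in> P i" using P_mono[OF True i] p by blast
    have "x \<otimes>\<^bsub>G\<^esub> p \<in> P i \<longleftrightarrow> x \<in> P i"
    proof
      assume "x \<otimes>\<^bsub>G\<^esub> p \<in> P i"
      then have "x \<otimes>\<^bsub>G\<^esub> p \<otimes>\<^bsub>G\<^esub> inv\<^bsub>G\<^esub> p \<in> P i" using Pi.m_inv_closed[OF pi] by (rule Pi.m_closed)
      then show "x \<in> P i" using x Pi.mem_carrier[OF pi] by (simp add: G.m_assoc)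
    qed (use pi Pi.m_closed in auto)
    then have "scaled_trace i (x \<otimes>\<^bsub>G\<^esub> p) = scaled_trace i x" by (simp add: scaled_trace_def)
    then show ?thesis using Q_zero Q_closed[OF scaled_trace_in_Q] by (simp add: K.diff_self)
  next
    case False
    then have "m i \<le> m j" using j by (intro m_mono) auto
    then show ?thesis by (intro Q_minus Q_mono[OF _ scaled_trace_in_Q])
  qed
qed

lemma scaled_trace_order_H: "i \<le> r \<Longrightarrow> scaled_trace i \<in> order_H"
proof -
  assume i: "i \<le> r"
  have "HR.trace_cond r m P (scaled_trace i)"
    using trace_cond_scaled_trace[OF i] H.mem_carrier unfolding HR.trace_cond_def trace_cond_def by simp
  then show ?thesis using scaled_trace_KH[OF i] order_H_iff by blast
qed

text \<open>If a conjugate of \<open>p\<close> by \<open>g\<close> left \<open>P i\<close>, the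
  translate by \<open>g\<close> would take the value of exact order \<open>m i\<close> at
  \<open>g\<close> and zero at \<open>g p\<close>. The congruence of index \<open>i - 1\<close> puts
  the difference into a strictly smaller fractional ideal, a contradiction.\<close>

lemma normal_if_scaled_trace_translates:
  assumes i: "i \<le> r" and t: "\<And>g. g \<in> carrier G \<Longrightarrow> scaled_trace i \<star> ge g \<in> tsum"
  shows "P i \<lhd> G"
proof (cases i)
  case 0
  then show ?thesis using P_0 G.one_is_normal by simp
next
  case (Suc j)
  have sub: "subgroup (P i) G" using P_subgroup i by blast
  have wK: "scaled_trace i \<in> carrier KG" using scaled_trace_KH[OF i] KH_subset by blast
  have "g \<otimes>\<^bsub>G\<^esub> p \<otimes>\<^bsub>G\<^esub> inv\<^bsub>G\<^esub> g \<in> P i" if g: "g \<in> carrier G" and p: "p \<in> P i" for g p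
  proof (rule ccontr)
    assume no: "g \<otimes>\<^bsub>G\<^esub> p \<otimes>\<^bsub>G\<^esub> inv\<^bsub>G\<^esub> g \<notin> P i"
    have pG: "p \<in> carrier G" using p subgroup.mem_carrier[OF sub] by blast
    have "trace_cond r m P (scaled_trace i \<star> ge g)" using t[OF g] tsum_iff by blast
    then have "(scaled_trace i \<star> ge g) g \<ominus>\<^bsub>K\<^esub> (scaled_trace i \<star> ge g) (g \<otimes>\<^bsub>G\<^esub> p) \<in> Q (m j)"
      using g p Suc i unfolding trace_cond_def by simp
    moreover have "(scaled_trace i \<star> ge g) g = inv\<^bsub>K\<^esub> (\<pi> [^]\<^bsub>K\<^esub> m i)"
      using mult_group_elem_apply[OF g wK g] g subgroup.one_closed[OF sub] by (simp add: scaled_trace_def)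
    moreover have "(scaled_trace i \<star> ge g) (g \<otimes>\<^bsub>G\<^esub> p) = \<zero>\<^bsub>K\<^esub>"
      using mult_group_elem_apply[OF g wK, of "g \<otimes>\<^bsub>G\<^esub> p"] g pG no by (simp add: scaled_trace_def)
    ultimately have "inv\<^bsub>K\<^esub> (\<pi> [^]\<^bsub>K\<^esub> m i) \<in> Q (m j)"
      using pi_pow_Units[of "m i"] by (simp add: a_minus_def)
    moreover have "m j < m i" using m_less Suc i by auto
    ultimately show False using inv_pi_pow_not_in_Q by blast
  qed
  then show ?thesis using sub by (simp add: G.normal_inv_iff)
qed

lemma RG_subset_tsum: "f \<in> carrier RG \<Longrightarrow> f \<in> tsum"
  unfolding tsum_iff trace_cond_def using RG_subset RG_coeff R_subset_Q Q_minus by blast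

lemma RG_subset_order_G: "f \<in> carrier RG \<Longrightarrow> f \<in> order_G"
  unfolding order_G_iff using RG_subset RG_subset_tsum RG_mult_in ge_in_RG by blast

text \<open>A ring containing \<open>R[G]\<close> is closed under right multiplication by group
  elements, so translates of scaled traces stay in it and force normality. Conversely, under
  normality the set is the order of the induced lattice.\<close>

lemma subring_Ind_iff: "subring tsum KG \<longleftrightarrow> (\<forall>i\<le>r. P i \<lhd> G)"
proof
  assume S: "subring tsum KG"
  show "\<forall>i\<le>r. P i \<lhd> G"
  proof (intro allI impI)
    fix i assume i: "i \<le> r"
    have "scaled_trace i \<in> tsum" using trace_cond_scaled_trace[OF i] scaled_trace_KH[OF i] KH_subset tsum_iff by blast
    then have "scaled_trace i \<star> ge g \<in> tsum" if "g \<in> carrier G" for g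
      using subringE(6)[OF S] RG_subset_tsum[OF ge_in_RG[OF that]] by blast
    then show "P i \<lhd> G" using normal_if_scaled_trace_translates[OF i] by blast
  qed
qed (use order_G_eq_tsum subring_order_G in simp)

text \<open>For \<open>H\<close> normal the conjugates of \<open>P i\<close> lie in
  \<open>H\<close>, so \<open>x\<close> and \<open>x p\<close>, once translated back by
  \<open>g\<close>, lie in the same left coset of \<open>H\<close>. Restriction therefore keeps both
  values in a congruence or kills both.\<close>

lemma res_order_G:
  assumes H: "H \<lhd> G" and f: "f \<in> order_G"
  shows "res f \<in> order_G"
proof -
  have fK: "f \<in> carrier KG" and ft: "\<And>g. g \<in> carrier G \<Longrightarrow> trace_cond r m P (f \<star> ge g)"
    using f unfolding order_G_iff tsum_iff by auto
  have rK: "res f \<in> carrier KG" using KH_subset[OF res_closed[OF fK]] .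
  have "trace_cond r m P (res f \<star> ge g)" if g: "g \<in> carrier G" for g
    unfolding trace_cond_def
  proof (intro conjI ballI allI impI)
    fix x assume x: "x \<in> carrier G"
    have rx: "(res f \<star> ge g) x = (if x \<otimes>\<^bsub>G\<^esub> inv\<^bsub>G\<^esub> g \<in> H then (f \<star> ge g) x else \<zero>\<^bsub>K\<^esub>)"
      if "x \<in> carrier G" for x
      using mult_group_elem_apply[OF g rK that] mult_group_elem_apply[OF g fK that] by (simp add: res_def)
    show "(res f \<star> ge g) x \<in> Q (m r)"
      using rx[OF x] ft[OF g] x Q_zero by (simp add: trace_cond_def)
    fix i p assume i: "i < r" and p: "p \<in> P (Suc i)"
    have pH: "p \<in> H" "p \<in> carrier G" using p P_subset_H[of "Suc i"] P_subset_G[of "Suc i"] i by auto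
    have q: "g \<otimes>\<^bsub>G\<^esub> p \<otimes>\<^bsub>G\<^esub> inv\<^bsub>G\<^esub> g \<in> H" using H pH g by (simp add: G.normal_inv_iff)
    have eq: "x \<otimes>\<^bsub>G\<^esub> p \<otimes>\<^bsub>G\<^esub> inv\<^bsub>G\<^esub> g = (x \<otimes>\<^bsub>G\<^esub> inv\<^bsub>G\<^esub> g) \<otimes>\<^bsub>G\<^esub> (g \<otimes>\<^bsub>G\<^esub> p \<otimes>\<^bsub>G\<^esub> inv\<^bsub>G\<^esub> g)"
      using x g pH by (simp add: G.m_assoc G.cancel_inv)
    have mem: "x \<otimes>\<^bsub>G\<^esub> p \<otimes>\<^bsub>G\<^esub> inv\<^bsub>G\<^esub> g \<in> H \<longleftrightarrow> x \<otimes>\<^bsub>G\<^esub> inv\<^bsub>G\<^esub> g \<in> H"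
    proof
      assume "x \<otimes>\<^bsub>G\<^esub> p \<otimes>\<^bsub>G\<^esub> inv\<^bsub>G\<^esub> g \<in> H"
      then have "(x \<otimes>\<^bsub>G\<^esub> inv\<^bsub>G\<^esub> g) \<otimes>\<^bsub>G\<^esub> (g \<otimes>\<^bsub>G\<^esub> p \<otimes>\<^bsub>G\<^esub> inv\<^bsub>G\<^esub> g) \<otimes>\<^bsub>G\<^esub> inv\<^bsub>G\<^esub> (g \<otimes>\<^bsub>G\<^esub> p \<otimes>\<^bsub>G\<^esub> inv\<^bsub>G\<^esub> g) \<in> H"
        unfolding eq using H.m_inv_closed[OF q] by (rule H.m_closed)
      moreover have "(x \<otimes>\<^bsub>G\<^esub> inv\<^bsub>G\<^esub> g) \<otimes>\<^bsub>G\<^esub> (g \<otimes>\<^bsub>G\<^esub> p \<otimes>\<^bsub>G\<^esub> inv\<^bsub>G\<^esub> g) \<otimes>\<^bsub>G\<^esub> inv\<^bsub>G\<^esub> (g \<otimes>\<^bsub>G\<^esub> p \<otimes>\<^bsub>G\<^esub> inv\<^bsub>G\<^esub> g) = x \<otimes>\<^bsub>G\<^esub> inv\<^bsub>G\<^esub> g"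
        using x g H.mem_carrier[OF q] by (simp only: G.m_assoc G.r_inv G.r_one G.m_closed G.inv_closed)
      ultimately show "x \<otimes>\<^bsub>G\<^esub> inv\<^bsub>G\<^esub> g \<in> H" by simp
    next
      assume "x \<otimes>\<^bsub>G\<^esub> inv\<^bsub>G\<^esub> g \<in> H"
      then show "x \<otimes>\<^bsub>G\<^esub> p \<otimes>\<^bsub>G\<^esub> inv\<^bsub>G\<^esub> g \<in> H" unfolding eq using q by (rule H.m_closed)
    qed
    show "(res f \<star> ge g) x \<ominus>\<^bsub>K\<^esub> (res f \<star> ge g) (x \<otimes>\<^bsub>G\<^esub> p) \<in> Q (m i)"
      using rx[OF x] rx[OF G.m_closed[OF x pH(2)]] mem ft[OF g] x p i Q_zero
      by (auto simp: trace_cond_def K.diff_self)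
  qed
  then show ?thesis unfolding order_G_iff tsum_iff using rK KG.m_closed group_elem_closed by blast
qed

section \<open>Dual maps and the projective case\<close>

lemma const_eq: "k \<in> carrier K \<Longrightarrow> const k = k \<odot>\<^bsub>KG\<^esub> \<one>\<^bsub>KG\<^esub>"
  by (auto simp: const_def group_elem_def)

lemma const_mult_apply:
  assumes "k \<in> carrier K" "a \<in> carrier KG"
  shows "const k \<star> a = k \<odot>\<^bsub>KG\<^esub> a" "a \<star> const k = k \<odot>\<^bsub>KG\<^esub> a"
  unfolding const_eq[OF assms(1)] using scalar_mult[OF assms] by blast+

lemma const_KG: "k \<in> carrier K \<Longrightarrow> const k \<in> carrier KG"
  using const_KH KH_subset by blast

text \<open>A \<open>B\<close>-linear map \<open>\<sigma>\<close> into \<open>B\<close> from a full lattice in \<open>F[G]\<close> extends to \<open>F[G]\<close>, where it is right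
  multiplication by \<open>d\<inverse> \<sigma> d\<close>.\<close>

lemma dual_map_eq:
  assumes d: "d \<in> R" "d \<noteq> \<zero>\<^bsub>K\<^esub>" "const d \<in> indspan lat" and y: "y \<in> indspan lat"
    and \<sigma>: "\<And>y. y \<in> indspan lat \<Longrightarrow> \<sigma> y \<in> order_G"
    and lin: "\<And>b y. b \<in> order_G \<Longrightarrow> y \<in> indspan lat \<Longrightarrow> \<sigma> (b \<star> y) = b \<star> \<sigma> y"
  shows "const d \<star> \<sigma> y = y \<star> \<sigma> (const d)"
proof -
  note oK = subsetD[OF subringE(1)[OF subring_order_G]]
  have yK: "y \<in> carrier KG" by (rule indspan_closed[OF y])
  have dK: "d \<in> carrier K" using R_in_K[OF d(1)] .
  \<comment> \<open>Linearity of \<open>\<sigma>\<close> is over \<open>order_G\<close>, which need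
    not contain \<open>y\<close>; a nonzero multiple with coefficients in \<open>R\<close> does lie
    in it.\<close>
  obtain e where e: "e \<in> R" "e \<noteq> \<zero>\<^bsub>K\<^esub>" "e \<odot>\<^bsub>KG\<^esub> y \<in> carrier RG"
    using common_denominator[OF fractions yK] by auto
  have eK: "e \<in> carrier K" using R_in_K[OF e(1)] .
  have c: "const e \<in> carrier KG" "const d \<in> carrier KG" "\<sigma> y \<in> carrier KG" "\<sigma> (const d) \<in> carrier KG"
    using const_KG eK dK oK[OF \<sigma>[OF y]] oK[OF \<sigma>[OF d(3)]] by auto
  have ey: "const e \<star> y \<in> order_G"
    unfolding const_mult_apply(1)[OF eK yK] by (rule RG_subset_order_G[OF e(3)])
  have "const d \<in> order_G" "const e \<in> order_G"
    using RG_subset_order_G RH_subset_RG const_RH d(1) e(1) by blast+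
  then have ed: "const e \<star> const d \<in> order_G" using subringE(6)[OF subring_order_G] by blast
  have comm: "(const e \<star> y) \<star> const d = (const e \<star> const d) \<star> y"
  proof -
    have "y \<star> const d = const d \<star> y" using const_mult_apply[OF dK yK] by simp
    then show ?thesis using KG.m_assoc[OF c(1) yK c(2)] KG.m_assoc[OF c(1,2) yK] by simp
  qed
  \<comment> \<open>The product of \<open>e\<close>, \<open>y\<close> and \<open>d\<close> is read
    both as \<open>e y\<close> acting on \<open>d\<close> and as \<open>e d\<close> acting on
    \<open>y\<close>. Comparing the two values of \<open>\<sigma>\<close> and cancelling
    \<open>e\<close> gives the claim.\<close>
  have "const e \<star> (y \<star> \<sigma> (const d)) = (const e \<star> y) \<star> \<sigma> (const d)"
    using KG.m_assoc[OF c(1) yK c(4)] by simp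
  also have "\<dots> = \<sigma> ((const e \<star> y) \<star> const d)" using lin[OF ey d(3)] by simp
  also have "\<dots> = (const e \<star> const d) \<star> \<sigma> y" unfolding comm by (rule lin[OF ed y])
  also have "\<dots> = const e \<star> (const d \<star> \<sigma> y)" by (rule KG.m_assoc[OF c(1,2,3)])
  finally have "e \<odot>\<^bsub>KG\<^esub> (y \<star> \<sigma> (const d)) = e \<odot>\<^bsub>KG\<^esub> (const d \<star> \<sigma> y)"
    unfolding const_mult_apply(1)[OF eK KG.m_closed[OF yK c(4)]] const_mult_apply(1)[OF eK KG.m_closed[OF c(2,3)]] .
  then show ?thesis
    using smult_cancel[OF eK e(2) KG.m_closed[OF yK c(4)] KG.m_closed[OF c(2,3)]] by simp
qed

text \<open>The dual basis \<open>(\<sigma>\<^sub>j, \<mu>\<^sub>j)\<close> expresses a scalar \<open>d\<close> as \<open>\<Sum> \<sigma>\<^sub>j(d) \<mu>\<^sub>j\<close>. Splitting \<open>\<mu>\<^sub>j\<close> along cosets of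
  \<open>H\<close> and using commutativity of \<open>F[H]\<close>, multiplication by \<open>a\<close> can be moved inside \<open>\<sigma>\<^sub>j\<close>, which
  exhibits \<open>a\<close> as a sum of elements of the order of the induced lattice.\<close>

lemma order_H_subset_order_G:
  assumes comm: "comm_group GH" and H: "H \<lhd> G"
    and d: "d \<in> R" "d \<noteq> \<zero>\<^bsub>K\<^esub>" "const d \<in> lat"
    and \<sigma>: "\<And>j y. y \<in> indspan lat \<Longrightarrow> \<sigma> j y \<in> order_G"
    and lin: "\<And>j b y. b \<in> order_G \<Longrightarrow> y \<in> indspan lat \<Longrightarrow> \<sigma> j (b \<star> y) = b \<star> \<sigma> j y"
    and \<mu>: "\<And>j. j \<in> J \<Longrightarrow> \<mu> j \<in> indspan lat"
    and dual: "const d = (\<Oplus>\<^bsub>KG\<^esub>j\<in>J. \<sigma> j (const d) \<star> \<mu> j)"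
  shows "order_H \<subseteq> order_G"
proof
  fix a assume a: "a \<in> order_H"
  note L = RH_submoduleD[OF RH_submodule_lat]
  note oG = subringE[OF subring_order_G]
  note oK = subsetD[OF oG(1)]
  have aH: "a \<in> carrier KH" and al: "\<And>l. l \<in> lat \<Longrightarrow> a \<star> l \<in> lat"
    using a unfolding order_of_lattice_eq by auto
  have aK: "a \<in> carrier KG" by (rule KH_subset[OF aH])
  have dK: "d \<in> carrier K" by (rule R_in_K[OF d(1)])
  have cK: "const d \<in> carrier KG" by (rule const_KG[OF dK])
  have lat_ind: "l \<in> indspan lat" if "l \<in> lat" for l
    using mult_in_indspan[OF RH_submodule_lat ge_in_RG[OF G.one_closed] that]
      KG.l_one[OF KH_subset[OF L(1)[OF that]]] by simp
  note dI = lat_ind[OF d(3)]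
  \<comment> \<open>\<open>Z\<close> collects the \<open>z\<close> for which \<open>a\<close> times
    the restriction of \<open>z\<close> is divisible by \<open>d\<close> within the order. It is an
    additive subgroup, so it can be tested on the terms of the dual basis expansion; once the scalar
    \<open>d\<close> is in \<open>Z\<close>, cancelling it exhibits \<open>a\<close> as an element
    of the order.\<close>
  define Z where "Z = {z \<in> carrier KG. \<exists>w\<in>order_G. a \<star> res z = const d \<star> w}"
  have rK: "res z \<in> carrier KG" if "z \<in> carrier KG" for z using KH_subset[OF res_closed[OF that]] .
  have Z: "subgroup Z (add_monoid KG)"
  proof (rule KG.add.subgroupI)
    show "Z \<subseteq> carrier KG" by (auto simp: Z_def)
    have "a \<star> res \<zero>\<^bsub>KG\<^esub> = const d \<star> \<zero>\<^bsub>KG\<^esub>"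
      unfolding res_zero KG.r_null[OF aK] KG.r_null[OF cK] ..
    then have "\<zero>\<^bsub>KG\<^esub> \<in> Z" unfolding Z_def using oG(2) KG.zero_closed by blast
    then show "Z \<noteq> {}" by blast
  next
    fix z assume "z \<in> Z"
    then obtain w where z: "z \<in> carrier KG" "w \<in> order_G" "a \<star> res z = const d \<star> w"
      unfolding Z_def by blast
    have "a \<star> res (\<ominus>\<^bsub>KG\<^esub> z) = const d \<star> \<ominus>\<^bsub>KG\<^esub> w"
      unfolding res_uminus[OF z(1)] KG.r_minus[OF aK rK[OF z(1)]] KG.r_minus[OF cK oK[OF z(2)]] z(3) ..
    then show "\<ominus>\<^bsub>KG\<^esub> z \<in> Z" unfolding Z_def using oG(5)[OF z(2)] KG.a_inv_closed[OF z(1)] by blast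
  next
    fix y z assume "y \<in> Z" "z \<in> Z"
    then obtain v w where y: "y \<in> carrier KG" "v \<in> order_G" "a \<star> res y = const d \<star> v"
      and z: "z \<in> carrier KG" "w \<in> order_G" "a \<star> res z = const d \<star> w"
      unfolding Z_def by blast
    have "a \<star> res (y \<oplus>\<^bsub>KG\<^esub> z) = const d \<star> (v \<oplus>\<^bsub>KG\<^esub> w)"
      unfolding res_add KG.r_distr[OF rK[OF y(1)] rK[OF z(1)] aK] KG.r_distr[OF oK[OF y(2)] oK[OF z(2)] cK] y(3) z(3) ..
    then show "y \<oplus>\<^bsub>KG\<^esub> z \<in> Z" unfolding Z_def using oG(7)[OF y(2) z(2)] KG.a_closed[OF y(1) z(1)] by blast
  qed
  have commH: "f \<star> g = g \<star> f" if "f \<in> carrier KH" "g \<in> carrier KH" for f g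
    using HR.mult_comm[OF comm that] KH_mult[OF that] KH_mult[OF that(2,1)] by simp
  have gen: "\<sigma> j (const d) \<star> (ge t \<star> l) \<in> Z" if t: "t \<in> carrier G" and l: "l \<in> lat" for j t l
  proof -
    let ?s = "\<sigma> j (const d)" and ?y = "a \<star> l"
    have lH: "l \<in> carrier KH" by (rule L(1)[OF l])
    have lK: "l \<in> carrier KG" by (rule KH_subset[OF lH])
    have sK: "?s \<in> carrier KG" by (rule oK[OF \<sigma>[OF dI]])
    have tK: "ge t \<in> carrier KG" by (rule group_elem_closed[OF t])
    have stK: "?s \<star> ge t \<in> carrier KG" using sK tK by (rule KG.m_closed)
    have yl: "?y \<in> lat" by (rule al[OF l])
    have yH: "?y \<in> carrier KH" by (rule L(1)[OF yl])
    have yK: "?y \<in> carrier KG" by (rule KH_subset[OF yH])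
    have syo: "\<sigma> j ?y \<in> order_G" by (rule \<sigma>[OF lat_ind[OF yl]])
    have sytK: "\<sigma> j ?y \<star> ge t \<in> carrier KG" using oK[OF syo] tK by (rule KG.m_closed)
    have rH: "res (?s \<star> ge t) \<in> carrier KH" by (rule res_closed[OF stK])
    have "res (?s \<star> (ge t \<star> l)) = res (?s \<star> ge t) \<star> l"
      unfolding KG.m_assoc[OF sK tK lK, symmetric] by (rule res_mult_right[OF stK lH])
    \<comment> \<open>Both factors lie in \<open>F[H]\<close>. Commuting them brings
      \<open>l\<close> next to \<open>a\<close>, and \<open>a l\<close> is again in the lattice
      because \<open>a\<close> belongs to its order.\<close>
    also have "\<dots> = l \<star> res (?s \<star> ge t)" by (rule commH[OF rH lH])
    finally have "a \<star> res (?s \<star> (ge t \<star> l)) = ?y \<star> res (?s \<star> ge t)"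
      using KG.m_assoc[OF aK lK KH_subset[OF rH]] by simp
    also have "\<dots> = res (?y \<star> (?s \<star> ge t))" by (rule res_mult_left[OF stK yH, symmetric])
    also have "?y \<star> (?s \<star> ge t) = (?y \<star> ?s) \<star> ge t" by (rule KG.m_assoc[OF yK sK tK, symmetric])
    \<comment> \<open>\<open>?y\<close> is a lattice element, so multiplying it by the value of the
      dual map at \<open>d\<close> gives \<open>d\<close> times the value at \<open>?y\<close>, and
      the latter value belongs to the order.\<close>
    also have "?y \<star> ?s = const d \<star> \<sigma> j ?y"
      using dual_map_eq[OF d(1,2) dI lat_ind[OF yl], of "\<sigma> j"] \<sigma> lin by simp
    also have "(const d \<star> \<sigma> j ?y) \<star> ge t = const d \<star> (\<sigma> j ?y \<star> ge t)"
      by (rule KG.m_assoc[OF cK oK[OF syo] tK])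
    also have "res \<dots> = const d \<star> res (\<sigma> j ?y \<star> ge t)"
      by (rule res_mult_left[OF sytK const_KH[OF dK]])
    finally have "a \<star> res (?s \<star> (ge t \<star> l)) = const d \<star> res (\<sigma> j ?y \<star> ge t)" .
    moreover have "res (\<sigma> j ?y \<star> ge t) \<in> order_G"
      by (rule res_order_G[OF H oG(6)[OF syo RG_subset_order_G[OF ge_in_RG[OF t]]]])
    ultimately show ?thesis unfolding Z_def using KG.m_closed[OF sK KG.m_closed[OF tK lK]] by blast
  qed
  have "\<sigma> j (const d) \<star> \<mu> j \<in> Z" if j: "j \<in> J" for j
  proof -
    obtain T where T: "finite T" "T \<subseteq> carrier G"
      "\<And>y. y \<in> carrier KG \<Longrightarrow> y = (\<Oplus>\<^bsub>KG\<^esub>t\<in>T. ge t \<star> res (ge (inv\<^bsub>G\<^esub> t) \<star> y))"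
      using coset_decomposition by blast
    let ?l = "\<lambda>t. res (ge (inv\<^bsub>G\<^esub> t) \<star> \<mu> j)"
    have l: "?l t \<in> lat" if "t \<in> T" for t using \<mu>[OF j] that T(2) by (auto simp: indspan_def)
    have tl: "ge t \<star> ?l t \<in> carrier KG" if "t \<in> T" for t
      using group_elem_closed[OF subsetD[OF T(2) that]] KH_subset[OF L(1)[OF l[OF that]]] by (rule KG.m_closed)
    have "\<sigma> j (const d) \<star> (\<Oplus>\<^bsub>KG\<^esub>t\<in>T. ge t \<star> ?l t) = (\<Oplus>\<^bsub>KG\<^esub>t\<in>T. \<sigma> j (const d) \<star> (ge t \<star> ?l t))"
      using T(1) oK[OF \<sigma>[OF dI]] tl by (intro KG.finsum_rdistr) auto
    also have "\<dots> \<in> Z"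
      using gen l T(2) by (intro KG.finsum_in_subgroup[OF Z]) auto
    finally show ?thesis unfolding T(3)[OF indspan_closed[OF \<mu>[OF j]], symmetric] .
  qed
  then have "(\<Oplus>\<^bsub>KG\<^esub>j\<in>J. \<sigma> j (const d) \<star> \<mu> j) \<in> Z"
    by (rule KG.finsum_in_subgroup[OF Z])
  then have "const d \<in> Z" unfolding dual[symmetric] .
  then obtain w where w: "w \<in> order_G" "a \<star> const d = const d \<star> w"
    unfolding Z_def using res_id[OF const_KH[OF dK]] by auto
  have "d \<odot>\<^bsub>KG\<^esub> a = d \<odot>\<^bsub>KG\<^esub> w"
    using w(2) const_mult_apply(2)[OF dK aK] const_mult_apply(1)[OF dK oK[OF w(1)]] by simp
  then have "a = w" by (rule smult_cancel[OF dK d(2) aK oK[OF w(1)]])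
  then show "a \<in> order_G" using w(1) by simp
qed

end

context trace_lattice
begin

text \<open>A retraction of a free module onto the lattice yields a dual basis: the coordinates of
  \<open>s\<close> are the dual maps, and the images of unit vectors under \<open>p\<close> are the
  lattice elements. Once \<open>order_H\<close> lies in \<open>order_G\<close>, all right translates
  of scaled traces lie in \<open>tsum\<close>, and normality follows.\<close>

lemma normal_if_projective:
  assumes comm: "comm_group GH" and H: "H \<lhd> G"
    and proj: "is_projective (KG\<lparr>carrier := order_G\<rparr>) (IndFM\<lparr>carrier := Ind_lattice K R G H M\<rparr>)"
  shows "\<forall>i\<le>r. P i \<lhd> G"
proof -
  let ?A = "KG\<lparr>carrier := order_G\<rparr>" and ?IL = "indspan lat"
  let ?V = "IndFM\<lparr>carrier := psi ` ?IL\<rparr>"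
  note oG = subringE[OF subring_order_G]
  note oK = subsetD[OF oG(1)]
  note yK = indspan_closed[of _ lat]
  have oIL: "b \<star> y \<in> ?IL" if "b \<in> order_G" "y \<in> ?IL" for b y
    using that unfolding order_of_Ind_eq by blast
  obtain I :: "((('g \<Rightarrow> 'k) \<times> (('k \<times> 'm) \<Rightarrow>\<^sub>0 int) set) \<Rightarrow>\<^sub>0 int) set set" and s p
    where s: "s \<in> left_module_hom ?A ?V (free_module ?A I)"
    and p: "p \<in> left_module_hom ?A (free_module ?A I) ?V"
    and ps: "\<And>x. x \<in> carrier ?V \<Longrightarrow> p (s x) = x"
    using proj unfolding is_projective_def Ind_lattice_eq by (elim conjE exE bexE) blast
  let ?F = "free_module ?A I"
  have Fr: "c \<in> carrier ?F \<longleftrightarrow> (\<forall>i. c i \<in> order_G) \<and> (\<forall>i. i \<notin> I \<longrightarrow> c i = \<zero>\<^bsub>KG\<^esub>) \<and> finite {i. c i \<noteq> \<zero>\<^bsub>KG\<^esub>}"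
    "c \<oplus>\<^bsub>?F\<^esub> c' = (\<lambda>i. c i \<oplus>\<^bsub>KG\<^esub> c' i)" "b \<odot>\<^bsub>?F\<^esub> c = (\<lambda>i. b \<star> c i)" for b c c'
    by (simp_all add: free_module_def)
  have s_cl: "s (psi y) \<in> carrier ?F" if "y \<in> ?IL" for y
    using s that unfolding left_module_hom_def hom_def by auto
  have s_lin: "s (psi (b \<star> y)) = b \<odot>\<^bsub>?F\<^esub> s (psi y)" if "b \<in> order_G" "y \<in> ?IL" for b y
    unfolding psi_smult[OF oK[OF that(1)] yK[OF that(2)], symmetric]
    using s that unfolding left_module_hom_def by auto
  have p_cl: "p c \<in> psi ` ?IL" if "c \<in> carrier ?F" for c
    using p that unfolding left_module_hom_def hom_def by auto
  have p_add: "p (c \<oplus>\<^bsub>?F\<^esub> c') = p c \<oplus>\<^bsub>IndFM\<^esub> p c'" if "c \<in> carrier ?F" "c' \<in> carrier ?F" for c c'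
    using p that unfolding left_module_hom_def hom_def by auto
  have p_lin: "p (b \<odot>\<^bsub>?F\<^esub> c) = b \<odot>\<^bsub>IndFM\<^esub> p c" if "b \<in> order_G" "c \<in> carrier ?F" for b c
    using p that unfolding left_module_hom_def by auto
  \<comment> \<open>The maps \<open>s\<close> and \<open>p\<close> live on classes
    \<open>psi y\<close>; \<open>q\<close> brings the values of \<open>p\<close> back to
    \<open>F[G]\<close>, where sums and products can be computed.\<close>
  define q where "q c = inv_into ?IL psi (p c)" for c
  have q: "q c \<in> ?IL" "psi (q c) = p c" if "c \<in> carrier ?F" for c
    unfolding q_def using p_cl[OF that] by (auto simp: inv_into_into f_inv_into_f)
  have qI: "q c = y" if "c \<in> carrier ?F" "p c = psi y" "y \<in> carrier KG" for c y
    using psi_inj[OF yK[OF q(1)[OF that(1)]] that(3)] q(2)[OF that(1)] that(2) by simp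
  define E where "E j = (\<lambda>i. if i = j then \<one>\<^bsub>KG\<^esub> else \<zero>\<^bsub>KG\<^esub>)" for j :: "((('g \<Rightarrow> 'k) \<times> (('k \<times> 'm) \<Rightarrow>\<^sub>0 int) set) \<Rightarrow>\<^sub>0 int) set"
  have E: "E j \<in> carrier ?F" if "j \<in> I" for j
  proof -
    have "{i. E j i \<noteq> \<zero>\<^bsub>KG\<^esub>} \<subseteq> {j}" by (auto simp: E_def)
    then have "finite {i. E j i \<noteq> \<zero>\<^bsub>KG\<^esub>}" by (rule finite_subset) simp
    moreover have "E j i \<in> order_G" for i using oG(2,3) by (simp add: E_def)
    ultimately show ?thesis unfolding Fr using that by (auto simp: E_def)
  qed
  \<comment> \<open>\<open>J\<close> only has to contain the support, so that clearing one entry of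
    \<open>c\<close> leaves a vector to which the induction hypothesis applies.\<close>
  have expand: "q c = (\<Oplus>\<^bsub>KG\<^esub>j\<in>J. c j \<star> q (E j))"
    if "finite J" "J \<subseteq> I" "c \<in> carrier ?F" "{i. c i \<noteq> \<zero>\<^bsub>KG\<^esub>} \<subseteq> J" for J c
    using that
  proof (induction J arbitrary: c rule: finite_induct)
    case empty
    \<comment> \<open>A vector without support equals zero times itself, so linearity of
      \<open>p\<close> shows that \<open>p c\<close> is the class of zero.\<close>
    have "c = \<zero>\<^bsub>KG\<^esub> \<odot>\<^bsub>?F\<^esub> c"
      unfolding Fr using empty(2,3) KG.l_null[OF oK] by (auto simp: Fr(1) fun_eq_iff)
    then have "p c = p (\<zero>\<^bsub>KG\<^esub> \<odot>\<^bsub>?F\<^esub> c)" by (rule arg_cong)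
    also have "\<dots> = \<zero>\<^bsub>KG\<^esub> \<odot>\<^bsub>IndFM\<^esub> psi (q c)"
      unfolding p_lin[OF oG(2) empty(2)] q(2)[OF empty(2)] ..
    also have "\<dots> = psi (\<zero>\<^bsub>KG\<^esub> \<star> q c)" by (rule psi_smult[OF KG.zero_closed yK[OF q(1)[OF empty(2)]]])
    also have "\<zero>\<^bsub>KG\<^esub> \<star> q c = \<zero>\<^bsub>KG\<^esub>" by (rule KG.l_null[OF yK[OF q(1)[OF empty(2)]]])
    finally show ?case using qI[OF empty(2) _ KG.zero_closed] KG.finsum_empty by simp
  next
    case (insert j J)
    let ?c = "c(j := \<zero>\<^bsub>KG\<^esub>)"
    have c: "c i \<in> order_G" for i using insert.prems(2) unfolding Fr by blast
    have jI: "j \<in> I" using insert.prems by blast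
    have c'F: "?c \<in> carrier ?F"
    proof -
      have "{i. ?c i \<noteq> \<zero>\<^bsub>KG\<^esub>} \<subseteq> {i. c i \<noteq> \<zero>\<^bsub>KG\<^esub>}" by auto
      moreover have "finite {i. c i \<noteq> \<zero>\<^bsub>KG\<^esub>}" using insert.prems(2) unfolding Fr by blast
      ultimately have "finite {i. ?c i \<noteq> \<zero>\<^bsub>KG\<^esub>}" by (rule finite_subset)
      moreover have "?c i \<in> order_G" for i using c oG(2) by simp
      moreover have "\<forall>i. i \<notin> I \<longrightarrow> ?c i = \<zero>\<^bsub>KG\<^esub>" using insert.prems(2) unfolding Fr by simp
      ultimately show ?thesis unfolding Fr by blast
    qed
    have cE: "c j \<odot>\<^bsub>?F\<^esub> E j \<in> carrier ?F"
    proof -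
      have "{i. (c j \<odot>\<^bsub>?F\<^esub> E j) i \<noteq> \<zero>\<^bsub>KG\<^esub>} \<subseteq> {j}"
        unfolding Fr E_def using KG.r_null[OF oK[OF c]] by auto
      then have "finite {i. (c j \<odot>\<^bsub>?F\<^esub> E j) i \<noteq> \<zero>\<^bsub>KG\<^esub>}" by (rule finite_subset) simp
      moreover have "(c j \<odot>\<^bsub>?F\<^esub> E j) i \<in> order_G" for i
        using oG(6)[OF c] E[OF jI] unfolding Fr by blast
      moreover have "\<forall>i. i \<notin> I \<longrightarrow> (c j \<odot>\<^bsub>?F\<^esub> E j) i = \<zero>\<^bsub>KG\<^esub>"
        unfolding Fr E_def using jI KG.r_null[OF oK[OF c]] by auto
      ultimately show ?thesis unfolding Fr(1) by blast
    qed
    have split: "c = c j \<odot>\<^bsub>?F\<^esub> E j \<oplus>\<^bsub>?F\<^esub> ?c"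
    proof
      fix i
      show "c i = (c j \<odot>\<^bsub>?F\<^esub> E j \<oplus>\<^bsub>?F\<^esub> ?c) i"
      proof (cases "i = j")
        case True
        have "c j = c j \<star> \<one>\<^bsub>KG\<^esub> \<oplus>\<^bsub>KG\<^esub> \<zero>\<^bsub>KG\<^esub>"
          unfolding KG.r_one[OF oK[OF c]] KG.r_zero[OF oK[OF c]] ..
        then show ?thesis unfolding Fr(2,3) E_def using True by (simp del: group_ring_simps)
      next
        case False
        have "c i = c j \<star> \<zero>\<^bsub>KG\<^esub> \<oplus>\<^bsub>KG\<^esub> c i"
          unfolding KG.r_null[OF oK[OF c]] KG.l_zero[OF oK[OF c]] ..
        then show ?thesis unfolding Fr(2,3) E_def using False by (simp del: group_ring_simps)
      qed
    qed
    have qE: "q (E j) \<in> carrier KG" and qc: "q ?c \<in> carrier KG"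
      using yK[OF q(1)[OF E[OF jI]]] yK[OF q(1)[OF c'F]] by auto
    have cq: "c j \<star> q (E j) \<in> carrier KG" using oK[OF c] qE by (rule KG.m_closed)
    have "p c = p (c j \<odot>\<^bsub>?F\<^esub> E j \<oplus>\<^bsub>?F\<^esub> ?c)" by (rule arg_cong[OF split])
    also have "\<dots> = p (c j \<odot>\<^bsub>?F\<^esub> E j) \<oplus>\<^bsub>IndFM\<^esub> p ?c" by (rule p_add[OF cE c'F])
    also have "p (c j \<odot>\<^bsub>?F\<^esub> E j) = psi (c j \<star> q (E j))"
      unfolding p_lin[OF c E[OF jI]] q(2)[OF E[OF jI], symmetric] by (rule psi_smult[OF oK[OF c] qE])
    also have "p ?c = psi (q ?c)" using q(2)[OF c'F] by simp
    also have "psi (c j \<star> q (E j)) \<oplus>\<^bsub>IndFM\<^esub> psi (q ?c) = psi (c j \<star> q (E j) \<oplus>\<^bsub>KG\<^esub> q ?c)"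
      by (rule psi_add[OF cq qc])
    finally have "q c = c j \<star> q (E j) \<oplus>\<^bsub>KG\<^esub> q ?c"
      using qI[OF insert.prems(2) _ KG.a_closed[OF cq qc]] by blast
    also have "q ?c = (\<Oplus>\<^bsub>KG\<^esub>i\<in>J. ?c i \<star> q (E i))"
    proof (rule insert.IH[OF _ c'F])
      show "J \<subseteq> I" using insert.prems(1) by blast
      show "{i. ?c i \<noteq> \<zero>\<^bsub>KG\<^esub>} \<subseteq> J" using insert.prems(3) by auto
    qed
    also have "\<dots> = (\<Oplus>\<^bsub>KG\<^esub>i\<in>J. c i \<star> q (E i))"
    proof (rule KG.finsum_cong')
      show "(\<lambda>i. c i \<star> q (E i)) \<in> J \<rightarrow> carrier KG"
        using insert.prems(1) KG.m_closed[OF oK[OF c] yK[OF q(1)[OF E]]] by blast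
    qed (use insert(2) in auto)
    also have "c j \<star> q (E j) \<oplus>\<^bsub>KG\<^esub> \<dots> = (\<Oplus>\<^bsub>KG\<^esub>i\<in>insert j J. c i \<star> q (E i))"
    proof (rule KG.finsum_insert[symmetric])
      show "(\<lambda>i. c i \<star> q (E i)) \<in> J \<rightarrow> carrier KG"
        using insert.prems(1) KG.m_closed[OF oK[OF c] yK[OF q(1)[OF E]]] by blast
    qed (use insert cq in auto)
    finally show ?case .
  qed
  obtain d where d: "d \<in> R" "d \<noteq> \<zero>\<^bsub>K\<^esub>" "const d \<in> lat" using const_in_lat by blast
  have dI: "const d \<in> ?IL"
    using mult_in_indspan[OF RH_submodule_lat ge_in_RG[OF G.one_closed] d(3)]
      KG.l_one[OF const_KG[OF R_in_K[OF d(1)]]] by simp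
  define \<sigma> where "\<sigma> j y = s (psi y) j" for j y
  \<comment> \<open>The dual basis is cut down to the finitely many indices at which the scalar
    \<open>d\<close> has a nonzero coordinate.\<close>
  let ?J = "{j. \<sigma> j (const d) \<noteq> \<zero>\<^bsub>KG\<^esub>}"
  have sF: "s (psi (const d)) \<in> carrier ?F" by (rule s_cl[OF dI])
  have J: "finite ?J" "?J \<subseteq> I" using sF unfolding Fr \<sigma>_def by blast+
  have "q (s (psi (const d))) = const d"
    using ps[of "psi (const d)"] dI by (intro qI[OF sF _ yK[OF dI]]) simp
  then have dual: "const d = (\<Oplus>\<^bsub>KG\<^esub>j\<in>?J. \<sigma> j (const d) \<star> q (E j))"
    using expand[OF J sF] unfolding \<sigma>_def by simp
  have "order_H \<subseteq> order_G"
  proof (rule order_H_subset_order_G[where \<sigma> = \<sigma> and \<mu> = "\<lambda>j. q (E j)", OF comm H d _ _ _ dual])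
    show "\<sigma> j y \<in> order_G" if "y \<in> ?IL" for j y
      using s_cl[OF that] unfolding Fr \<sigma>_def by blast
    show "\<sigma> j (b \<star> y) = b \<star> \<sigma> j y" if "b \<in> order_G" "y \<in> ?IL" for j b y
      unfolding \<sigma>_def s_lin[OF that] Fr ..
    show "q (E j) \<in> ?IL" if "j \<in> ?J" for j using q(1)[OF E] that J(2) by blast
  qed
  then have "scaled_trace i \<in> order_G" if "i \<le> r" for i using scaled_trace_order_H[OF that] by blast
  then show ?thesis using normal_if_scaled_trace_translates order_G_iff by blast
qed

end

text \<open>It remains to extract from the hypotheses the data of \<open>trace_lattice\<close>: an
  element \<open>\<pi>\<close> whose inverse lies outside \<open>R\<close>, a generator
  \<open>v\<close>, and natural exponents.\<close>

theorem theorem7p4: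
  fixes F :: "'k ring" and R :: "'k set" and \<pi> :: 'k
    and G :: "'g monoid" and H :: "'g set" and M :: "('g \<Rightarrow> 'k, 'm) module"
    and r :: nat and n :: "nat \<Rightarrow> int" and P :: "nat \<Rightarrow> 'g set"
  assumes "fraction_field_of F R" and "char_zero F"
    and "discrete_valuation_ring (F\<lparr>carrier := R\<rparr>)"
    and "uniformizer (F\<lparr>carrier := R\<rparr>) \<pi>"
    and "finite (carrier (F\<lparr>carrier := R\<rparr> Quot (PIdl\<^bsub>F\<lparr>carrier := R\<rparr>\<^esub> \<pi>)))"
    and "group G" and "finite (carrier G)" and "subgroup H G"
    and "group_ring_lattice (F\<lparr>carrier := R\<rparr>) (G\<lparr>carrier := H\<rparr>) M"
    and "is_free_of_rank (group_ring F (G\<lparr>carrier := H\<rparr>)) (generic_fibre F R (G\<lparr>carrier := H\<rparr>) M) 1"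
    and "n 0 = 0" and "\<forall>i < r. n i < n (Suc i)"
    and "P 0 = {\<one>\<^bsub>G\<^esub>}" and "\<forall>i < r. P i \<subset> P (Suc i)" and "P r \<subseteq> H"
    and "\<forall>i \<le> r. subgroup (P i) G"
    and "order_of_lattice F R G H M = trace_sum F R (G\<lparr>carrier := H\<rparr>) \<pi> r n P"
  shows "(Ind_subset F R G H (order_of_lattice F R G H M) = trace_sum F R G \<pi> r n P) \<and>
    (order_of_Ind F R G H M = trace_sum F R G \<pi> r n (\<lambda>i. ncl G (P i))) \<and>
    (subring (Ind_subset F R G H (order_of_lattice F R G H M)) (group_ring F G)
       \<longleftrightarrow> (\<forall>i \<le> r. P i \<lhd> G)) \<and>
    ((\<forall>i \<le> r. P i \<lhd> G) \<and>
     is_free ((group_ring F (G\<lparr>carrier := H\<rparr>))\<lparr>carrier := order_of_lattice F R G H M\<rparr>)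
       ((generic_fibre F R (G\<lparr>carrier := H\<rparr>) M)\<lparr>carrier := lattice_in F R (G\<lparr>carrier := H\<rparr>) M\<rparr>)
       \<longrightarrow> is_free ((group_ring F G)\<lparr>carrier := order_of_Ind F R G H M\<rparr>)
             (regular_module (group_ring F G)
                (Ind_subset F R G H (order_of_lattice F R G H M)))) \<and>
    (comm_group (G\<lparr>carrier := H\<rparr>) \<and> H \<lhd> G \<and>
     is_projective ((group_ring F G)\<lparr>carrier := order_of_Ind F R G H M\<rparr>)
       ((Ind F G H (generic_fibre F R (G\<lparr>carrier := H\<rparr>) M))\<lparr>carrier := Ind_lattice F R G H M\<rparr>)
       \<longrightarrow> (\<forall>i \<le> r. P i \<lhd> G))"
proof -
  let ?R = "F\<lparr>carrier := R\<rparr>" and ?GH = "G\<lparr>carrier := H\<rparr>"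
  let ?FM = "generic_fibre F R ?GH M"
  interpret F: field F using assms(1) by (simp add: fraction_field_of_def)
  interpret G: group G by fact
  have R: "subring R F" using assms(1) by (simp add: fraction_field_of_def)
  interpret R: domain ?R by (rule F.subring_is_domain[OF R])
  have pi_R: "\<pi> \<in> R" and max: "maximalideal (PIdl\<^bsub>?R\<^esub> \<pi>) ?R"
    using assms(4) by (simp_all add: uniformizer_def)
  have pi_F: "\<pi> \<in> carrier F" using pi_R subringE(1)[OF R] by blast
  \<comment> \<open>A zero uniformizer would make the zero ideal maximal and \<open>R\<close> a
    field.\<close>
  have pi0: "\<pi> \<noteq> \<zero>\<^bsub>F\<^esub>"
  proof
    assume "\<pi> = \<zero>\<^bsub>F\<^esub>"
    then have "PIdl\<^bsub>?R\<^esub> \<pi> = {\<zero>\<^bsub>?R\<^esub>}"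
      using R.cgenideal_eq_genideal[of \<pi>] R.genideal_zero pi_R by simp
    then have "field ?R" using max R.zeromaximalideal_fieldI by simp
    then show False using assms(3) by (simp add: discrete_valuation_ring_def)
  qed
  \<comment> \<open>A uniformizer invertible in \<open>R\<close> would generate the whole ring,
    which is not a maximal ideal.\<close>
  have pi_unit: "inv\<^bsub>F\<^esub> \<pi> \<notin> R"
  proof
    assume i: "inv\<^bsub>F\<^esub> \<pi> \<in> R"
    have "inv\<^bsub>F\<^esub> \<pi> \<otimes>\<^bsub>F\<^esub> \<pi> = \<one>\<^bsub>F\<^esub>" using pi_F pi0 F.field_Units by simp
    then have "\<one>\<^bsub>?R\<^esub> \<in> PIdl\<^bsub>?R\<^esub> \<pi>" using i by (auto simp: cgenideal_def intro!: exI[of _ "inv\<^bsub>F\<^esub> \<pi>"])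
    then have "PIdl\<^bsub>?R\<^esub> \<pi> = carrier ?R"
      using ideal.one_imp_carrier[OF maximalideal.axioms(1)[OF max]] by blast
    then show False using maximalideal.I_notcarr[OF max] by simp
  qed
  have lmM: "left_module (group_ring ?R ?GH) M" using assms(9) by (simp add: group_ring_lattice_def)
  have lmF: "left_module (group_ring F ?GH) ?FM" using assms(10) by (simp add: is_free_of_rank_def)
  obtain v where v: "module_basis (group_ring F ?GH) ?FM {v}"
    using assms(10) by (auto simp: is_free_of_rank_def card_1_singleton_iff)
  have vc: "v \<in> carrier ?FM" using v by (simp add: module_basis_def)
  interpret FM: left_module "group_ring F ?GH" ?FM by (rule lmF)
  \<comment> \<open>Coefficient functions supported at \<open>v\<close> are determined by their
    value there, so a one-element basis amounts to a bijection from \<open>F[H]\<close> onto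
    \<open>FM\<close>.\<close>
  have vb: "bij_betw (\<lambda>l. l \<odot>\<^bsub>?FM\<^esub> v) (carrier (group_ring F ?GH)) (carrier ?FM)"
  proof -
    let ?K = "group_ring F ?GH"
    let ?e = "\<lambda>l i. if i = v then l else \<zero>\<^bsub>?K\<^esub>"
    \<comment> \<open>The sum runs over the support of the coefficient function, which is empty when
      \<open>l\<close> is zero.\<close>
    have lin: "lin_comb ?K ?FM (?e l) = l \<odot>\<^bsub>?FM\<^esub> v" if l: "l \<in> carrier ?K" for l
    proof (cases "l = \<zero>\<^bsub>?K\<^esub>")
      case True
      then have "{b. ?e l b \<noteq> \<zero>\<^bsub>?K\<^esub>} = {}" by auto
      then show ?thesis unfolding lin_comb_def using FM.smult_zero_left[OF vc] True by simp
    next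
      case False
      then have "{b. ?e l b \<noteq> \<zero>\<^bsub>?K\<^esub>} = {v}" by auto
      then show ?thesis unfolding lin_comb_def
        using FM.smult_closed[OF l vc] FM.V.finsum_insert[of "{}" v "\<lambda>b. ?e l b \<odot>\<^bsub>?FM\<^esub> b"] FM.V.finsum_empty by simp
    qed
    have "bij_betw ?e (carrier ?K) (carrier (free_module ?K {v}))"
    proof (rule bij_betwI[where g = "\<lambda>c. c v"])
      show "?e \<in> carrier ?K \<rightarrow> carrier (free_module ?K {v})"
      proof
        fix l assume l: "l \<in> carrier ?K"
        have "{i. ?e l i \<noteq> \<zero>\<^bsub>?K\<^esub>} \<subseteq> {v}" by auto
        then have "finite {i. ?e l i \<noteq> \<zero>\<^bsub>?K\<^esub>}" by (rule finite_subset) simp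
        then show "?e l \<in> carrier (free_module ?K {v})"
          using l FM.A.zero_closed by (simp add: free_module_def)
      qed
      show "(\<lambda>c. c v) \<in> carrier (free_module ?K {v}) \<rightarrow> carrier ?K" by (simp add: free_module_def)
      show "?e (c v) = c" if "c \<in> carrier (free_module ?K {v})" for c
        using that by (auto simp: free_module_def)
    qed simp
    moreover have "bij_betw (lin_comb ?K ?FM) (carrier (free_module ?K {v})) (carrier ?FM)"
      using v by (simp add: module_basis_def)
    ultimately have "bij_betw (lin_comb ?K ?FM \<circ> ?e) (carrier ?K) (carrier ?FM)" by (rule bij_betw_trans)
    then show ?thesis using lin by (subst (asm) bij_betw_cong[of _ _ "\<lambda>l. l \<odot>\<^bsub>?FM\<^esub> v"]) auto
  qed
  \<comment> \<open>The start at zero and the strict growth exclude negative exponents, so passing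
    to naturals loses nothing.\<close>
  have n_nonneg: "n i \<ge> 0" if "i \<le> r" for i
    using that
  proof (induction i)
    case (Suc i)
    then have "0 \<le> n i" "n i < n (Suc i)" using assms(12) by auto
    then show ?case by simp
  qed (simp add: assms(11))
  interpret T: trace_lattice F G R \<pi> H M v r n P "\<lambda>i. nat (n i)"
  proof -
    have "finite_group_ring F G"
      unfolding finite_group_ring_def finite_group_ring_axioms_def
      using F.ring_axioms G.group_axioms assms(7) by blast
    then have "valued_group_ring F G R \<pi>"
      unfolding valued_group_ring_def valued_group_ring_axioms_def
      using F.field_axioms R pi_R pi0 pi_unit by blast
    then have "group_ring_induction F G R \<pi> H"
      unfolding group_ring_induction_def group_ring_induction_axioms_def using assms(8) by blast
    moreover have "\<exists>a\<in>R. \<exists>b\<in>R - {\<zero>\<^bsub>F\<^esub>}. x = a \<otimes>\<^bsub>F\<^esub> inv\<^bsub>F\<^esub> b" if "x \<in> carrier F" for x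
      using assms(1) that by (simp add: fraction_field_of_def)
    ultimately have "induced_lattice F G R \<pi> H M v"
      unfolding induced_lattice_def induced_lattice_axioms_def using lmM lmF vc vb by blast
    moreover have "\<forall>i\<le>r. n i = int (nat (n i))" using n_nonneg by simp
    moreover have "\<forall>i<r. nat (n i) < nat (n (Suc i))"
    proof (intro allI impI)
      fix i assume i: "i < r"
      have "0 \<le> n i" "n i < n (Suc i)" using n_nonneg[of i] assms(12) i by auto
      then show "nat (n i) < nat (n (Suc i))" by simp
    qed
    moreover have "\<forall>i<r. P i \<subseteq> P (Suc i)" using assms(14) by blast
    ultimately show "trace_lattice F G R \<pi> H M v r n P (\<lambda>i. nat (n i))"
      unfolding trace_lattice_def trace_lattice_axioms_def using assms(13,15,16,17) by blast
  qed
  \<comment> \<open>Under normality the induced order is the order of the induced lattice, so the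
    module is a ring over itself, free on the identity.\<close>
  have "is_free ((group_ring F G)\<lparr>carrier := order_of_Ind F R G H M\<rparr>)
      (regular_module (group_ring F G) (Ind_subset F R G H (order_of_lattice F R G H M)))"
    if "\<forall>i \<le> r. P i \<lhd> G"
    unfolding T.Ind_subset_order_H T.order_G_eq_tsum[OF that]
    using T.KG.is_free_regular_module T.subring_Ind_iff that by blast
  then show ?thesis
    using T.Ind_subset_order_H T.order_G_eq T.subring_Ind_iff T.normal_if_projective by simp
qed

end
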